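(* Let $K=\mathbb{C}(x_1,\ldots,x_n)$ and let $\Omega=\sum_{i=1}^n P_i\,dx_1\wedge\cdots\wedge\widehat{dx_i}\wedge\cdots\wedge dx_n$ with $P_1,\ldots,P_n\in K$. Suppose there exist an elementary extension $L$ of $K$, elements $v\in L$, $u_1,\ldots,u_m\in L^*$ and constants $c_1,\ldots,c_m\in\mathbb{C}$ such that $$\Big(\sum_{i=1}^m c_i\frac{du_i}{u_i}+dv\Big)\wedge\Omega=0,\qquad \sum_{i=1}^m c_i\frac{du_i}{u_i}+dv\neq 0 .$$ Then there exists a finite algebraic extension $\widetilde L$ of $K$ with $\widetilde L\subseteq L$, together with $\widetilde v\in\widetilde L$, $\widetilde u_1,\ldots,\widetilde u_{\widetilde m}\in\widetilde L^*$ and $\widetilde c_1,\ldots,\widetilde c_{\widetilde m}\in\mathbb{C}$, such that $$\Big(\sum_{i} \widetilde c_i\frac{d\widetilde u_i}{\widetilde u_i}+d\widetilde v\Big)\wedge\Omega=0,\qquad \sum_{i} \widetilde c_i\frac{d\widetilde u_i}{\widetilde u_i}+d\widetilde v\neq 0 .$$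
   Context: $K=\mathbb{C}(x_1,\ldots,x_n)$ is a differential field with the commuting derivations $\partial/\partial x_1,\ldots,\partial/\partial x_n$. A differential extension field $F$ of $K$ is a field extension to which these derivations extend (as commuting derivations). For such $F$, one-forms over $F$ are expressions $\sum_i a_i\,dx_i$ with $a_i\in F$, $df:=\sum_i \frac{\partial f}{\partial x_i}dx_i$, and forms are multiplied with the usual exterior (wedge) product, so that a one-form wedged with the $(n-1)$-form $\Omega$ is a multiple of $dx_1\wedge\cdots\wedge dx_n$. A differential extension field $L$ of $K$ is elementary if $K$ and $L$ have the same constants and there is a tower $K=K_0\subset K_1\subset\cdots\subset K_m=L$ such that for each $i$ one of the following holds: (i) $K_{i+1}=K_i(t_i)$ with $t_i\neq0$ and $dt_i/t_i=dR_i$ for some $R_i\in K_i$ (adjoining an exponential); (ii) $K_{i+1}=K_i(t_i)$ with $dt_i=dR_i/R_i$ for some $R_i\in K_i^*$ (adjoining a logarithm); (iii) $K_{i+1}$ is a finite algebraic extension of $K_i$. *)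

theory Defs
  imports Main "HOL-Library.FuncSet" Complex_Main
begin

text \<open>The elementary extension L is modelled as the whole of a field type 'a,
  equipped with n derivations D 0, ..., D (n-1) (standing for the extensions of
  the partial derivatives d/dx_1, ..., d/dx_n).  K = C(x_1,...,x_n) is the
  subfield of 'a generated by an embedded copy iota(C) of the complex numbers
  and by elements x 0, ..., x (n-1) that are algebraically independent over
  iota(C).\<close>

definition subfield :: "'a::field set \<Rightarrow> bool" where
  "subfield F \<longleftrightarrow> 0 \<in> F \<and> 1 \<in> F \<and>
     (\<forall>a\<in>F. \<forall>b\<in>F. a + b \<in> F \<and> a - b \<in> F \<and> a * b \<in> F) \<and>
     (\<forall>a\<in>F. inverse a \<in> F)"

definition gen_field :: "'a::field set \<Rightarrow> 'a set \<Rightarrow> 'a set" where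
  "gen_field S T = \<Inter>{F. subfield F \<and> S \<union> T \<subseteq> F}"

definition finite_ext :: "'a::field set \<Rightarrow> 'a set \<Rightarrow> bool" where
  "finite_ext F E \<longleftrightarrow> subfield F \<and> subfield E \<and> F \<subseteq> E \<and>
     (\<exists>B. finite B \<and> B \<subseteq> E \<and>
        (\<forall>y\<in>E. \<exists>a. (\<forall>b\<in>B. a b \<in> F) \<and> y = (\<Sum>b\<in>B. a b * b)))"

definition field_hom :: "(complex \<Rightarrow> 'a::field) \<Rightarrow> bool" where
  "field_hom \<iota> \<longleftrightarrow> \<iota> 0 = 0 \<and> \<iota> 1 = 1 \<and>
     (\<forall>a b. \<iota> (a + b) = \<iota> a + \<iota> b \<and> \<iota> (a * b) = \<iota> a * \<iota> b)"

definition commuting_derivations :: "nat \<Rightarrow> (nat \<Rightarrow> 'a::field \<Rightarrow> 'a) \<Rightarrow> bool" where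
  "commuting_derivations n D \<longleftrightarrow>
     (\<forall>i<n. \<forall>a b. D i (a + b) = D i a + D i b \<and> D i (a * b) = a * D i b + D i a * b) \<and>
     (\<forall>i<n. \<forall>j<n. \<forall>a. D i (D j a) = D j (D i a))"

definition alg_indep :: "nat \<Rightarrow> (complex \<Rightarrow> 'a::field) \<Rightarrow> (nat \<Rightarrow> 'a) \<Rightarrow> bool" where
  "alg_indep n \<iota> x \<longleftrightarrow>
     (\<forall>S c. finite S \<longrightarrow> (\<forall>\<alpha>\<in>S. \<forall>i. n \<le> i \<longrightarrow> \<alpha> i = (0::nat)) \<longrightarrow>
        (\<Sum>\<alpha>\<in>S. \<iota> (c \<alpha>) * (\<Prod>i<n. x i ^ \<alpha> i)) = 0 \<longrightarrow> (\<forall>\<alpha>\<in>S. c \<alpha> = 0))"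

definition rational_function_field ::
  "nat \<Rightarrow> (nat \<Rightarrow> 'a::field \<Rightarrow> 'a) \<Rightarrow> (complex \<Rightarrow> 'a) \<Rightarrow> (nat \<Rightarrow> 'a) \<Rightarrow> 'a set \<Rightarrow> bool" where
  "rational_function_field n D \<iota> x K \<longleftrightarrow>
     field_hom \<iota> \<and> alg_indep n \<iota> x \<and>
     K = gen_field (range \<iota>) (x ` {..<n}) \<and>
     (\<forall>i<n. \<forall>c. D i (\<iota> c) = 0) \<and>
     (\<forall>i<n. \<forall>j<n. D i (x j) = (if i = j then 1 else 0))"

definition constants :: "nat \<Rightarrow> (nat \<Rightarrow> 'a::field \<Rightarrow> 'a) \<Rightarrow> 'a set \<Rightarrow> 'a set" where
  "constants n D F = {y \<in> F. \<forall>i<n. D i y = 0}"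

definition elementary_step :: "nat \<Rightarrow> (nat \<Rightarrow> 'a::field \<Rightarrow> 'a) \<Rightarrow> 'a set \<Rightarrow> 'a set \<Rightarrow> bool" where
  "elementary_step n D F E \<longleftrightarrow>
     (\<exists>t. E = gen_field F {t} \<and> t \<noteq> 0 \<and> (\<exists>R\<in>F. \<forall>i<n. D i t / t = D i R)) \<or>
     (\<exists>t. E = gen_field F {t} \<and> (\<exists>R\<in>F. R \<noteq> 0 \<and> (\<forall>i<n. D i t = D i R / R))) \<or>
     finite_ext F E"

definition elementary_over :: "nat \<Rightarrow> (nat \<Rightarrow> 'a::field \<Rightarrow> 'a) \<Rightarrow> 'a set \<Rightarrow> bool" where
  "elementary_over n D K \<longleftrightarrow>
     constants n D UNIV = constants n D K \<and>
     (\<exists>m T. T 0 = K \<and> T m = UNIV \<and> (\<forall>i<m. elementary_step n D (T i) (T (Suc i))))"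

definition log_form :: "(nat \<Rightarrow> 'a::field \<Rightarrow> 'a) \<Rightarrow> (complex \<Rightarrow> 'a) \<Rightarrow> nat \<Rightarrow>
    (nat \<Rightarrow> complex) \<Rightarrow> (nat \<Rightarrow> 'a) \<Rightarrow> 'a \<Rightarrow> nat \<Rightarrow> 'a" where
  "log_form D \<iota> m c u v j = (\<Sum>k<m. \<iota> (c k) * D j (u k) / u k) + D j v"

text \<open>(sum_j a_j dx_j) wedge (sum_i P_i dx_1..^dx_i..dx_n)
  = (sum_i (-1)^(i-1) a_i P_i) dx_1...dx_n (1-indexed); here 0-indexed,
  we record the coefficient of dx_1...dx_n.\<close>
definition wedge_Omega :: "nat \<Rightarrow> (nat \<Rightarrow> 'a::field) \<Rightarrow> (nat \<Rightarrow> 'a) \<Rightarrow> 'a" where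
  "wedge_Omega n a P = (\<Sum>i<n. (-1) ^ i * a i * P i)"

end

theory Submission
  imports "Jordan_Normal_Form.Determinant" Defs
begin

text \<open>Contraction with \<open>\<Omega>\<close> is contraction with a vector field \<open>X\<close>, a derivation of \<open>L\<close> with coefficients in
  \<open>K\<close>. Replacing each field \<open>F\<close> of the tower by its relative algebraic closure in \<open>L\<close>, it suffices to
  descend a nonzero logarithmic form \<open>\<omega>\<close> annihilated by \<open>X\<close> from a finite extension \<open>E\<close> of \<open>F(t)\<close> to
  \<open>F\<close>, where \<open>t\<close> is transcendental over \<open>F\<close> and an exponential or logarithm of \<open>R \<in> F\<close>.

  Let \<open>\<theta>\<close> be the extension to \<open>E\<close> of \<open>t d/dt\<close> (exponential) or \<open>d/dt\<close> (logarithm). It commutes with all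
  \<open>D i\<close> and with \<open>X\<close>, so \<open>a = \<Sum> c \<theta>u/u + \<theta>v\<close> satisfies \<open>X a = 0\<close>.
  If \<open>a\<close> is not constant, it is a first integral: either \<open>a \<in> F\<close>, or \<open>t\<close> is algebraic over \<open>F(a)\<close>, and
  applying \<open>X\<close> to its minimal polynomial and then substituting an integer for \<open>a\<close> yields \<open>w \<in> F\<close> with
  \<open>X w = X R / R\<close> or \<open>X w / w = e X R\<close> with \<open>e = [F(a, t) : F(a)]\<close>, hence the form \<open>dR/R - dw\<close> or
  \<open>dw/w - e dR\<close> over \<open>F\<close>.
  If \<open>a\<close> is constant, subtract \<open>a (dt - dR/R) = 0\<close> or \<open>a (dt/t - dR) = 0\<close> from \<open>\<omega>\<close> to get \<open>a = 0\<close>. Then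
  the coefficients of \<open>\<omega>\<close> are killed by \<open>\<theta>\<close>, so they lie in \<open>F\<close>; therefore passing to norms and traces
  over \<open>F(t)\<close> only multiplies \<open>\<omega>\<close> by \<open>[E : F(t)]\<close>, and reading off the result at \<open>t = \<infinity>\<close> expresses it
  over \<open>F\<close>.\<close>

section \<open>Relative algebraic closure and finite extensions\<close>


text \<open>Norms and traces alone cannot carry the descent, since the trace of a nonzero form may
  vanish. They are safe only for a form whose coefficients lie in \<open>F\<close>, and
  \<open>a\<close> measures the obstruction: \<theta> of the coefficient \<open>i\<close> of
  \<omega> is \<open>D i a\<close>. A nonconstant \<open>a\<close> is not a failure but a first
  integral, from which a new form is built; its contraction \<open>X a\<close> is 0 because the
  coefficients of \<Omega> lie in \<open>K\<close> and are killed by \<theta>. Normalising to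
  \<open>a = 0\<close> is what makes the reading at infinity work: it forces the polynomial part of
  \<open>v\<close> to be constant and, for an exponential, cancels the contributions of the degrees
  of the \<open>u k\<close>. That reading also relies on \<open>D i t\<close> being affine in
  \<open>t\<close> over \<open>F\<close>, so that no \<open>D i\<close> raises degrees; the same
  shape makes \<theta> and \<open>D i\<close> commute. The forms built from a first integral are
  nonzero because there are no new constants: otherwise \<open>t - w\<close> or
  \<open>w / t ^ e\<close> would be a complex constant and \<open>t\<close> would be algebraic over
  \<open>F\<close>. Relative closure makes algebraic steps of the tower invisible and turns
  \<open>t\<close> outside \<open>F\<close> into transcendence; a finite extension is chosen only at
  the end.\<close>

lemma subfield_zero: "subfield F \<Longrightarrow> 0 \<in> F"
  and subfield_one: "subfield F \<Longrightarrow> 1 \<in> F"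
  and subfield_add: "subfield F \<Longrightarrow> a \<in> F \<Longrightarrow> b \<in> F \<Longrightarrow> a + b \<in> F"
  and subfield_diff: "subfield F \<Longrightarrow> a \<in> F \<Longrightarrow> b \<in> F \<Longrightarrow> a - b \<in> F"
  and subfield_mult: "subfield F \<Longrightarrow> a \<in> F \<Longrightarrow> b \<in> F \<Longrightarrow> a * b \<in> F"
  and subfield_inverse: "subfield F \<Longrightarrow> a \<in> F \<Longrightarrow> inverse a \<in> F"
  by (auto simp: subfield_def)

lemma subfield_uminus: "subfield F \<Longrightarrow> a \<in> F \<Longrightarrow> - a \<in> F"
  using subfield_diff[of F 0 a] subfield_zero[of F] by simp

lemma subfield_divide: "subfield F \<Longrightarrow> a \<in> F \<Longrightarrow> b \<in> F \<Longrightarrow> a / b \<in> F"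
  by (simp add: divide_inverse subfield_mult subfield_inverse)

lemma subfield_power: "subfield F \<Longrightarrow> a \<in> F \<Longrightarrow> a ^ n \<in> F"
  by (induction n) (auto simp: subfield_one subfield_mult)

lemma subfield_sum: "subfield F \<Longrightarrow> (\<And>i. i \<in> I \<Longrightarrow> f i \<in> F) \<Longrightarrow> (\<Sum>i\<in>I. f i) \<in> F"
  by (induction I rule: infinite_finite_induct) (auto simp: subfield_zero subfield_add)

lemma subfield_prod: "subfield F \<Longrightarrow> (\<And>i. i \<in> I \<Longrightarrow> f i \<in> F) \<Longrightarrow> (\<Prod>i\<in>I. f i) \<in> F"
  by (induction I rule: infinite_finite_induct) (auto simp: subfield_one subfield_mult)

lemma subfield_of_nat: "subfield F \<Longrightarrow> of_nat n \<in> F"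
  by (induction n) (auto simp: subfield_zero subfield_one subfield_add)

lemmas subfield_intros = subfield_zero subfield_one subfield_add subfield_diff subfield_mult
  subfield_inverse subfield_uminus subfield_divide subfield_power subfield_sum subfield_prod
  subfield_of_nat

lemma subfield_UNIV: "subfield (UNIV :: 'a::field set)"
  by (simp add: subfield_def)

lemma subfield_gen_field: "subfield (gen_field S T)"
  unfolding gen_field_def subfield_def by blast

lemma gen_field_superset: "S \<union> T \<subseteq> gen_field S T"
  unfolding gen_field_def by blast

lemma gen_field_least: "subfield F \<Longrightarrow> S \<subseteq> F \<Longrightarrow> T \<subseteq> F \<Longrightarrow> gen_field S T \<subseteq> F"
  unfolding gen_field_def by blast

text \<open>Subfields are sets inside one field type, so a polynomial over a subfield stays in the
  ambient polynomial type; evaluating it outside the subfield then takes no embedding.\<close>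

definition poly_over :: "'a::field set \<Rightarrow> 'a poly set" where
  "poly_over F = {p. \<forall>i. coeff p i \<in> F}"

lemma poly_over_coeff: "p \<in> poly_over F \<Longrightarrow> coeff p i \<in> F"
  by (simp add: poly_over_def)

lemma poly_over_mono: "F \<subseteq> E \<Longrightarrow> p \<in> poly_over F \<Longrightarrow> p \<in> poly_over E"
  by (auto simp: poly_over_def)

context
  fixes F :: "'a::field set"
  assumes F: "subfield F"
begin

lemma poly_over_zero: "0 \<in> poly_over F"
  and poly_over_add: "p \<in> poly_over F \<Longrightarrow> q \<in> poly_over F \<Longrightarrow> p + q \<in> poly_over F"
  and poly_over_diff: "p \<in> poly_over F \<Longrightarrow> q \<in> poly_over F \<Longrightarrow> p - q \<in> poly_over F"
  and poly_over_smult: "a \<in> F \<Longrightarrow> p \<in> poly_over F \<Longrightarrow> smult a p \<in> poly_over F"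
  and poly_over_mult: "p \<in> poly_over F \<Longrightarrow> q \<in> poly_over F \<Longrightarrow> p * q \<in> poly_over F"
  and poly_over_pderiv: "p \<in> poly_over F \<Longrightarrow> pderiv p \<in> poly_over F"
  and poly_over_monom: "a \<in> F \<Longrightarrow> monom a n \<in> poly_over F"
  using F unfolding poly_over_def
  by (auto simp: subfield_intros coeff_mult coeff_pderiv simp del: of_nat_Suc)

lemma poly_over_pCons_iff: "pCons a p \<in> poly_over F \<longleftrightarrow> a \<in> F \<and> p \<in> poly_over F"
  unfolding poly_over_def by (auto simp: coeff_pCons split: nat.splits) 

lemma poly_over_one: "1 \<in> poly_over F"
  using poly_over_monom[OF subfield_one[OF F], of 0] by simp

lemma poly_over_sum: "(\<And>i. i \<in> I \<Longrightarrow> f i \<in> poly_over F) \<Longrightarrow> (\<Sum>i\<in>I. f i) \<in> poly_over F"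
  by (induction I rule: infinite_finite_induct) (auto simp: poly_over_zero poly_over_add)

lemma poly_over_eval: "p \<in> poly_over F \<Longrightarrow> y \<in> F \<Longrightarrow> poly p y \<in> F"
  unfolding poly_altdef using F by (auto intro!: subfield_intros simp: poly_over_coeff)

lemma poly_over_map_poly: "p \<in> poly_over F \<Longrightarrow> (\<And>a. a \<in> F \<Longrightarrow> f a \<in> F) \<Longrightarrow> f 0 = 0 \<Longrightarrow> map_poly f p \<in> poly_over F"
  unfolding poly_over_def by (auto simp: coeff_map_poly)

text \<open>Long division by induction on \<open>degree p\<close>: each step divides by
  \<open>lead_coeff g\<close> only, so quotient and remainder keep their coefficients in
  \<open>F\<close>.\<close>

lemma poly_over_division:
  assumes g: "g \<in> poly_over F" "g \<noteq> 0" and p: "p \<in> poly_over F"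
  shows "\<exists>h r. h \<in> poly_over F \<and> r \<in> poly_over F \<and> p = g * h + r \<and> (r = 0 \<or> degree r < degree g)"
  using p
proof (induction "degree p" arbitrary: p rule: less_induct)
  case less
  show ?case
  proof (cases "p = 0 \<or> degree p < degree g")
    case True
    then show ?thesis using less.prems poly_over_zero by (intro exI[of _ 0] exI[of _ p]) auto
  next
    case False
    then have pg: "p \<noteq> 0" "degree g \<le> degree p" by auto
    define a where "a = lead_coeff p / lead_coeff g"
    define s where "s = monom a (degree p - degree g)"
    have a0: "a \<noteq> 0" using pg g unfolding a_def by simp
    have s: "s \<in> poly_over F" unfolding s_def a_def using F less.prems g
      by (auto intro!: poly_over_monom subfield_divide poly_over_coeff)
    have "s \<noteq> 0" "degree s = degree p - degree g" using a0 by (simp_all add: s_def degree_monom_eq)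
    then have dsg: "degree (g * s) = degree p" using pg g by (simp add: degree_mult_eq)
    have "lead_coeff (g * s) = lead_coeff g * a" using a0
      by (simp add: lead_coeff_mult s_def degree_monom_eq)
    then have "lead_coeff (g * s) = lead_coeff p" using g by (simp add: a_def)
    then have cf: "coeff (p - g * s) (degree p) = 0" using dsg by simp
    have in': "p - g * s \<in> poly_over F" using s g less.prems by (intro poly_over_diff poly_over_mult)
    have le: "degree (p - g * s) \<le> degree p" using dsg by (simp add: degree_diff_le)
    \<comment> \<open>At degree 0 the degree cannot drop any further; there the vanishing top
      coefficient already makes the difference 0.\<close>
    show ?thesis
    proof (cases "degree p = 0 \<or> p - g * s = 0")
      case True
      then have "p - g * s = 0" using cf le by (metis le_zero_eq leading_coeff_0_iff)
      then show ?thesis using s poly_over_zero by (intro exI[of _ s] exI[of _ 0]) auto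
    next
      case False
      then have "degree (p - g * s) < degree p" using cf le
        by (metis le_neq_implies_less leading_coeff_0_iff)
      from less.hyps[OF this in'] obtain h r where hr: "h \<in> poly_over F" "r \<in> poly_over F"
        "p - g * s = g * h + r" "r = 0 \<or> degree r < degree g" by blast
      have "p = g * (h + s) + r" using hr(3) by (simp add: algebra_simps)
      then show ?thesis using hr s by (intro exI[of _ "h + s"] exI[of _ r]) (auto intro: poly_over_add)
    qed
  qed
qed

end

section \<open>Algebraic elements and linear dependence over a subfield\<close>

definition acl :: "'a::field set \<Rightarrow> 'a set" where
  "acl F = {y. \<exists>p\<in>poly_over F. p \<noteq> 0 \<and> poly p y = 0}"

definition lspan :: "'a::field set \<Rightarrow> 'i set \<Rightarrow> ('i \<Rightarrow> 'a) \<Rightarrow> 'a set" where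
  "lspan F I b = {y. \<exists>a. (\<forall>i. a i \<in> F) \<and> y = (\<Sum>i\<in>I. a i * b i)}"

lemma acl_mono: "F \<subseteq> E \<Longrightarrow> acl F \<subseteq> acl E"
  unfolding acl_def using poly_over_mono by blast

lemma acl_superset: assumes "subfield F" shows "F \<subseteq> acl F"
proof
  fix y assume "y \<in> F"
  then have "[:-y, 1:] \<in> poly_over F" using assms
    by (simp add: poly_over_pCons_iff poly_over_zero subfield_intros)
  then show "y \<in> acl F" unfolding acl_def by (auto intro!: bexI[of _ "[:-y,1:]"])
qed

text \<open>Gaussian elimination: a pivot \<open>k\<close> whose expression involves
  \<open>b x\<close> removes that generator from all other \<open>y j\<close>, at the cost of one
  element and one generator. Indexing by \<open>J\<close> counts coinciding elements, such as equal
  powers, separately.\<close>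

lemma lspan_dependent:
  assumes F: "subfield F" and "finite I" "finite J" "card I < card J" "\<And>j. j \<in> J \<Longrightarrow> y j \<in> lspan F I b"
  shows "\<exists>a. (\<forall>j. a j \<in> F) \<and> (\<exists>j\<in>J. a j \<noteq> 0) \<and> (\<Sum>j\<in>J. a j * y j) = 0"
  using assms(2-)
proof (induction I arbitrary: J y rule: finite_induct)
  case empty
  then have "\<And>j. j \<in> J \<Longrightarrow> y j = 0" "J \<noteq> {}" by (auto simp: lspan_def)
  then show ?case using F by (intro exI[of _ "\<lambda>_. 1"]) (auto simp: subfield_intros)
next
  case (insert x I)
  have "\<forall>j\<in>J. \<exists>a. (\<forall>i. a i \<in> F) \<and> y j = (\<Sum>i\<in>insert x I. a i * b i)"
    using insert.prems(3) unfolding lspan_def by blast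
  then obtain A where "\<forall>j\<in>J. (\<forall>i. A j i \<in> F) \<and> y j = (\<Sum>i\<in>insert x I. A j i * b i)"
    by metis
  then have A: "\<And>j i. j \<in> J \<Longrightarrow> A j i \<in> F" "\<And>j. j \<in> J \<Longrightarrow> y j = A j x * b x + (\<Sum>i\<in>I. A j i * b i)"
    using insert.hyps by auto
  show ?case
  proof (cases "\<forall>j\<in>J. A j x = 0")
    case True
    then have "\<And>j. j \<in> J \<Longrightarrow> y j \<in> lspan F I b" using A unfolding lspan_def by fastforce
    then show ?thesis using insert.IH[of J y] insert.prems insert.hyps by simp
  next
    case False
    then obtain k where k: "k \<in> J" "A k x \<noteq> 0" by blast
    define r where "r j = A j x / A k x" for j
    have rF: "j \<in> J \<Longrightarrow> r j \<in> F" for j unfolding r_def using A(1) k F by (auto intro: subfield_intros)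
    have "y j - r j * y k \<in> lspan F I b" if "j \<in> J - {k}" for j
    proof -
      have "y j - r j * y k = (\<Sum>i\<in>I. A j i * b i) - r j * (\<Sum>i\<in>I. A k i * b i)"
        using that k A(2)[of j] A(2)[of k] unfolding r_def by (simp add: field_simps)
      also have "\<dots> = (\<Sum>i\<in>I. (A j i - r j * A k i) * b i)"
        by (simp add: sum_subtractf sum_distrib_left algebra_simps)
      finally show ?thesis unfolding lspan_def using A(1) that k rF F
        by (auto intro!: exI[of _ "\<lambda>i. A j i - r j * A k i"] subfield_intros)
    qed
    moreover have "card I < card (J - {k})" using insert k by simp
    ultimately obtain a where a: "\<forall>j. a j \<in> F" "\<exists>j\<in>J-{k}. a j \<noteq> 0" "(\<Sum>j\<in>J-{k}. a j * (y j - r j * y k)) = 0"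
      using insert.IH[of "J - {k}" "\<lambda>j. y j - r j * y k"] insert.prems by auto
    \<comment> \<open>Undoing the elimination gives the pivot the coefficient \<open>- s\<close> in
      the lifted relation.\<close>
    define s where "s = (\<Sum>j\<in>J-{k}. a j * r j)"
    have sF: "s \<in> F" unfolding s_def using a rF F by (auto intro!: subfield_intros)
    have "(\<Sum>j\<in>J-{k}. a j * y j) = s * y k" using a(3) unfolding s_def
      by (simp add: algebra_simps sum_subtractf sum_distrib_left)
    then have "(\<Sum>j\<in>J. (a(k := - s)) j * y j) = 0" using k insert.prems(1)
      by (subst sum.remove[of J k]) auto
    moreover have "\<exists>j\<in>J. (a(k := - s)) j \<noteq> 0" using a by auto
    ultimately show ?thesis using a sF F by (intro exI[of _ "a(k := - s)"]) (auto simp: subfield_uminus)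
  qed
qed

text \<open>The first \<open>card I + 1\<close> powers are linearly dependent, and the coefficients
  of the dependence form an annihilating polynomial.\<close>

lemma acl_of_powers_in_lspan:
  assumes F: "subfield F" and I: "finite I" and y: "\<And>i. y ^ i \<in> lspan F I b"
  shows "y \<in> acl F"
proof -
  obtain a where a: "\<forall>j. a j \<in> F" "\<exists>j\<in>{..card I}. a j \<noteq> 0" "(\<Sum>j\<le>card I. a j * y ^ j) = 0"
    using lspan_dependent[OF F I, of "{..card I}" "\<lambda>i. y ^ i" b] y by auto
  define p where "p = (\<Sum>j\<le>card I. monom (a j) j)"
  have "coeff p j = a j" if "j \<le> card I" for j
    unfolding p_def coeff_sum using that by simp
  then have "p \<noteq> 0" using a(2) by auto
  moreover have "p \<in> poly_over F" unfolding p_def using F a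
    by (auto intro: poly_over_sum poly_over_monom)
  moreover have "poly p y = 0" using a(3) unfolding p_def by (simp add: poly_sum poly_monom)
  ultimately show ?thesis unfolding acl_def by blast
qed

text \<open>A relation \<open>a + y * poly p y = 0\<close> with \<open>a \<noteq> 0\<close> can be
  solved for \<open>1 / y\<close>; if \<open>a = 0\<close>, cancel \<open>y\<close> and continue
  with \<open>p\<close>.\<close>

lemma acl_inverse_poly:
  assumes F: "subfield F" and y: "y \<in> acl F" "y \<noteq> 0"
  shows "\<exists>q\<in>poly_over F. inverse y = poly q y"
proof -
  from y obtain p where "p \<in> poly_over F" "p \<noteq> 0" "poly p y = 0" unfolding acl_def by blast
  then show ?thesis
  proof (induction p)
    case (pCons a p)
    then have ap: "a \<in> F" "p \<in> poly_over F" by (auto simp: poly_over_pCons_iff[OF F])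
    show ?case
    proof (cases "a = 0")
      case True
      then show ?thesis using pCons ap y by auto
    next
      case False
      have "inverse y = poly (smult (- inverse a) p) y"
        using pCons.prems False y by (simp add: field_simps add_eq_0_iff)
      then show ?thesis using ap F by (auto intro!: bexI[of _ "smult (- inverse a) p"] poly_over_smult subfield_intros)
    qed
  qed auto
qed

lemma minimal_polynomial:
  assumes F: "subfield F" and y: "y \<in> acl F"
  obtains g where "g \<in> poly_over F" "lead_coeff g = 1" "poly g y = 0" "degree g > 0"
    "\<And>p. p \<in> poly_over F \<Longrightarrow> poly p y = 0 \<Longrightarrow> degree p < degree g \<Longrightarrow> p = 0"
    "\<And>p. p \<in> poly_over F \<Longrightarrow> poly p y = 0 \<Longrightarrow> \<exists>h\<in>poly_over F. p = g * h"
proof -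
  define Q where "Q p \<longleftrightarrow> p \<in> poly_over F \<and> p \<noteq> 0 \<and> poly p y = 0" for p
  obtain p0 where "Q p0" using y unfolding acl_def Q_def by blast
  then obtain p where p: "Q p" "\<And>q. Q q \<Longrightarrow> degree p \<le> degree q"
    using ex_has_least_nat[of Q p0 degree] by blast
  define g where "g = smult (inverse (lead_coeff p)) p"
  have g1: "g \<in> poly_over F" "lead_coeff g = 1" "poly g y = 0" "degree g = degree p"
    using p(1) F unfolding g_def Q_def by (auto intro!: poly_over_smult subfield_inverse poly_over_coeff)
  have min: "q = 0" if "q \<in> poly_over F" "poly q y = 0" "degree q < degree g" for q
    using p(2)[of q] that g1 unfolding Q_def by fastforce
  have d: "degree g > 0"
  proof (rule ccontr)
    assume "\<not> ?thesis"
    then have "g = [:1:]" using g1(2) by (metis degree_0_id neq0_conv)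
    then show False using g1(3) by simp
  qed
  have "\<exists>h\<in>poly_over F. q = g * h" if q: "q \<in> poly_over F" "poly q y = 0" for q
  proof -
    obtain h r where hr: "h \<in> poly_over F" "r \<in> poly_over F" "q = g * h + r" "r = 0 \<or> degree r < degree g"
      using poly_over_division[OF F g1(1) _ q(1)] g1(2) by fastforce
    have "poly r y = 0" using hr(3) q(2) g1(3) by simp
    then have "r = 0" using hr min by blast
    then show ?thesis using hr by auto
  qed
  then show ?thesis using that g1 min d by blast
qed

text \<open>Gives the extension the form used by the dimension count. Conversely, generators that
  coincide have their coefficients added up.\<close>

lemma finite_ext_iff_lspan:
  "finite_ext F E \<longleftrightarrow> subfield F \<and> subfield E \<and> F \<subseteq> E \<and>
     (\<exists>(I::nat set) b. finite I \<and> b ` I \<subseteq> E \<and> E \<subseteq> lspan F I b)" (is "?L \<longleftrightarrow> ?R")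
proof
  assume L: ?L
  then obtain B where B: "finite B" "B \<subseteq> E" "\<forall>y\<in>E. \<exists>a. (\<forall>b\<in>B. a b \<in> F) \<and> y = (\<Sum>b\<in>B. a b * b)"
    unfolding finite_ext_def by blast
  obtain f where f: "bij_betw f {0..<card B} B" using ex_bij_betw_nat_finite[OF B(1)] by blast
  have "y \<in> lspan F {0..<card B} f" if y: "y \<in> E" for y
  proof -
    obtain a where a: "\<forall>b\<in>B. a b \<in> F" "y = (\<Sum>b\<in>B. a b * b)" using B(3) y by blast
    have "y = (\<Sum>i\<in>{0..<card B}. a (f i) * f i)" unfolding a(2)
      using sum.reindex_bij_betw[OF f, of "\<lambda>b. a b * b"] by simp
    also have "\<dots> = (\<Sum>i\<in>{0..<card B}. (if i < card B then a (f i) else 0) * f i)" by simp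
    finally have "y = (\<Sum>i\<in>{0..<card B}. (if i < card B then a (f i) else 0) * f i)" .
    moreover have "(if i < card B then a (f i) else 0) \<in> F" for i
      using a(1) L bij_betwE[OF f] by (auto simp: finite_ext_def subfield_zero)
    ultimately show ?thesis unfolding lspan_def mem_Collect_eq
      by (intro exI[of _ "\<lambda>i. if i < card B then a (f i) else 0"]) blast
  qed
  moreover have "f ` {0..<card B} \<subseteq> E" using f B by (auto simp: bij_betw_def)
  ultimately show ?R using L unfolding finite_ext_def by blast
next
  assume R: ?R
  then obtain I :: "nat set" and b where I: "finite I" "b ` I \<subseteq> E" "E \<subseteq> lspan F I b" by blast
  have "\<exists>a. (\<forall>c\<in>b`I. a c \<in> F) \<and> y = (\<Sum>c\<in>b`I. a c * c)" if y: "y \<in> E" for y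
  proof -
    obtain a where a: "\<And>i. a i \<in> F" "y = (\<Sum>i\<in>I. a i * b i)" using subsetD[OF I(3) y] unfolding lspan_def by blast
    have "y = (\<Sum>c\<in>b`I. \<Sum>i\<in>{i\<in>I. b i = c}. a i * b i)" unfolding a(2) using sum.image_gen[OF I(1)] .
    also have "\<dots> = (\<Sum>c\<in>b`I. (\<Sum>i\<in>{i\<in>I. b i = c}. a i) * c)"
      by (intro sum.cong refl) (auto simp: sum_distrib_right)
    finally show ?thesis using a(1) R by (auto intro!: exI[of _ "\<lambda>c. \<Sum>i\<in>{i\<in>I. b i = c}. a i"] subfield_sum)
  qed
  then show ?L using R I unfolding finite_ext_def by (auto intro!: exI[of _ "b ` I"])
qed

section \<open>Composition of finite extensions and closure under field operations\<close>

lemma finite_ext_refl: "subfield F \<Longrightarrow> finite_ext F F"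
  unfolding finite_ext_def
  by (auto intro!: exI[of _ "{1}"] simp: subfield_one)

lemma finite_ext_trans:
  assumes "finite_ext F E" "finite_ext E G" shows "finite_ext F G"
proof -
  obtain B C where B: "finite B" "B \<subseteq> E" "\<forall>y\<in>E. \<exists>a. (\<forall>b\<in>B. a b \<in> F) \<and> y = (\<Sum>b\<in>B. a b * b)"
    and C: "finite C" "C \<subseteq> G" "\<forall>y\<in>G. \<exists>a. (\<forall>b\<in>C. a b \<in> E) \<and> y = (\<Sum>b\<in>C. a b * b)"
    using assms unfolding finite_ext_def by blast
  have sf: "subfield F" "subfield E" "subfield G" "F \<subseteq> E" "E \<subseteq> G" using assms by (auto simp: finite_ext_def)
  let ?f = "\<lambda>(b,c). b * c"
  have "\<exists>a. (\<forall>d\<in>?f`(B\<times>C). a d \<in> F) \<and> y = (\<Sum>d\<in>?f`(B\<times>C). a d * d)" if y: "y \<in> G" for y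
  proof -
    obtain e where e: "\<forall>c\<in>C. e c \<in> E" "y = (\<Sum>c\<in>C. e c * c)" using C y by blast
    have "\<forall>c\<in>C. \<exists>a. (\<forall>b\<in>B. a b \<in> F) \<and> e c = (\<Sum>b\<in>B. a b * b)" using e B by blast
    then obtain A where A: "\<forall>c\<in>C. (\<forall>b\<in>B. A c b \<in> F) \<and> e c = (\<Sum>b\<in>B. A c b * b)" by metis
    have "y = (\<Sum>c\<in>C. \<Sum>b\<in>B. A c b * (b * c))" unfolding e(2)
      using A by (intro sum.cong refl) (simp add: sum_distrib_right mult.assoc)
    also have "\<dots> = (\<Sum>(b,c)\<in>B\<times>C. A c b * (b * c))"
      by (subst sum.swap) (rule sum.cartesian_product)
    \<comment> \<open>Different pairs may have the same product, so coefficients are collected over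
      the fibres of \<open>?f\<close>.\<close>
    also have "\<dots> = (\<Sum>d\<in>?f`(B\<times>C). \<Sum>p\<in>{p\<in>B\<times>C. ?f p = d}. case p of (b,c) \<Rightarrow> A c b * (b * c))"
      using sum.image_gen[of "B \<times> C" _ ?f] B C by blast
    also have "\<dots> = (\<Sum>d\<in>?f`(B\<times>C). (\<Sum>p\<in>{p\<in>B\<times>C. ?f p = d}. case p of (b,c) \<Rightarrow> A c b) * d)"
      by (intro sum.cong refl) (auto simp: sum_distrib_right intro!: sum.cong)
    finally show ?thesis using A sf
      by (intro exI[of _ "\<lambda>d. \<Sum>p\<in>{p\<in>B\<times>C. ?f p = d}. case p of (b,c) \<Rightarrow> A c b"])
         (auto intro!: subfield_sum)
  qed
  moreover have "?f`(B\<times>C) \<subseteq> G" using B C sf by (auto intro!: subfield_mult)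
  ultimately show ?thesis using sf B C unfolding finite_ext_def 
    by (auto intro!: exI[of _ "?f`(B\<times>C)"])
qed

lemma finite_ext_subset_acl: assumes "finite_ext F E" shows "E \<subseteq> acl F"
proof
  fix y assume y: "y \<in> E"
  obtain I :: "nat set" and b where I: "finite I" "E \<subseteq> lspan F I b" and F: "subfield F" "subfield E"
    using assms unfolding finite_ext_iff_lspan by blast
  show "y \<in> acl F"
    by (rule acl_of_powers_in_lspan[OF F(1) I(1), of y b]) (use I(2) subfield_power[OF F(2) y] in blast)
qed

text \<open>Division by the minimal polynomial \<open>g\<close> shows that the powers of
  \<open>y\<close> below \<open>degree g\<close> span the ring \<open>R\<close> of polynomial
  values. Every element of \<open>R\<close> has all its powers in this finite span, hence is
  algebraic, and its inverse is a polynomial in it; so the ring is a field.\<close>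

lemma finite_ext_simple:
  assumes F: "subfield F" and y: "y \<in> acl F"
  shows "finite_ext F (gen_field F {y})" and "gen_field F {y} = {poly p y |p. p \<in> poly_over F}"
proof -
  obtain g where g: "g \<in> poly_over F" "lead_coeff g = 1" "poly g y = 0" "degree g > 0"
    using minimal_polynomial[OF F y] by metis
  define R where "R = {poly p y |p. p \<in> poly_over F}"
  have Rin: "p \<in> poly_over F \<Longrightarrow> poly p y \<in> R" for p unfolding R_def by blast
  have span: "R \<subseteq> lspan F {..<degree g} (\<lambda>i. y ^ i)"
  proof
    fix z assume "z \<in> R"
    then obtain p where p: "p \<in> poly_over F" "z = poly p y" unfolding R_def by blast
    obtain h r where hr: "h \<in> poly_over F" "r \<in> poly_over F" "p = g * h + r" "r = 0 \<or> degree r < degree g"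
      using poly_over_division[OF F g(1) _ p(1)] g(2) by fastforce
    have "z = poly r y" using p hr g by simp
    also have "\<dots> = (\<Sum>i\<le>degree r. coeff r i * y ^ i)" by (rule poly_altdef)
    also have "\<dots> = (\<Sum>i<degree g. coeff r i * y ^ i)"
      using hr(4) g(4) by (intro sum.mono_neutral_left) (auto simp: coeff_eq_0)
    finally show "z \<in> lspan F {..<degree g} (\<lambda>i. y ^ i)" unfolding lspan_def using hr(2)
      by (auto intro!: exI[of _ "coeff r"] simp: poly_over_coeff)
  qed
  have RR: "a + b \<in> R" "a - b \<in> R" "a * b \<in> R" if ab: "a \<in> R" "b \<in> R" for a b
  proof -
    obtain p q where pq: "p \<in> poly_over F" "q \<in> poly_over F" "a = poly p y" "b = poly q y"
      using ab unfolding R_def by blast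
    show "a + b \<in> R" using Rin[OF poly_over_add[OF F pq(1,2)]] pq by simp
    show "a - b \<in> R" using Rin[OF poly_over_diff[OF F pq(1,2)]] pq by simp
    show "a * b \<in> R" using Rin[OF poly_over_mult[OF F pq(1,2)]] pq by simp
  qed
  have FR: "F \<subseteq> R"
  proof
    fix a assume "a \<in> F"
    then show "a \<in> R" using Rin[OF poly_over_monom[OF F, of a 0]] by (simp add: poly_monom)
  qed
  have R1: "1 \<in> R" "0 \<in> R" using FR F by (auto simp: subfield_intros)
  have Rpow: "a ^ i \<in> R" if "a \<in> R" for a i using that by (induction i) (auto simp: RR R1)
  have Reval: "poly q a \<in> R" if "a \<in> R" "q \<in> poly_over F" for q a
  proof -
    have "(\<Sum>i\<in>I. coeff q i * a ^ i) \<in> R" for I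
    proof (induction I rule: infinite_finite_induct)
      case (insert i I)
      have "coeff q i * a ^ i \<in> R" using poly_over_coeff[OF that(2), of i] FR Rpow[OF that(1)] by (intro RR(3)) auto
      then show ?case using insert RR(1) by simp
    qed (use R1 in auto)
    then show ?thesis unfolding poly_altdef .
  qed
  have Rinv: "inverse a \<in> R" if a: "a \<in> R" for a
  proof (cases "a = 0")
    case False
    have "a ^ i \<in> lspan F {..<degree g} (\<lambda>i. y ^ i)" for i using span Rpow[OF a] by (rule subsetD)
    then have "a \<in> acl F" by (rule acl_of_powers_in_lspan[OF F, rotated]) simp
    then show ?thesis using acl_inverse_poly[OF F _ False] Reval[OF a] by metis
  qed (use R1 in auto)
  have sR: "subfield R" unfolding subfield_def using R1 RR Rinv by simp
  have yR: "y \<in> R" using Rin[OF poly_over_monom[OF F subfield_one[OF F], of 1]] by (simp add: poly_monom)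
  have eq: "gen_field F {y} = R"
  proof
    show "gen_field F {y} \<subseteq> R" using gen_field_least[OF sR FR] yR by blast
    have "poly p y \<in> gen_field F {y}" if "p \<in> poly_over F" for p
      using gen_field_superset[of F "{y}"] that
      by (intro poly_over_eval subfield_gen_field) (auto intro: poly_over_mono)
    then show "R \<subseteq> gen_field F {y}" unfolding R_def by blast
  qed
  then show "gen_field F {y} = {poly p y |p. p \<in> poly_over F}" unfolding R_def .
  show "finite_ext F (gen_field F {y})" unfolding eq finite_ext_iff_lspan
    using F sR FR span Rpow[OF yR] by (auto intro!: exI[of _ "{..<degree g}"] exI[of _ "\<lambda>i. y ^ i"])
qed

lemma finite_ext_containing:
  assumes F: "subfield F" and "finite S" "S \<subseteq> acl F"
  obtains E where "finite_ext F E" "S \<subseteq> E"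
proof -
  have "\<exists>E. finite_ext F E \<and> S \<subseteq> E" using assms(2,3)
  proof (induction S rule: finite_induct)
    case empty
    then show ?case using finite_ext_refl[OF F] by blast
  next
    case (insert y S)
    then obtain E where E: "finite_ext F E" "S \<subseteq> E" by blast
    then have sE: "subfield E" "F \<subseteq> E" by (auto simp: finite_ext_def)
    then have "y \<in> acl E" using insert acl_mono by blast
    then have "finite_ext E (gen_field E {y})" using finite_ext_simple sE by blast
    then show ?case using finite_ext_trans[OF E(1)] E(2) gen_field_superset[of E "{y}"] by blast
  qed
  then show ?thesis using that by blast
qed

text \<open>Two algebraic elements lie in a common finite extension, and that consists of algebraic
  elements.\<close>

lemma subfield_acl: assumes F: "subfield F" shows "subfield (acl F)"
proof -
  have "a + b \<in> acl F \<and> a - b \<in> acl F \<and> a * b \<in> acl F \<and> inverse a \<in> acl F" if ab: "a \<in> acl F" "b \<in> acl F" for a b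
  proof -
    obtain E where E: "finite_ext F E" "{a,b} \<subseteq> E" using finite_ext_containing[OF F, of "{a,b}"] ab by auto
    then have "subfield E" by (simp add: finite_ext_def)
    then show ?thesis using finite_ext_subset_acl[OF E(1)] E(2) by (auto simp: subset_iff subfield_intros)
  qed
  then show ?thesis using acl_superset[OF F] F unfolding subfield_def by blast
qed

lemma acl_finite_ext: assumes "finite_ext F E" shows "acl E = acl F"
proof
  have F: "subfield F" "subfield E" "F \<subseteq> E" using assms by (auto simp: finite_ext_def)
  show "acl F \<subseteq> acl E" using acl_mono F by blast
  show "acl E \<subseteq> acl F"
  proof
    fix y assume "y \<in> acl E"
    then have "finite_ext F (gen_field E {y})" using finite_ext_simple(1)[OF F(2)] finite_ext_trans[OF assms] by blast
    then show "y \<in> acl F" using finite_ext_subset_acl gen_field_superset[of E "{y}"] by blast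
  qed
qed

text \<open>A polynomial has finitely many coefficients, so a relation over \<open>acl F\<close> is
  already one over a single finite extension of \<open>F\<close>.\<close>

lemma acl_idem: assumes F: "subfield F" shows "acl (acl F) = acl F"
proof
  show "acl F \<subseteq> acl (acl F)" using acl_superset[OF subfield_acl[OF F]] .
  show "acl (acl F) \<subseteq> acl F"
  proof
    fix y assume "y \<in> acl (acl F)"
    then obtain p where p: "p \<in> poly_over (acl F)" "p \<noteq> 0" "poly p y = 0" unfolding acl_def by blast
    have "coeff p i \<in> insert 0 (coeff p ` {..degree p})" for i
      by (cases "i \<le> degree p") (auto simp: coeff_eq_0)
    then have "range (coeff p) \<subseteq> insert 0 (coeff p ` {..degree p})" by blast
    then have "finite (range (coeff p))" by (meson finite_atMost finite_imageI finite_insert finite_subset)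
    moreover have "range (coeff p) \<subseteq> acl F" using p by (auto simp: poly_over_def)
    ultimately obtain E where E: "finite_ext F E" "range (coeff p) \<subseteq> E" using finite_ext_containing[OF F] by metis
    then have "p \<in> poly_over E" by (auto simp: poly_over_def)
    then have "y \<in> acl E" using p unfolding acl_def by blast
    then show "y \<in> acl F" using acl_finite_ext[OF E(1)] by simp
  qed
qed

text \<open>Asking for \<open>poly q t \<noteq> 0\<close> instead of \<open>q \<noteq> 0\<close>
  covers algebraic and transcendental \<open>t\<close> alike; derivations are later extended in both
  situations.\<close>

lemma gen_field_fractions:
  assumes F: "subfield F"
  shows "gen_field F {t} = {poly p t / poly q t |p q. p \<in> poly_over F \<and> q \<in> poly_over F \<and> poly q t \<noteq> 0}"
proof -
  define R where "R = {poly p t / poly q t |p q. p \<in> poly_over F \<and> q \<in> poly_over F \<and> poly q t \<noteq> 0}"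
  have in': "poly p t / poly q t \<in> R" if "p \<in> poly_over F" "q \<in> poly_over F" "poly q t \<noteq> 0" for p q
    unfolding R_def using that by blast
  have one: "poly 1 t \<noteq> 0" by simp
  have FR: "a \<in> R" if "a \<in> F" for a
    using in'[OF poly_over_monom[OF F that, of 0] poly_over_one[OF F] one] by (simp add: poly_monom)
  have RR: "a + b \<in> R" "a - b \<in> R" "a * b \<in> R" if ab: "a \<in> R" "b \<in> R" for a b
  proof -
    obtain p q p' q' where pq: "p \<in> poly_over F" "q \<in> poly_over F" "poly q t \<noteq> 0" "a = poly p t / poly q t"
      "p' \<in> poly_over F" "q' \<in> poly_over F" "poly q' t \<noteq> 0" "b = poly p' t / poly q' t" using ab unfolding R_def by blast
    have qq: "q * q' \<in> poly_over F" "poly (q * q') t \<noteq> 0" using pq F by (auto simp: poly_over_mult)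
    have eqs: "a + b = poly (p * q' + p' * q) t / poly (q * q') t"
      "a - b = poly (p * q' - p' * q) t / poly (q * q') t"
      "a * b = poly (p * p') t / poly (q * q') t" unfolding pq(4,8) using pq(3,7) by (simp_all add: field_simps)
    show "a + b \<in> R" unfolding eqs by (intro in' qq poly_over_add poly_over_mult F pq)
    show "a - b \<in> R" unfolding eqs by (intro in' qq poly_over_diff poly_over_mult F pq)
    show "a * b \<in> R" unfolding eqs by (intro in' qq poly_over_mult F pq)
  qed
  have Rinv: "inverse a \<in> R" if a: "a \<in> R" for a
  proof (cases "a = 0")
    case False
    obtain p q where pq: "p \<in> poly_over F" "q \<in> poly_over F" "poly q t \<noteq> 0" "a = poly p t / poly q t"
      using a unfolding R_def by blast
    then have "poly p t \<noteq> 0" using False by auto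
    then show ?thesis using in'[of q p] pq by auto
  qed (use FR[OF subfield_zero[OF F]] in simp)
  have sR: "subfield R" unfolding subfield_def
    using FR[OF subfield_zero[OF F]] FR[OF subfield_one[OF F]] RR Rinv by simp
  have "t \<in> R" using in'[OF poly_over_monom[OF F subfield_one[OF F], of 1] poly_over_one[OF F] one]
    by (simp add: poly_monom)
  then have "gen_field F {t} \<subseteq> R" using FR by (intro gen_field_least sR) auto
  moreover have "poly p t / poly q t \<in> gen_field F {t}" if "p \<in> poly_over F" "q \<in> poly_over F" for p q
    using gen_field_superset[of F "{t}"] that
    by (intro subfield_divide subfield_gen_field poly_over_eval) (auto intro: poly_over_mono)
  then have "R \<subseteq> gen_field F {t}" unfolding R_def by blast
  ultimately show ?thesis unfolding R_def by blast
qed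

lemma common_denominator:
  assumes F: "subfield F" and p: "p \<in> poly_over (gen_field F {t})"
  shows "\<exists>q\<in>poly_over F. poly q t \<noteq> 0 \<and> (\<exists>P. \<forall>i. P i \<in> poly_over F \<and> coeff p i * poly q t = poly (P i) t)"
  using p
proof (induction p)
  case 0
  then show ?case using F by (intro bexI[of _ 1]) (auto intro!: exI[of _ "\<lambda>_. 0"] simp: poly_over_one poly_over_zero)
next
  case (pCons a p)
  then have ap: "a \<in> gen_field F {t}" "p \<in> poly_over (gen_field F {t})"
    by (auto simp: poly_over_pCons_iff subfield_gen_field)
  from pCons.IH[OF ap(2)] obtain q P where q': "q \<in> poly_over F" "poly q t \<noteq> 0"
    "\<forall>i. P i \<in> poly_over F \<and> coeff p i * poly q t = poly (P i) t" by (elim bexE conjE exE)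
  then have q: "q \<in> poly_over F" "poly q t \<noteq> 0" "\<And>i. P i \<in> poly_over F" "\<And>i. coeff p i * poly q t = poly (P i) t"
    by simp_all
  obtain r s where rs: "r \<in> poly_over F" "s \<in> poly_over F" "poly s t \<noteq> 0" "a = poly r t / poly s t"
    using ap(1) unfolding gen_field_fractions[OF F] by blast
  define P' where "P' i = (case i of 0 \<Rightarrow> r * q | Suc i \<Rightarrow> P i * s)" for i
  have "P' i \<in> poly_over F \<and> coeff (pCons a p) i * poly (q * s) t = poly (P' i) t" for i
    using q rs F by (cases i) (auto simp: P'_def poly_over_mult field_simps)
  moreover have "poly (q * s) t \<noteq> 0" "q * s \<in> poly_over F" using q rs F by (auto simp: poly_over_mult)
  ultimately show ?case by (intro bexI[of _ "q * s"] conjI exI[of _ P'] allI) simp_all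
qed

lemma transcendental_nonzero: "f \<notin> acl F \<Longrightarrow> p \<in> poly_over F \<Longrightarrow> poly p f = 0 \<longleftrightarrow> p = 0"
  unfolding acl_def by auto

text \<open>Cleared of denominators, a relation for \<open>f\<close> over \<open>F(t)\<close>
  becomes a polynomial relation between \<open>f\<close> and \<open>t\<close> over \<open>F\<close>.
  Regrouped by powers of \<open>t\<close> it is a relation for \<open>t\<close> over
  \<open>F(f)\<close>, and it stays nontrivial because \<open>f\<close> is transcendental.\<close>

lemma acl_exchange:
  assumes F: "subfield F" and f: "f \<in> acl (gen_field F {t})" "f \<notin> acl F"
  shows "t \<in> acl (gen_field F {f})"
proof -
  from f(1) obtain p where p: "p \<in> poly_over (gen_field F {t})" "p \<noteq> 0" "poly p f = 0" unfolding acl_def by blast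
  from common_denominator[OF F p(1)] obtain q P where q': "q \<in> poly_over F" "poly q t \<noteq> 0"
    "\<forall>i. P i \<in> poly_over F \<and> coeff p i * poly q t = poly (P i) t" by (elim bexE conjE exE)
  then have q: "q \<in> poly_over F" "poly q t \<noteq> 0" "\<And>i. P i \<in> poly_over F" "\<And>i. coeff p i * poly q t = poly (P i) t"
    by simp_all
  define r where "r = (\<Sum>i\<le>degree p. smult (f ^ i) (P i))"
  have f': "f \<in> gen_field F {f}" "F \<subseteq> gen_field F {f}" using gen_field_superset[of F "{f}"] by auto
  have "r \<in> poly_over (gen_field F {f})" unfolding r_def
    by (intro poly_over_sum poly_over_smult subfield_power subfield_gen_field f'(1) poly_over_mono[OF f'(2) q(3)])
  moreover have "poly r t = poly q t * poly p f" unfolding r_def poly_sum poly_altdef[of p]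
    unfolding poly_smult q(4)[symmetric] by (simp add: sum_distrib_left mult_ac)
  moreover have "r \<noteq> 0"
  proof -
    have "coeff p (degree p) * poly q t \<noteq> 0" using p(2) q(2) by simp
    then have "P (degree p) \<noteq> 0" unfolding q(4) by auto
    then obtain j where j: "coeff (P (degree p)) j \<noteq> 0" by (meson leading_coeff_0_iff)
    \<comment> \<open>\<open>poly s f\<close> is the coefficient of \<open>r\<close> at
      \<open>j\<close>; the top coefficient of \<open>s\<close> was chosen nonzero, so transcendence
      of \<open>f\<close> applies to \<open>s\<close>.\<close>
    define s where "s = (\<Sum>i\<le>degree p. monom (coeff (P i) j) i)"
    have "coeff s (degree p) \<noteq> 0" using j unfolding s_def coeff_sum by simp
    then have "s \<noteq> 0" by auto
    moreover have "s \<in> poly_over F" unfolding s_def using q F by (intro poly_over_sum poly_over_monom) (auto simp: poly_over_coeff)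
    ultimately have "poly s f \<noteq> 0" using transcendental_nonzero[OF f(2)] by blast
    moreover have "poly s f = coeff r j" unfolding s_def r_def coeff_sum by (simp add: poly_sum poly_monom mult_ac)
    ultimately show ?thesis by auto
  qed
  ultimately show ?thesis unfolding acl_def using p by auto
qed

section \<open>Derivations and their extension to algebraic elements\<close>

text \<open>The rules hold on \<open>F\<close> only and values may leave \<open>F\<close>:
  derivations are constructed one field at a time, as total functions with arbitrary values
  elsewhere.\<close>

definition deriv_on :: "'a::field set \<Rightarrow> ('a \<Rightarrow> 'a) \<Rightarrow> bool" where
  "deriv_on F d \<longleftrightarrow> (\<forall>a\<in>F. \<forall>b\<in>F. d (a + b) = d a + d b \<and> d (a * b) = a * d b + d a * b)"

lemma deriv_on_subset: "deriv_on E d \<Longrightarrow> F \<subseteq> E \<Longrightarrow> deriv_on F d"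
  unfolding deriv_on_def by blast

context
  fixes F :: "'a::field set" and d :: "'a \<Rightarrow> 'a"
  assumes F: "subfield F" and d: "deriv_on F d"
begin

lemma deriv_add: "a \<in> F \<Longrightarrow> b \<in> F \<Longrightarrow> d (a + b) = d a + d b"
  and deriv_mult: "a \<in> F \<Longrightarrow> b \<in> F \<Longrightarrow> d (a * b) = a * d b + d a * b"
  using d by (auto simp: deriv_on_def)

lemma deriv_zero: "d 0 = 0"
proof -
  have "d 0 + d 0 = d 0 + 0" using deriv_add[of 0 0] F subfield_zero by auto
  then show ?thesis by (simp only: add_left_cancel)
qed

lemma deriv_one: "d 1 = 0"
proof -
  have "d 1 + d 1 = d 1 + 0" using deriv_mult[of 1 1] F subfield_one by auto
  then show ?thesis by (simp only: add_left_cancel)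
qed

lemma deriv_uminus: "a \<in> F \<Longrightarrow> d (- a) = - d a"
  using deriv_add[of a "- a"] F by (simp add: subfield_uminus deriv_zero eq_neg_iff_add_eq_0 add.commute)

lemma deriv_diff: "a \<in> F \<Longrightarrow> b \<in> F \<Longrightarrow> d (a - b) = d a - d b"
  using deriv_add[of a "- b"] F by (simp add: subfield_uminus deriv_uminus)

lemma deriv_sum: "(\<And>i. i \<in> I \<Longrightarrow> f i \<in> F) \<Longrightarrow> d (\<Sum>i\<in>I. f i) = (\<Sum>i\<in>I. d (f i))"
  by (induction I rule: infinite_finite_induct) (auto simp: deriv_zero deriv_add subfield_sum F)

lemma deriv_prod:
  "finite I \<Longrightarrow> (\<And>i. i \<in> I \<Longrightarrow> f i \<in> F) \<Longrightarrow>
   d (\<Prod>i\<in>I. f i) = (\<Sum>l\<in>I. d (f l) * (\<Prod>i\<in>I-{l}. f i))"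
proof (induction I rule: finite_induct)
  case (insert x I)
  have 1: "(\<Prod>i\<in>insert x I - {x}. f i) = (\<Prod>i\<in>I. f i)" using insert by simp
  have 2: "(\<Prod>i\<in>insert x I - {l}. f i) = f x * (\<Prod>i\<in>I-{l}. f i)" if "l \<in> I" for l
  proof -
    have "insert x I - {l} = insert x (I - {l})" using insert that by auto
    then show ?thesis using insert by simp
  qed
  have "d (\<Prod>i\<in>insert x I. f i) = f x * d (\<Prod>i\<in>I. f i) + d (f x) * (\<Prod>i\<in>I. f i)"
    using insert F by (simp add: deriv_mult subfield_prod)
  also have "\<dots> = d (f x) * (\<Prod>i\<in>insert x I - {x}. f i) + (\<Sum>l\<in>I. d (f l) * (\<Prod>i\<in>insert x I - {l}. f i))"
    using insert unfolding 1 by (simp add: 2 sum_distrib_left mult_ac cong: sum.cong)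
  also have "\<dots> = (\<Sum>l\<in>insert x I. d (f l) * (\<Prod>i\<in>insert x I - {l}. f i))" using insert by simp
  finally show ?case .
qed (simp add: deriv_one)

lemma deriv_of_nat: "d (of_nat n) = 0"
  by (induction n) (auto simp: deriv_zero deriv_one deriv_add F subfield_one subfield_of_nat)

lemma deriv_divide:
  assumes "a \<in> F" "b \<in> F" "b \<noteq> 0"
  shows "d (a / b) = (d a * b - a * d b) / (b * b)"
proof -
  have "d (a / b * b) = a / b * d b + d (a / b) * b"
    using assms F by (intro deriv_mult) (auto simp: subfield_divide)
  then show ?thesis using assms by (simp add: field_simps)
qed

lemma deriv_power_Suc: "a \<in> F \<Longrightarrow> d (a ^ Suc n) = of_nat (Suc n) * a ^ n * d a"
proof (induction n)
  case (Suc n)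
  have "d (a ^ Suc (Suc n)) = a * d (a ^ Suc n) + d a * a ^ Suc n"
    using deriv_mult[of a "a ^ Suc n"] Suc F by (simp add: subfield_power subfield_mult)
  then show ?case using Suc by (simp add: algebra_simps)
qed simp

lemma deriv_log_divide:
  assumes "a \<in> F" "b \<in> F" "a \<noteq> 0" "b \<noteq> 0"
  shows "d (a / b) / (a / b) = d a / a - d b / b"
  using assms by (simp add: deriv_divide field_simps)

lemma deriv_log_power:
  assumes "a \<in> F" "a \<noteq> 0"
  shows "d (a ^ n) / a ^ n = of_nat n * (d a / a)"
proof (cases n)
  case (Suc k)
  have "d (a ^ n) = of_nat n * a ^ k * d a" unfolding Suc using assms(1) by (rule deriv_power_Suc)
  then show ?thesis using assms(2) by (simp add: Suc)
qed (simp add: deriv_one)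

lemma deriv_poly:
  assumes "p \<in> poly_over F" "y \<in> F"
  shows "d (poly p y) = poly (map_poly d p) y + poly (pderiv p) y * d y"
  using assms(1)
proof (induction p)
  case (pCons a p)
  then have ap: "a \<in> F" "p \<in> poly_over F" by (auto simp: poly_over_pCons_iff F)
  then have "poly p y \<in> F" using assms poly_over_eval F by blast
  then show ?case using ap pCons assms
    by (simp add: deriv_add deriv_mult map_poly_pCons deriv_zero pderiv_pCons F subfield_mult algebra_simps)
qed (simp add: deriv_zero)

lemma map_poly_deriv_add:
  assumes "p \<in> poly_over F" "q \<in> poly_over F"
  shows "map_poly d (p + q) = map_poly d p + map_poly d q"
  by (rule poly_eqI) (simp add: coeff_map_poly deriv_zero deriv_add poly_over_coeff[OF assms(1)] poly_over_coeff[OF assms(2)])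

lemma map_poly_deriv_diff:
  assumes "p \<in> poly_over F" "q \<in> poly_over F"
  shows "map_poly d (p - q) = map_poly d p - map_poly d q"
  by (rule poly_eqI) (simp add: coeff_map_poly deriv_zero deriv_diff poly_over_coeff[OF assms(1)] poly_over_coeff[OF assms(2)])

lemma map_poly_deriv_mult:
  assumes "p \<in> poly_over F" "q \<in> poly_over F"
  shows "map_poly d (p * q) = p * map_poly d q + map_poly d p * q"
proof (rule poly_eqI)
  fix n
  show "coeff (map_poly d (p * q)) n = coeff (p * map_poly d q + map_poly d p * q) n"
    using F poly_over_coeff[OF assms(1)] poly_over_coeff[OF assms(2)]
    by (simp add: coeff_map_poly deriv_zero coeff_mult deriv_sum deriv_mult subfield_mult sum.distrib)
qed

end

section \<open>Extension of derivations to simple and finite extensions\<close>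

lemma poly_map_poly_zero: "(\<And>i. d (coeff p i) = 0) \<Longrightarrow> d 0 = 0 \<Longrightarrow> map_poly d p = 0"
  by (rule poly_eqI) (simp add: coeff_map_poly)

text \<open>\<open>wd\<close> is exactly well-definedness on polynomial values: a polynomial
  vanishing at \<open>y\<close> must get derivative 0. For transcendental \<open>y\<close> it holds
  for every \<xi>; for algebraic \<open>y\<close> it fixes \<xi>. The quotient rule then reaches
  fractions.\<close>

lemma deriv_extend:
  fixes F :: "'a::field set"
  assumes F: "subfield F" and d: "deriv_on F d"
    and wd: "\<And>p. p \<in> poly_over F \<Longrightarrow> poly p y = 0 \<Longrightarrow> poly (map_poly d p) y + poly (pderiv p) y * \<xi> = 0"
    and xi: "\<xi> \<in> gen_field F {y}" and dF: "\<And>a. a \<in> F \<Longrightarrow> d a \<in> F"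
  obtains d' where "deriv_on (gen_field F {y}) d'" "\<And>a. a \<in> F \<Longrightarrow> d' a = d a" "d' y = \<xi>"
    "\<And>a. a \<in> gen_field F {y} \<Longrightarrow> d' a \<in> gen_field F {y}"
proof -
  define \<Delta> where "\<Delta> p = poly (map_poly d p) y + poly (pderiv p) y * \<xi>" for p
  have d0: "d 0 = 0" "d 1 = 0" using deriv_zero[OF F d] deriv_one[OF F d] by auto
  have Dadd: "\<Delta> (p + q) = \<Delta> p + \<Delta> q" if "p \<in> poly_over F" "q \<in> poly_over F" for p q
    unfolding \<Delta>_def map_poly_deriv_add[OF F d that] by (simp add: pderiv_add algebra_simps)
  have Ddiff: "\<Delta> (p - q) = \<Delta> p - \<Delta> q" if "p \<in> poly_over F" "q \<in> poly_over F" for p q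
    unfolding \<Delta>_def map_poly_deriv_diff[OF F d that] by (simp add: pderiv_diff algebra_simps)
  have Dmult: "\<Delta> (p * q) = poly p y * \<Delta> q + \<Delta> p * poly q y" if "p \<in> poly_over F" "q \<in> poly_over F" for p q
    unfolding \<Delta>_def map_poly_deriv_mult[OF F d that] by (simp add: pderiv_mult algebra_simps)
  define Q where "Q z p q \<longleftrightarrow> p \<in> poly_over F \<and> q \<in> poly_over F \<and> poly q y \<noteq> 0 \<and> z = poly p y / poly q y" for z p q
  define W where "W p q = (\<Delta> p * poly q y - poly p y * \<Delta> q) / (poly q y * poly q y)" for p q
  define d' where "d' z = (SOME w. \<exists>p q. Q z p q \<and> w = W p q)" for z
  have uniq: "W p q = W p' q'" if "Q z p q" "Q z p' q'" for z p q p' q'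
  proof -
    have ne: "poly q y \<noteq> 0" "poly q' y \<noteq> 0" using that by (auto simp: Q_def)
    have po: "p \<in> poly_over F" "q \<in> poly_over F" "p' \<in> poly_over F" "q' \<in> poly_over F"
      using that by (auto simp: Q_def)
    have "poly p y / poly q y = poly p' y / poly q' y" using that by (auto simp: Q_def)
    then have eq: "poly p y * poly q' y = poly p' y * poly q y" using ne by (simp add: frac_eq_eq)
    \<comment> \<open>Two representations of one element differ by a cross-multiplied polynomial
      vanishing at \<open>y\<close>; \<open>wd\<close> for it gives independence of the
      representation.\<close>
    have "\<Delta> (p * q' - p' * q) = 0"
      unfolding \<Delta>_def using po F eq by (intro wd) (auto simp: poly_over_diff poly_over_mult)
    then have e2: "poly p y * \<Delta> q' + \<Delta> p * poly q' y = poly p' y * \<Delta> q + \<Delta> p' * poly q y"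
      using po F by (simp add: Ddiff Dmult poly_over_mult)
    define a b c e where "a = poly p y" "b = poly q y" "c = poly p' y" "e = poly q' y"
    note abbr = this[symmetric]
    have "(\<Delta> p * b - a * \<Delta> q) * (e * e) = (\<Delta> p' * e - c * \<Delta> q') * (b * b)"
    proof -
      have e1: "a * e = c * b" using eq unfolding abbr .
      have e3: "\<Delta> p * e = c * \<Delta> q + \<Delta> p' * b - a * \<Delta> q'" using e2 unfolding abbr by (simp add: algebra_simps)
      have "(\<Delta> p * b - a * \<Delta> q) * (e * e) = b * e * (\<Delta> p * e) - (a * e) * (e * \<Delta> q)" by (simp add: algebra_simps)
      also have "\<dots> = b * b * e * \<Delta> p' - b * (a * e) * \<Delta> q'" unfolding e3 unfolding e1
        by (simp add: algebra_simps e1)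
      also have "\<dots> = (\<Delta> p' * e - c * \<Delta> q') * (b * b)" unfolding e1 by (simp add: algebra_simps)
      finally show ?thesis .
    qed
    then show ?thesis unfolding W_def abbr using ne unfolding abbr by (subst frac_eq_eq) auto
  qed
  have d'eq: "d' z = W p q" if "Q z p q" for z p q
  proof -
    have "\<exists>p q. Q z p q \<and> d' z = W p q" unfolding d'_def
      by (rule someI_ex) (use that in blast)
    then show ?thesis using uniq[OF that] by metis
  qed
  have Qex: "\<exists>p q. Q z p q" if "z \<in> gen_field F {y}" for z
    using that unfolding gen_field_fractions[OF F] Q_def by blast
  have "deriv_on (gen_field F {y}) d'"
    unfolding deriv_on_def
  proof (intro ballI)
    fix a b assume ab: "a \<in> gen_field F {y}" "b \<in> gen_field F {y}"
    then obtain p q p' q' where Q: "Q a p q" "Q b p' q'" using Qex by blast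
    have po: "p \<in> poly_over F" "q \<in> poly_over F" "p' \<in> poly_over F" "q' \<in> poly_over F"
      and ne: "poly q y \<noteq> 0" "poly q' y \<noteq> 0" and ab: "a = poly p y / poly q y" "b = poly p' y / poly q' y"
      using Q by (auto simp: Q_def)
    note pom = poly_over_mult[OF F]
    have "Q (a + b) (p * q' + p' * q) (q * q')" "Q (a * b) (p * p') (q * q')"
      unfolding Q_def ab using po ne by (auto simp: poly_over_add F pom field_simps)
    note * = this[THEN d'eq] d'eq[OF Q(1)] d'eq[OF Q(2)]
    show "d' (a + b) = d' a + d' b \<and> d' (a * b) = a * d' b + d' a * b"
      unfolding * W_def using po ne
      by (simp add: Dadd Dmult pom ab field_simps)
  qed
  moreover have "d' a = d a" if "a \<in> F" for a
  proof -
    have "Q a [:a:] 1" unfolding Q_def using that F by (simp add: poly_over_pCons_iff poly_over_zero poly_over_one)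
    then have "d' a = W [:a:] 1" by (rule d'eq)
    then show ?thesis unfolding W_def \<Delta>_def by (simp add: map_poly_pCons d0 pderiv_pCons pderiv_1 map_poly_1)
  qed
  moreover have "d' y = \<xi>"
  proof -
    have "Q y [:0,1:] 1" unfolding Q_def using F by (simp add: poly_over_pCons_iff poly_over_zero poly_over_one subfield_intros)
    then have "d' y = W [:0,1:] 1" by (rule d'eq)
    then show ?thesis unfolding W_def \<Delta>_def by (simp add: map_poly_pCons d0 pderiv_pCons pderiv_1 map_poly_1)
  qed
  moreover have "d' a \<in> gen_field F {y}" if "a \<in> gen_field F {y}" for a
  proof -
    obtain p q where Q: "Q a p q" using Qex \<open>a \<in> gen_field F {y}\<close> by blast
    have sup: "F \<subseteq> gen_field F {y}" "y \<in> gen_field F {y}" using gen_field_superset[of F "{y}"] by auto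
    have ev: "poly r y \<in> gen_field F {y}" if "r \<in> poly_over F" for r
      using sup that by (intro poly_over_eval subfield_gen_field) (auto intro: poly_over_mono)
    have Din: "\<Delta> r \<in> gen_field F {y}" if "r \<in> poly_over F" for r
      unfolding \<Delta>_def using that F d0 dF xi
      by (intro subfield_add subfield_mult subfield_gen_field ev poly_over_pderiv poly_over_map_poly) auto
    show ?thesis unfolding d'eq[OF Q] W_def using Q unfolding Q_def
      by (intro subfield_divide subfield_diff subfield_mult subfield_gen_field ev Din) auto
  qed
  ultimately show ?thesis using that by blast
qed

text \<open>In characteristic 0 the derivative of the minimal polynomial is nonzero of smaller
  degree, so minimality forbids it to vanish at \<open>y\<close>.\<close>

lemma separable_minimal_polynomial:
  fixes F :: "'a::field set"
  assumes "CHAR('a) = 0" and F: "subfield F" and y: "y \<in> acl F"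
  obtains g where "g \<in> poly_over F" "poly g y = 0" "poly (pderiv g) y \<noteq> 0"
    "\<And>p. p \<in> poly_over F \<Longrightarrow> poly p y = 0 \<Longrightarrow> \<exists>h\<in>poly_over F. p = g * h"
proof -
  obtain g where g: "g \<in> poly_over F" "lead_coeff g = 1" "poly g y = 0" "degree g > 0"
    "\<And>p. p \<in> poly_over F \<Longrightarrow> poly p y = 0 \<Longrightarrow> degree p < degree g \<Longrightarrow> p = 0"
    "\<And>p. p \<in> poly_over F \<Longrightarrow> poly p y = 0 \<Longrightarrow> \<exists>h\<in>poly_over F. p = g * h"
    using minimal_polynomial[OF F y] by metis
  have "coeff (pderiv g) (degree g - 1) = of_nat (degree g)" using g(2,4) by (simp add: coeff_pderiv)
  then have "coeff (pderiv g) (degree g - 1) \<noteq> 0" using assms(1) g(4) by (simp add: CHAR_eq0_iff)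
  then have "pderiv g \<noteq> 0" by auto
  moreover have "degree (pderiv g) \<le> degree g - 1"
    by (rule degree_le) (auto simp: coeff_pderiv coeff_eq_0)
  ultimately have "poly (pderiv g) y \<noteq> 0" using g(4,5) poly_over_pderiv[OF F g(1)] by fastforce
  then show ?thesis using that g by blast
qed

lemma deriv_extend_finite:
  fixes F :: "'a::field set"
  assumes ch: "CHAR('a) = 0" and F: "subfield F" and d: "deriv_on F d" and dF: "\<And>a. a \<in> F \<Longrightarrow> d a \<in> F"
    and "finite S" "S \<subseteq> acl F"
  obtains E d' where "finite_ext F E" "S \<subseteq> E" "deriv_on E d'" "\<And>a. a \<in> F \<Longrightarrow> d' a = d a"
    "\<And>a. a \<in> E \<Longrightarrow> d' a \<in> E"
proof -
  have "\<exists>E d'. finite_ext F E \<and> S \<subseteq> E \<and> deriv_on E d' \<and> (\<forall>a\<in>F. d' a = d a) \<and> (\<forall>a\<in>E. d' a \<in> E)"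
    using assms(5,6)
  proof (induction S rule: finite_induct)
    case empty
    then show ?case using finite_ext_refl[OF F] d dF by (intro exI[of _ F] exI[of _ d]) auto
  next
    case (insert y S)
    then obtain E d' where E: "finite_ext F E" "S \<subseteq> E" "deriv_on E d'" "\<forall>a\<in>F. d' a = d a" "\<forall>a\<in>E. d' a \<in> E"
      by blast
    then have sE: "subfield E" "F \<subseteq> E" by (auto simp: finite_ext_def)
    have y: "y \<in> acl E" using insert.prems acl_mono[OF sE(2)] by blast
    obtain g where g: "g \<in> poly_over E" "poly g y = 0" "poly (pderiv g) y \<noteq> 0"
       "\<And>p. p \<in> poly_over E \<Longrightarrow> poly p y = 0 \<Longrightarrow> \<exists>h\<in>poly_over E. p = g * h"
      using separable_minimal_polynomial[OF ch sE(1) y] by metis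
    define G where "G = gen_field E {y}"
    have G: "subfield G" "E \<subseteq> G" "y \<in> G" unfolding G_def using subfield_gen_field gen_field_superset[of E "{y}"] by auto
    \<comment> \<open>The only value compatible with differentiating
      \<open>poly g y = 0\<close>.\<close>
    define \<xi> where "\<xi> = - poly (map_poly d' g) y / poly (pderiv g) y"
    have d0: "d' 0 = 0" using deriv_zero[OF sE(1) E(3)] .
    have "\<xi> \<in> G" unfolding \<xi>_def using G g d0 E(5) poly_over_mono[OF G(2)] sE
      by (intro subfield_divide subfield_uminus poly_over_eval)
         (auto intro!: poly_over_mono[OF G(2)] poly_over_pderiv poly_over_map_poly)
    moreover have "poly (map_poly d' p) y + poly (pderiv p) y * \<xi> = 0" if p: "p \<in> poly_over E" "poly p y = 0" for p
    proof -
      obtain h where h: "h \<in> poly_over E" "p = g * h" using g(4) p by blast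
      show ?thesis unfolding h(2) map_poly_deriv_mult[OF sE(1) E(3) g(1) h(1)] \<xi>_def
        using g by (simp add: pderiv_mult field_simps)
    qed
    ultimately obtain d'' where d'': "deriv_on G d''" "\<And>a. a \<in> E \<Longrightarrow> d'' a = d' a" "\<And>a. a \<in> G \<Longrightarrow> d'' a \<in> G"
      using deriv_extend[OF sE(1) E(3), of y \<xi>] E(5) unfolding G_def by metis
    have "finite_ext F G" using finite_ext_trans[OF E(1)] finite_ext_simple(1)[OF sE(1) y] unfolding G_def by blast
    then show ?case using d'' E G sE by (intro exI[of _ G] exI[of _ d'']) auto
  qed
  then show ?thesis using that by blast
qed

lemma deriv_algebraic_formula:
  fixes F :: "'a::field set"
  assumes ch: "CHAR('a) = 0" and sf: "subfield F" "subfield E" "F \<subseteq> E" and d: "deriv_on E d"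
    and y: "y \<in> E" "y \<in> acl F"
  obtains g where "g \<in> poly_over F" "poly (pderiv g) y \<noteq> 0"
    "d y = - poly (map_poly d g) y / poly (pderiv g) y"
proof -
  obtain g where g: "g \<in> poly_over F" "poly g y = 0" "poly (pderiv g) y \<noteq> 0"
    using separable_minimal_polynomial[OF ch sf(1) y(2)] by metis
  have "d (poly g y) = poly (map_poly d g) y + poly (pderiv g) y * d y"
    using deriv_poly[OF sf(2) d] poly_over_mono[OF sf(3) g(1)] y by blast
  then have "poly (map_poly d g) y + poly (pderiv g) y * d y = 0" using g deriv_zero[OF sf(2) d] by simp
  then have "d y = - poly (map_poly d g) y / poly (pderiv g) y" using g by (simp add: field_simps eq_neg_iff_add_eq_0)
  then show ?thesis using that g by blast
qed

text \<open>Uniqueness of the extension of a derivation to algebraic elements. Applied to a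
  commutator, it spreads commutation from a field to its algebraic extensions.\<close>

lemma deriv_vanishes_algebraic:
  fixes F :: "'a::field set"
  assumes "CHAR('a) = 0" "subfield F" "subfield E" "F \<subseteq> E" "deriv_on E d" "y \<in> E" "y \<in> acl F"
    and "\<And>a. a \<in> F \<Longrightarrow> d a = 0"
  shows "d y = 0"
proof -
  obtain g where g: "g \<in> poly_over F" "d y = - poly (map_poly d g) y / poly (pderiv g) y"
    using deriv_algebraic_formula[OF assms(1-7)] by metis
  have "map_poly d g = 0" using assms(8) g(1) deriv_zero[OF assms(3,5)]
    by (intro poly_map_poly_zero) (auto simp: poly_over_coeff)
  then show ?thesis using g by simp
qed

lemma deriv_algebraic_closed:
  fixes F :: "'a::field set"
  assumes "CHAR('a) = 0" "subfield F" "subfield E" "F \<subseteq> E" "deriv_on E' d" "E \<subseteq> E'" "y \<in> E" "y \<in> acl F"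
    and "\<And>a. a \<in> F \<Longrightarrow> d a \<in> F"
  shows "d y \<in> E"
proof -
  have dE: "deriv_on E d" using deriv_on_subset assms by blast
  obtain g where g: "g \<in> poly_over F" "d y = - poly (map_poly d g) y / poly (pderiv g) y"
    using deriv_algebraic_formula[OF assms(1-4) dE assms(7,8)] by metis
  have "map_poly d g \<in> poly_over E" "pderiv g \<in> poly_over E"
    using g assms(2,9) deriv_zero[OF assms(3) dE]
    by (auto intro!: poly_over_mono[OF assms(4)] poly_over_map_poly poly_over_pderiv)
  then show ?thesis unfolding g(2) using assms(3,7) by (intro subfield_divide subfield_uminus poly_over_eval)
qed

lemma deriv_gen_field_closed:
  assumes F: "subfield F" and E: "subfield E" "gen_field F {t} \<subseteq> E" and d: "deriv_on E d"
    and "\<And>a. a \<in> F \<Longrightarrow> d a \<in> gen_field F {t}" "d t \<in> gen_field F {t}" "y \<in> gen_field F {t}"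
  shows "d y \<in> gen_field F {t}"
proof -
  let ?G = "gen_field F {t}"
  have d0: "d 0 = 0" using deriv_zero[OF E(1) d] .
  have sup: "F \<subseteq> ?G" "t \<in> ?G" using gen_field_superset[of F "{t}"] by auto
  have ev: "d (poly p t) \<in> ?G \<and> poly p t \<in> ?G" if p: "p \<in> poly_over F" for p
  proof -
    have "d (poly p t) = poly (map_poly d p) t + poly (pderiv p) t * d t"
      using E sup p by (intro deriv_poly[OF E(1) d]) (auto intro: poly_over_mono)
    moreover have "map_poly d p \<in> poly_over ?G"
      using p assms(5) d0 by (auto simp: poly_over_def coeff_map_poly)
    moreover have "pderiv p \<in> poly_over ?G" "p \<in> poly_over ?G"
      using p F by (auto intro!: poly_over_mono[OF sup(1)] poly_over_pderiv)
    ultimately show ?thesis using assms sup by (auto intro!: subfield_intros poly_over_eval subfield_gen_field)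
  qed
  obtain p q where pq: "p \<in> poly_over F" "q \<in> poly_over F" "poly q t \<noteq> 0" "y = poly p t / poly q t"
    using assms(7) unfolding gen_field_fractions[OF F] by blast
  have "d y = (d (poly p t) * poly q t - poly p t * d (poly q t)) / (poly q t * poly q t)"
    unfolding pq(4) using ev[OF pq(1)] ev[OF pq(2)] E pq(3) by (intro deriv_divide[OF E(1) d]) auto
  then show ?thesis using ev[OF pq(1)] ev[OF pq(2)] by (simp add: subfield_intros subfield_gen_field)
qed

section \<open>Norm and trace\<close>

lemma finite_ext_basis:
  assumes "finite_ext F E"
  shows "\<exists>(n::nat) b. n > 0 \<and> (\<forall>i<n. b i \<in> E) \<and>
    (\<forall>y\<in>E. \<exists>a. (\<forall>i. a i \<in> F) \<and> y = (\<Sum>i<n. a i * b i)) \<and>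
    (\<forall>a. (\<forall>i. a i \<in> F) \<longrightarrow> (\<Sum>i<n. a i * b i) = 0 \<longrightarrow> (\<forall>i<n. a i = 0))"
proof -
  have sf: "subfield F" "subfield E" "F \<subseteq> E" using assms by (auto simp: finite_ext_def)
  define S where "S n b \<longleftrightarrow> (\<forall>i<n. b i \<in> E) \<and> (\<forall>y\<in>E. \<exists>a. (\<forall>i. a i \<in> F) \<and> y = (\<Sum>i<n. a i * b i))"
    for n :: nat and b :: "nat \<Rightarrow> 'a"
  have "\<exists>n b. S n b"
  proof -
    obtain I :: "nat set" and b where I: "finite I" "b ` I \<subseteq> E" "E \<subseteq> lspan F I b"
      using assms unfolding finite_ext_iff_lspan by blast
    obtain f where f: "bij_betw f {0..<card I} I" using ex_bij_betw_nat_finite[OF I(1)] by blast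
    have "\<exists>a. (\<forall>i. a i \<in> F) \<and> y = (\<Sum>i<card I. a i * b (f i))" if y: "y \<in> E" for y
    proof -
      obtain a where a: "\<forall>i. a i \<in> F" "y = (\<Sum>i\<in>I. a i * b i)"
        using subsetD[OF I(3) y] unfolding lspan_def by blast
      have "y = (\<Sum>i<card I. a (f i) * b (f i))" unfolding a(2)
        using sum.reindex_bij_betw[OF f, of "\<lambda>i. a i * b i"] by (simp add: lessThan_atLeast0)
      then show ?thesis using a(1) by (intro exI[of _ "\<lambda>i. a (f i)"]) auto
    qed
    moreover have "b (f i) \<in> E" if "i < card I" for i using bij_betwE[OF f] I(2) that by auto
    ultimately have "S (card I) (\<lambda>i. b (f i))" unfolding S_def by blast
    then show ?thesis by blast
  qed
  then have ex: "\<exists>n. \<exists>b. S n b" .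
  define n where "n = (LEAST n. \<exists>b. S n b)"
  obtain b where b: "S n b" using LeastI_ex[OF ex] unfolding n_def by blast
  have min: "\<not> S m b'" if "m < n" for m b' using not_less_Least that unfolding n_def by blast
  have ind: "a i = 0" if a: "\<And>i. a i \<in> F" "(\<Sum>i<n. a i * b i) = 0" "i < n" for a i
  proof (rule ccontr)
    assume ai: "a i \<noteq> 0"
    obtain m where m: "n = Suc m" using a(3) by (cases n) auto
    \<comment> \<open>Closes the gap left by the index \<open>i\<close>, so that the shorter family
      is again indexed by an initial segment.\<close>
    define f where "f j = (if j < i then j else Suc j)" for j
    have f: "bij_betw f {..<m} ({..<n} - {i})"
      by (rule bij_betwI[where g = "\<lambda>j. if j < i then j else j - 1"])
         (use a(3) m in \<open>auto simp: f_def split: if_splits\<close>)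
    have bi: "b i = (\<Sum>j\<in>{..<n}-{i}. - (a j / a i) * b j)"
    proof -
      have "a i * b i + (\<Sum>j\<in>{..<n}-{i}. a j * b j) = 0"
        using a(2,3) sum.remove[of "{..<n}" i "\<lambda>j. a j * b j"] by simp
      then have "b i = - (\<Sum>j\<in>{..<n}-{i}. a j * b j) / a i" using ai by (simp add: field_simps eq_neg_iff_add_eq_0)
      then show ?thesis by (simp add: sum_divide_distrib sum_negf[symmetric])
    qed
    have "\<exists>e. (\<forall>i. e i \<in> F) \<and> y = (\<Sum>j<m. e j * b (f j))" if y: "y \<in> E" for y
    proof -
      obtain c where c: "\<forall>i. c i \<in> F" "y = (\<Sum>i<n. c i * b i)" using b y unfolding S_def by blast
      have "y = c i * b i + (\<Sum>j\<in>{..<n}-{i}. c j * b j)" unfolding c(2) using a(3)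
        by (intro sum.remove) auto
      also have "\<dots> = (\<Sum>j\<in>{..<n}-{i}. (c j - c i * (a j / a i)) * b j)"
        by (subst bi) (simp add: sum_distrib_left sum.distrib[symmetric] algebra_simps)
      also have "\<dots> = (\<Sum>j<m. (c (f j) - c i * (a (f j) / a i)) * b (f j))"
        using sum.reindex_bij_betw[OF f, of "\<lambda>j. (c j - c i * (a j / a i)) * b j"] by simp
      finally show ?thesis using c(1) a(1) sf
        by (intro exI[of _ "\<lambda>j. c (f j) - c i * (a (f j) / a i)"]) (auto simp: subfield_intros)
    qed
    moreover have "b (f j) \<in> E" if "j < m" for j using b bij_betwE[OF f] that unfolding S_def by auto
    ultimately have "S m (\<lambda>j. b (f j))" unfolding S_def by blast
    then show False using min[of m] m by blast
  qed
  have "n > 0"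
  proof (rule ccontr)
    assume "\<not> n > 0"
    then have "1 = (0::'a)" using b subfield_one[OF sf(2)] unfolding S_def by fastforce
    then show False by simp
  qed
  moreover have "\<forall>i<n. b i \<in> E" "\<forall>y\<in>E. \<exists>a. (\<forall>i. a i \<in> F) \<and> y = (\<Sum>i<n. a i * b i)"
    using b unfolding S_def by simp_all
  moreover have "\<forall>a. (\<forall>i. a i \<in> F) \<longrightarrow> (\<Sum>i<n. a i * b i) = 0 \<longrightarrow> (\<forall>i<n. a i = 0)"
    using ind by blast
  ultimately show ?thesis by (intro exI[of _ n] exI[of _ b] conjI)
qed

text \<open>Liouville's formula for the linear system with matrix \<open>M\<close>. Differentiating
  row \<open>l\<close> replaces it by a combination of the rows \<open>k\<close>; a determinant with
  row \<open>k\<close> in place of row \<open>l\<close> has a repeated row unless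
  \<open>k = l\<close>, so only the diagonal of \<open>M\<close> survives.\<close>

lemma deriv_det:
  fixes A M :: "'a::field mat"
  assumes F: "subfield F" and d: "deriv_on F \<delta>"
    and A: "A \<in> carrier_mat n n" "\<And>i j. i < n \<Longrightarrow> j < n \<Longrightarrow> A $$ (i,j) \<in> F"
    and dA: "\<And>i j. i < n \<Longrightarrow> j < n \<Longrightarrow> \<delta> (A $$ (i,j)) = (\<Sum>k<n. M $$ (i,k) * A $$ (k,j))"
  shows "\<delta> (det A) = (\<Sum>i<n. M $$ (i,i)) * det A"
proof -
  let ?P = "{p. p permutes {0..<n}}"
  define R where "R l k = mat n n (\<lambda>(i,j). if i = l then A $$ (k,j) else A $$ (i,j))" for l k
  have pin: "p i < n" if "p \<in> ?P" "i < n" for p i using that permutes_in_image[of p "{0..<n}" i] by auto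
  have sgF: "signof p \<in> F" for p :: "nat \<Rightarrow> nat" using F by (auto simp: sign_def subfield_intros)
  have dsg: "\<delta> (signof p * z) = signof p * \<delta> z" if "z \<in> F" for p :: "nat \<Rightarrow> nat" and z
    using deriv_uminus[OF F d that] by (auto simp: sign_def)
  have detR: "det (R l k) = (\<Sum>p\<in>?P. signof p * (A $$ (k, p l) * (\<Prod>i\<in>{0..<n}-{l}. A $$ (i, p i))))" if "l < n" for l k
  proof -
    have "det (R l k) = (\<Sum>p\<in>?P. signof p * (\<Prod>i\<in>{0..<n}. R l k $$ (i, p i)))"
      by (rule det_def') (simp add: R_def)
    also have "\<dots> = (\<Sum>p\<in>?P. signof p * (A $$ (k, p l) * (\<Prod>i\<in>{0..<n}-{l}. A $$ (i, p i))))"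
    proof (rule sum.cong[OF refl])
      fix p assume p: "p \<in> ?P"
      have "(\<Prod>i\<in>{0..<n}. R l k $$ (i, p i)) = R l k $$ (l, p l) * (\<Prod>i\<in>{0..<n}-{l}. R l k $$ (i, p i))"
        using that by (intro prod.remove) auto
      also have "\<dots> = A $$ (k, p l) * (\<Prod>i\<in>{0..<n}-{l}. A $$ (i, p i))"
        using that pin[OF p] by (intro arg_cong2[of _ _ _ _ "(*)"] prod.cong) (auto simp: R_def)
      finally show "signof p * (\<Prod>i\<in>{0..<n}. R l k $$ (i, p i)) = signof p * (A $$ (k, p l) * (\<Prod>i\<in>{0..<n}-{l}. A $$ (i, p i)))"
        by simp
    qed
    finally show ?thesis .
  qed
  have detR': "det (R l k) = (if k = l then det A else 0)" if lk: "l < n" "k < n" for l k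
  proof (cases "k = l")
    case True
    then have "R l k = A" using A by (intro eq_matI) (auto simp: R_def)
    then show ?thesis using True by simp
  next
    case False
    have "row (R l k) l = row (R l k) k" using lk by (intro eq_vecI) (auto simp: R_def)
    then have "det (R l k) = 0" using False lk by (intro det_identical_rows[of _ n l k]) (auto simp: R_def)
    then show ?thesis using False by simp
  qed
  have prF: "(\<Prod>i\<in>I. A $$ (i, p i)) \<in> F" if "p \<in> ?P" "I \<subseteq> {0..<n}" for p I
    using that A(2) pin F by (intro subfield_prod) auto
  have "\<delta> (det A) = (\<Sum>p\<in>?P. signof p * \<delta> (\<Prod>i\<in>{0..<n}. A $$ (i, p i)))"
    unfolding det_def'[OF A(1)] using F prF sgF
    by (subst deriv_sum[OF F d]) (auto simp: dsg subfield_mult)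
  also have "\<dots> = (\<Sum>p\<in>?P. \<Sum>l\<in>{0..<n}. \<Sum>k<n. M $$ (l,k) * (signof p * (A $$ (k, p l) * (\<Prod>i\<in>{0..<n}-{l}. A $$ (i, p i)))))"
  proof (rule sum.cong[OF refl])
    fix p assume p: "p \<in> ?P"
    have "\<delta> (\<Prod>i\<in>{0..<n}. A $$ (i, p i)) = (\<Sum>l\<in>{0..<n}. \<delta> (A $$ (l, p l)) * (\<Prod>i\<in>{0..<n}-{l}. A $$ (i, p i)))"
      using p pin A(2) by (intro deriv_prod[OF F d]) auto
    also have "\<dots> = (\<Sum>l\<in>{0..<n}. (\<Sum>k<n. M $$ (l,k) * A $$ (k, p l)) * (\<Prod>i\<in>{0..<n}-{l}. A $$ (i, p i)))"
      using p pin dA by (intro sum.cong refl) auto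
    finally show "signof p * \<delta> (\<Prod>i\<in>{0..<n}. A $$ (i, p i)) =
      (\<Sum>l\<in>{0..<n}. \<Sum>k<n. M $$ (l,k) * (signof p * (A $$ (k, p l) * (\<Prod>i\<in>{0..<n}-{l}. A $$ (i, p i)))))"
      by (simp add: sum_distrib_left sum_distrib_right mult_ac)
  qed
  also have "\<dots> = (\<Sum>l\<in>{0..<n}. \<Sum>k<n. \<Sum>p\<in>?P. M $$ (l,k) * (signof p * (A $$ (k, p l) * (\<Prod>i\<in>{0..<n}-{l}. A $$ (i, p i)))))"
    by (subst sum.swap) (intro sum.cong refl sum.swap)
  also have "\<dots> = (\<Sum>l\<in>{0..<n}. \<Sum>k<n. M $$ (l,k) * det (R l k))"
    by (intro sum.cong refl) (simp add: detR sum_distrib_left)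
  also have "\<dots> = (\<Sum>l\<in>{0..<n}. \<Sum>k<n. if k = l then M $$ (l,k) * det A else 0)"
    by (intro sum.cong refl) (auto simp: detR')
  also have "\<dots> = (\<Sum>l\<in>{0..<n}. M $$ (l,l) * det A)"
    by (intro sum.cong refl) simp
  finally show ?thesis by (simp add: sum_distrib_right lessThan_atLeast0)
qed

definition mtrace :: "nat \<Rightarrow> 'a::field mat \<Rightarrow> 'a" where
  "mtrace n A = (\<Sum>i<n. A $$ (i,i))"

lemma mtrace_comm:
  assumes "A \<in> carrier_mat n n" "B \<in> carrier_mat n n"
  shows "mtrace n (A * B) = mtrace n (B * A)"
proof -
  have "mtrace n (A * B) = (\<Sum>i<n. \<Sum>k<n. A $$ (i,k) * B $$ (k,i))"
    using assms unfolding mtrace_def by (intro sum.cong refl) (auto simp: scalar_prod_def lessThan_atLeast0)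
  also have "\<dots> = (\<Sum>k<n. \<Sum>i<n. A $$ (i,k) * B $$ (k,i))" by (rule sum.swap)
  also have "\<dots> = mtrace n (B * A)"
    using assms unfolding mtrace_def by (intro sum.cong refl) (auto simp: scalar_prod_def lessThan_atLeast0 mult.commute)
  finally show ?thesis .
qed

lemma mtrace_add: "A \<in> carrier_mat n n \<Longrightarrow> B \<in> carrier_mat n n \<Longrightarrow> mtrace n (A + B) = mtrace n A + mtrace n B"
  and mtrace_minus: "A \<in> carrier_mat n n \<Longrightarrow> B \<in> carrier_mat n n \<Longrightarrow> mtrace n (A - B) = mtrace n A - mtrace n B"
  unfolding mtrace_def by (auto simp: sum.distrib sum_subtractf)

text \<open>Trace and determinant of the multiplication matrices in a basis. A single existential
  statement makes the same \<open>Tr\<close> and \<open>N\<close> serve every derivation preserving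
  both fields, since the descent applies them to all \<open>D i\<close> and to \<theta>.\<close>

lemma trace_norm_exist:
  fixes F :: "'a::field set"
  assumes ext: "finite_ext F E"
  shows "\<exists>Tr N (n::nat). n > 0 \<and> (\<forall>y\<in>E. Tr y \<in> F) \<and>
    (\<forall>y\<in>E. \<forall>z\<in>E. Tr (y + z) = Tr y + Tr z) \<and>
    (\<forall>a\<in>F. \<forall>y\<in>E. Tr (a * y) = a * Tr y) \<and>
    (\<forall>a\<in>F. Tr a = of_nat n * a) \<and>
    (\<forall>u\<in>E. u \<noteq> 0 \<longrightarrow> N u \<in> F \<and> N u \<noteq> 0) \<and>
    (\<forall>\<delta>. deriv_on E \<delta> \<longrightarrow> (\<forall>a\<in>F. \<delta> a \<in> F) \<longrightarrow> (\<forall>a\<in>E. \<delta> a \<in> E) \<longrightarrow>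
      (\<forall>y\<in>E. Tr (\<delta> y) = \<delta> (Tr y)) \<and> (\<forall>u\<in>E. u \<noteq> 0 \<longrightarrow> Tr (\<delta> u / u) = \<delta> (N u) / N u))"
proof -
  have sf: "subfield F" "subfield E" "F \<subseteq> E" using ext by (auto simp: finite_ext_def)
  from finite_ext_basis[OF ext] obtain n :: nat and b where n: "n > 0" and b': "\<forall>i<n. b i \<in> E"
    and span: "\<forall>y\<in>E. \<exists>a. (\<forall>i. a i \<in> F) \<and> y = (\<Sum>i<n. a i * b i)"
    and ind': "\<forall>a. (\<forall>i. a i \<in> F) \<longrightarrow> (\<Sum>i<n. a i * b i) = 0 \<longrightarrow> (\<forall>i<n. a i = 0)"
    by (elim exE conjE)
  have b: "\<And>i. i < n \<Longrightarrow> b i \<in> E" using b' by blast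
  have ind: "a i = 0" if "\<And>i. a i \<in> F" "(\<Sum>i<n. a i * b i) = 0" "i < n" for a i
    using ind'[rule_format, of a i] that by blast
  from span obtain co where "\<forall>y\<in>E. (\<forall>i. co y i \<in> F) \<and> y = (\<Sum>i<n. co y i * b i)"
    by (elim bchoice[THEN exE])
  then have co: "\<And>y i. y \<in> E \<Longrightarrow> co y i \<in> F" "\<And>y. y \<in> E \<Longrightarrow> y = (\<Sum>i<n. co y i * b i)" by blast+
  have uniq: "co y i = a i" if "y \<in> E" "\<And>i. i < n \<Longrightarrow> a i \<in> F" "y = (\<Sum>i<n. a i * b i)" "i < n" for y a i
  proof -
    define e where "e j = (if j < n then co y j - a j else 0)" for j
    have "(\<Sum>j<n. e j * b j) = (\<Sum>j<n. co y j * b j) - (\<Sum>j<n. a j * b j)"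
      unfolding e_def sum_subtractf[symmetric] by (intro sum.cong refl) (simp add: algebra_simps)
    also have "\<dots> = 0" using co(2)[OF that(1)] that(3) by simp
    finally have e0: "(\<Sum>j<n. e j * b j) = 0" .
    have "e j \<in> F" for j using that(2) sf co(1)[OF that(1)] by (auto simp: e_def subfield_intros)
    then have "e i = 0" using e0 that(4) by (rule ind)
    then show ?thesis using that(4) by (simp add: e_def)
  qed
  define A where "A u = mat n n (\<lambda>(i,j). co (u * b i) j)" for u
  define Tr where "Tr u = mtrace n (A u)" for u
  define N where "N u = det (A u)" for u
  have Ac[simp]: "A u \<in> carrier_mat n n" for u unfolding A_def by simp
  have Adim[simp]: "dim_row (A u) = n" "dim_col (A u) = n" for u unfolding A_def by auto
  have ub: "u * b i \<in> E" if "u \<in> E" "i < n" for u i using that b sf by (auto intro: subfield_mult)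
  have AF: "A u $$ (i,j) \<in> F" if "u \<in> E" "i < n" "j < n" for u i j using that co(1)[OF ub] by (simp add: A_def)
  have Aeq: "u * b i = (\<Sum>j<n. A u $$ (i,j) * b j)" if "u \<in> E" "i < n" for u i
  proof -
    have "u * b i = (\<Sum>j<n. co (u * b i) j * b j)" by (rule co(2)[OF ub[OF that]])
    also have "\<dots> = (\<Sum>j<n. A u $$ (i,j) * b j)" using that by (intro sum.cong refl) (simp add: A_def)
    finally show ?thesis .
  qed
  have Auniq: "A u = B" if u: "u \<in> E" and B: "B \<in> carrier_mat n n" "\<And>i j. i < n \<Longrightarrow> j < n \<Longrightarrow> B $$ (i,j) \<in> F"
      "\<And>i. i < n \<Longrightarrow> u * b i = (\<Sum>j<n. B $$ (i,j) * b j)" for u B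
  proof (rule eq_matI)
    fix i j assume ij: "i < dim_row B" "j < dim_col B"
    then have "i < n" "j < n" using B by auto
    then show "A u $$ (i,j) = B $$ (i,j)" using uniq[OF ub[OF u], of i "\<lambda>j. B $$ (i,j)" j] B by (simp add: A_def)
  qed (use B in auto)
  have mult_entry: "(B * C) $$ (i,j) = (\<Sum>k<n. B $$ (i,k) * C $$ (k,j))"
    if "B \<in> carrier_mat n n" "C \<in> carrier_mat n n" "i < n" "j < n" for B C :: "'a mat" and i j
    using that by (auto simp: scalar_prod_def lessThan_atLeast0)
  have expand: "(\<Sum>k<n. x k * (\<Sum>j<n. B $$ (k,j) * b j)) = (\<Sum>j<n. (\<Sum>k<n. x k * B $$ (k,j)) * b j)" for x B
  proof -
    have "(\<Sum>k<n. x k * (\<Sum>j<n. B $$ (k,j) * b j)) = (\<Sum>k<n. \<Sum>j<n. x k * B $$ (k,j) * b j)"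
      by (simp add: sum_distrib_left mult.assoc)
    also have "\<dots> = (\<Sum>j<n. \<Sum>k<n. x k * B $$ (k,j) * b j)" by (rule sum.swap)
    finally show ?thesis by (simp add: sum_distrib_right)
  qed
  have Aadd: "A (u + w) = A u + A w" if uw: "u \<in> E" "w \<in> E" for u w
  proof (rule Auniq)
    fix i assume i: "i < n"
    have "(u + w) * b i = u * b i + w * b i" by (simp add: algebra_simps)
    also have "\<dots> = (\<Sum>j<n. A u $$ (i,j) * b j) + (\<Sum>j<n. A w $$ (i,j) * b j)" using Aeq uw i by simp
    also have "\<dots> = (\<Sum>j<n. (A u + A w) $$ (i,j) * b j)" unfolding sum.distrib[symmetric]
      using i by (intro sum.cong refl) (simp add: algebra_simps)
    finally show "(u + w) * b i = (\<Sum>j<n. (A u + A w) $$ (i,j) * b j)" .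
  qed (use uw sf AF in \<open>auto simp: subfield_add\<close>)
  have Amult: "A (u * w) = A u * A w" if uw: "u \<in> E" "w \<in> E" for u w
  proof (rule Auniq)
    fix i assume i: "i < n"
    have "u * w * b i = w * (u * b i)" by (simp add: mult_ac)
    also have "\<dots> = (\<Sum>k<n. A u $$ (i,k) * (w * b k))" by (subst Aeq[OF uw(1) i]) (simp add: sum_distrib_left mult_ac)
    also have "\<dots> = (\<Sum>k<n. A u $$ (i,k) * (\<Sum>j<n. A w $$ (k,j) * b j))"
      by (intro sum.cong refl arg_cong2[of _ _ _ _ "(*)"] Aeq uw) simp
    also have "\<dots> = (\<Sum>j<n. (\<Sum>k<n. A u $$ (i,k) * A w $$ (k,j)) * b j)" by (rule expand)
    also have "\<dots> = (\<Sum>j<n. (A u * A w) $$ (i,j) * b j)" using i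
      by (intro sum.cong refl) (simp add: mult_entry[OF Ac Ac] del: index_mult_mat)
    finally show "u * w * b i = (\<Sum>j<n. (A u * A w) $$ (i,j) * b j)" .
  next
    fix i j assume "i < n" "j < n"
    then show "(A u * A w) $$ (i,j) \<in> F" unfolding mult_entry[OF Ac Ac \<open>i < n\<close> \<open>j < n\<close>]
      using AF uw sf by (auto intro!: subfield_sum subfield_mult)
  qed (use uw sf in \<open>auto intro: subfield_mult\<close>)
  have Ascal: "A a = a \<cdot>\<^sub>m 1\<^sub>m n" if a: "a \<in> F" for a
  proof (rule Auniq)
    fix i assume i: "i < n"
    have "(\<Sum>j<n. (a \<cdot>\<^sub>m 1\<^sub>m n) $$ (i,j) * b j) = (\<Sum>j<n. if j = i then a * b j else 0)"
      using i by (intro sum.cong refl) auto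
    then show "a * b i = (\<Sum>j<n. (a \<cdot>\<^sub>m 1\<^sub>m n) $$ (i,j) * b j)" using i by simp
  qed (use a sf in \<open>auto simp: subfield_zero\<close>)
  have Aone: "A 1 = 1\<^sub>m n" using Ascal[OF subfield_one[OF sf(1)]] by (auto intro!: eq_matI)
  have TrF: "Tr y \<in> F" if "y \<in> E" for y unfolding Tr_def mtrace_def using that AF sf by (intro subfield_sum) auto
  have Tradd: "Tr (y + z) = Tr y + Tr z" if "y \<in> E" "z \<in> E" for y z
    unfolding Tr_def Aadd[OF that] by (rule mtrace_add) auto
  have Trlin: "Tr (a * y) = a * Tr y" if "a \<in> F" "y \<in> E" for a y
  proof -
    have "A (a * y) = a \<cdot>\<^sub>m 1\<^sub>m n * A y" using Amult[of a y] Ascal[OF that(1)] that sf by auto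
    also have "\<dots> = a \<cdot>\<^sub>m (1\<^sub>m n * A y)" by (rule mult_smult_assoc_mat) auto
    also have "1\<^sub>m n * A y = A y" by (rule left_mult_one_mat) auto
    finally have "A (a * y) = a \<cdot>\<^sub>m A y" .
    then show ?thesis unfolding Tr_def mtrace_def sum_distrib_left by (intro sum.cong) auto
  qed
  have Trscal: "Tr a = of_nat n * a" if "a \<in> F" for a
    unfolding Tr_def mtrace_def Ascal[OF that] by simp
  have inv: "A u * A (1 / u) = 1\<^sub>m n" "A (1 / u) * A u = 1\<^sub>m n" if "u \<in> E" "u \<noteq> 0" for u
    using Amult[of u "1 / u"] Amult[of "1 / u" u] that sf Aone by (auto simp: subfield_intros)
  have NF: "N u \<in> F \<and> N u \<noteq> 0" if u: "u \<in> E" "u \<noteq> 0" for u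
  proof
    have "p permutes {0..<n} \<Longrightarrow> i < n \<Longrightarrow> p i < n" for p i using permutes_in_image[of p "{0..<n}" i] by auto
    then show "N u \<in> F" unfolding N_def det_def'[OF Ac] using AF u sf
      by (auto intro!: subfield_sum subfield_mult subfield_prod simp: sign_def subfield_intros)
    have "det (A u) * det (A (1 / u)) = 1" using inv(1)[OF u] det_mult[OF Ac Ac, of u "1 / u"] by simp
    then show "N u \<noteq> 0" unfolding N_def by auto
  qed
  {
    fix \<delta> assume d: "deriv_on E \<delta>" and dF: "\<And>a. a \<in> F \<Longrightarrow> \<delta> a \<in> F" and dE: "\<And>a. a \<in> E \<Longrightarrow> \<delta> a \<in> E"
    \<comment> \<open>The connection matrix of \<delta>: it records how far the basis is from being
      constant.\<close>
    define \<Gamma> where "\<Gamma> = mat n n (\<lambda>(i,j). co (\<delta> (b i)) j)"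
    define DA where "DA u = mat n n (\<lambda>(i,j). \<delta> (A u $$ (i,j)))" for u
    have c[simp]: "\<Gamma> \<in> carrier_mat n n" "DA u \<in> carrier_mat n n" for u unfolding \<Gamma>_def DA_def by auto
    have gdim: "dim_row \<Gamma> = n" "dim_col \<Gamma> = n" unfolding \<Gamma>_def by auto
    have GF: "\<Gamma> $$ (i,j) \<in> F" if "i < n" "j < n" for i j using that co(1)[OF dE[OF b]] by (simp add: \<Gamma>_def)
    have Geq: "\<delta> (b i) = (\<Sum>j<n. \<Gamma> $$ (i,j) * b j)" if "i < n" for i
    proof -
      have "\<delta> (b i) = (\<Sum>j<n. co (\<delta> (b i)) j * b j)" by (rule co(2)[OF dE[OF b[OF that]]])
      also have "\<dots> = (\<Sum>j<n. \<Gamma> $$ (i,j) * b j)" using that by (intro sum.cong refl) (simp add: \<Gamma>_def)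
      finally show ?thesis .
    qed
    \<comment> \<open>Compare the coordinates of \<open>\<delta> (u * b i)\<close> obtained by
      differentiating the expansion of \<open>u * b i\<close> with those obtained from the product
      rule.\<close>
    have key: "DA u + A u * \<Gamma> = A (\<delta> u) + \<Gamma> * A u" if u: "u \<in> E" for u
    proof (rule eq_matI)
      fix i j assume "i < dim_row (A (\<delta> u) + \<Gamma> * A u)" "j < dim_col (A (\<delta> u) + \<Gamma> * A u)"
      then have ij: "i < n" "j < n" by (auto simp: \<Gamma>_def)
      have "\<delta> (u * b i) = (\<Sum>k<n. A u $$ (i,k) * \<delta> (b k) + \<delta> (A u $$ (i,k)) * b k)"
        unfolding Aeq[OF u ij(1)] using AF[OF u ij(1)] b sf
        by (subst deriv_sum[OF sf(2) d]) (auto intro!: sum.cong deriv_mult[OF sf(2) d] subfield_mult)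
      also have "\<dots> = (\<Sum>k<n. A u $$ (i,k) * (\<Sum>j<n. \<Gamma> $$ (k,j) * b j)) + (\<Sum>k<n. DA u $$ (i,k) * b k)"
        using ij by (simp add: sum.distrib Geq DA_def)
      also have "\<dots> = (\<Sum>j<n. (\<Sum>k<n. A u $$ (i,k) * \<Gamma> $$ (k,j)) * b j) + (\<Sum>k<n. DA u $$ (i,k) * b k)"
        by (simp only: expand)
      also have "\<dots> = (\<Sum>j<n. ((\<Sum>k<n. A u $$ (i,k) * \<Gamma> $$ (k,j)) + DA u $$ (i,j)) * b j)"
        by (simp add: sum.distrib algebra_simps)
      finally have 1: "\<delta> (u * b i) = \<dots>" .
      have "\<delta> (u * b i) = u * \<delta> (b i) + \<delta> u * b i" using u b ij by (intro deriv_mult[OF sf(2) d]) auto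
      also have "\<dots> = (\<Sum>k<n. \<Gamma> $$ (i,k) * (u * b k)) + (\<Sum>j<n. A (\<delta> u) $$ (i,j) * b j)"
        unfolding Geq[OF ij(1)] Aeq[OF dE[OF u] ij(1)] by (simp add: sum_distrib_left mult_ac)
      also have "\<dots> = (\<Sum>k<n. \<Gamma> $$ (i,k) * (\<Sum>j<n. A u $$ (k,j) * b j)) + (\<Sum>j<n. A (\<delta> u) $$ (i,j) * b j)"
        using Aeq[OF u] by simp
      also have "\<dots> = (\<Sum>j<n. (\<Sum>k<n. \<Gamma> $$ (i,k) * A u $$ (k,j)) * b j) + (\<Sum>j<n. A (\<delta> u) $$ (i,j) * b j)"
        by (simp only: expand)
      also have "\<dots> = (\<Sum>j<n. ((\<Sum>k<n. \<Gamma> $$ (i,k) * A u $$ (k,j)) + A (\<delta> u) $$ (i,j)) * b j)"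
        by (simp add: sum.distrib algebra_simps)
      finally have 2: "\<delta> (u * b i) = \<dots>" .
      have dub: "\<delta> (u * b i) \<in> E" using dE ub u ij by blast
      have "co (\<delta> (u * b i)) j = (\<Sum>k<n. A u $$ (i,k) * \<Gamma> $$ (k,j)) + DA u $$ (i,j)"
        by (rule uniq[OF dub _ 1 ij(2)])
           (use AF[OF u] GF ij sf dF in \<open>auto intro!: subfield_sum subfield_mult subfield_add simp: DA_def\<close>)
      moreover have "co (\<delta> (u * b i)) j = (\<Sum>k<n. \<Gamma> $$ (i,k) * A u $$ (k,j)) + A (\<delta> u) $$ (i,j)"
        by (rule uniq[OF dub _ 2 ij(2)])
           (use AF[OF u] AF[OF dE[OF u]] GF ij sf in \<open>auto intro!: subfield_sum subfield_mult subfield_add\<close>)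
      moreover have "(DA u + A u * \<Gamma>) $$ (i,j) = DA u $$ (i,j) + (\<Sum>k<n. A u $$ (i,k) * \<Gamma> $$ (k,j))"
        "(A (\<delta> u) + \<Gamma> * A u) $$ (i,j) = A (\<delta> u) $$ (i,j) + (\<Sum>k<n. \<Gamma> $$ (i,k) * A u $$ (k,j))"
        using ij mult_entry[OF Ac c(1) ij, of u] mult_entry[OF c(1) Ac ij, of u]
        by (simp_all add: gdim del: index_mult_mat(1))
      ultimately show "(DA u + A u * \<Gamma>) $$ (i,j) = (A (\<delta> u) + \<Gamma> * A u) $$ (i,j)" by (simp add: add.commute)
    qed (auto simp: \<Gamma>_def DA_def)
    have tr: "mtrace n (DA u) = \<delta> (Tr u)" if u: "u \<in> E" for u
      unfolding mtrace_def Tr_def using AF[OF u] sf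
      by (subst deriv_sum[OF sf(2) d]) (auto simp: DA_def)
    \<comment> \<open>In \<open>key\<close> the two terms with \<Gamma> form a commutator, whose
      trace is 0.\<close>
    have "Tr (\<delta> u) = \<delta> (Tr u)" if u: "u \<in> E" for u
    proof -
      have "mtrace n (DA u) + mtrace n (A u * \<Gamma>) = mtrace n (A (\<delta> u)) + mtrace n (\<Gamma> * A u)"
        using arg_cong[OF key[OF u], of "mtrace n"] by (simp add: mtrace_add[of _ n] mult_carrier_mat[of _ n n])
      then show ?thesis using mtrace_comm[OF Ac[of u] c(1)] tr[OF u] by (simp add: Tr_def)
    qed
    moreover have "Tr (\<delta> u / u) = \<delta> (N u) / N u" if u: "u \<in> E" "u \<noteq> 0" for u
    proof -
      define w where "w = \<delta> u / u"
      have w: "w \<in> E" unfolding w_def using u dE sf by (auto intro: subfield_divide)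
      have wu: "\<delta> u = w * u" unfolding w_def using u by simp
      \<comment> \<open>Multiplying \<open>key\<close> on the right by \<open>A (1 / u)\<close>, the
        inverse of \<open>A u\<close>, shows that \<open>A u\<close> solves the linear system with
        this matrix. In its trace \<Gamma> cancels against its conjugate, leaving
        \<open>Tr w\<close>.\<close>
      define M where "M = A w + \<Gamma> - A u * \<Gamma> * A (1 / u)"
      have cM: "A u * \<Gamma> \<in> carrier_mat n n" "\<Gamma> * A u \<in> carrier_mat n n" "A u * \<Gamma> * A (1 / u) \<in> carrier_mat n n"
        "A w * A u \<in> carrier_mat n n"
        by (auto intro!: mult_carrier_mat[of _ n n])
      have Mc: "M \<in> carrier_mat n n" unfolding M_def by (intro minus_carrier_mat cM)
      have "M * A u = A w * A u + \<Gamma> * A u - A u * \<Gamma> * A (1 / u) * A u"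
      proof -
        have "M * A u = (A w + \<Gamma>) * A u - A u * \<Gamma> * A (1 / u) * A u"
          unfolding M_def by (rule minus_mult_distrib_mat[of _ n n]) (auto intro: cM)
        also have "(A w + \<Gamma>) * A u = A w * A u + \<Gamma> * A u"
          by (rule add_mult_distrib_mat[of _ n n]) auto
        finally show ?thesis .
      qed
      also have "A u * \<Gamma> * A (1 / u) * A u = A u * \<Gamma>"
      proof -
        have "A u * \<Gamma> * A (1 / u) * A u = A u * \<Gamma> * (A (1 / u) * A u)"
          by (rule assoc_mult_mat[of _ n n _ n _ n]) (auto intro: cM)
        then show ?thesis unfolding inv(2)[OF u] using right_mult_one_mat[OF cM(1)] by simp
      qed
      also have "A w * A u + \<Gamma> * A u = DA u + A u * \<Gamma>" using key[OF u(1)] unfolding wu Amult[OF w u(1)] by simp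
      finally have MA: "M * A u = DA u + A u * \<Gamma> - A u * \<Gamma>" .
      have "\<delta> (A u $$ (i,j)) = (\<Sum>k<n. M $$ (i,k) * A u $$ (k,j))" if ij: "i < n" "j < n" for i j
      proof -
        have "(\<Sum>k<n. M $$ (i,k) * A u $$ (k,j)) = (M * A u) $$ (i,j)" using mult_entry[OF Mc Ac ij] by simp
        also have "\<dots> = DA u $$ (i,j)" unfolding MA using ij by (simp add: gdim del: index_mult_mat(1))
        finally show ?thesis using ij by (simp add: DA_def)
      qed
      then have "\<delta> (det (A u)) = mtrace n M * det (A u)" unfolding mtrace_def
        using AF[OF u(1)] deriv_on_subset[OF d sf(3)] by (intro deriv_det[OF sf(1)]) auto
      moreover have "mtrace n M = Tr w"
      proof -
        have "mtrace n (A u * \<Gamma> * A (1 / u)) = mtrace n (A (1 / u) * (A u * \<Gamma>))" by (rule mtrace_comm) (auto intro: cM)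
        also have "A (1 / u) * (A u * \<Gamma>) = \<Gamma>" 
        proof -
          have "A (1 / u) * (A u * \<Gamma>) = A (1 / u) * A u * \<Gamma>"
            by (rule assoc_mult_mat[of _ n n _ n _ n, symmetric]) auto
          then show ?thesis unfolding inv(2)[OF u] using left_mult_one_mat[OF c(1)] by simp
        qed
        finally show ?thesis unfolding M_def Tr_def using cM by (simp add: mtrace_add mtrace_minus)
      qed
      ultimately show ?thesis using NF[OF u] unfolding w_def N_def by simp
    qed
    ultimately have "(\<forall>u\<in>E. Tr (\<delta> u) = \<delta> (Tr u)) \<and> (\<forall>u\<in>E. u \<noteq> 0 \<longrightarrow> Tr (\<delta> u / u) = \<delta> (N u) / N u)" by blast
  } note D = this
  show ?thesis
    by (intro exI[of _ Tr] exI[of _ N] exI[of _ n] conjI ballI allI impI)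
       (simp_all add: n TrF Tradd Trlin Trscal NF D)
qed

section \<open>Values at infinity in a rational function field\<close>

text \<open>The finite value at infinity of a rational function of \<open>t\<close>. It is a
  relation because poles have no value. Taking \<open>coeff p (degree q)\<close> rather than the
  leading coefficient of \<open>p\<close> yields 0 for proper fractions without a case
  distinction.\<close>

definition lim_infinity :: "'a::field set \<Rightarrow> 'a \<Rightarrow> 'a \<Rightarrow> 'a \<Rightarrow> bool" where
  "lim_infinity F t z r \<longleftrightarrow> (\<exists>p q. p \<in> poly_over F \<and> q \<in> poly_over F \<and> q \<noteq> 0 \<and> degree p \<le> degree q \<and>
     z = poly p t / poly q t \<and> r = coeff p (degree q) / lead_coeff q)"

lemma coeff_mult_top:
  fixes p q :: "'a::comm_semiring_0 poly"
  assumes "degree p \<le> m" "degree q \<le> n"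
  shows "coeff (p * q) (m + n) = coeff p m * coeff q n"
proof (cases "degree p = m \<and> degree q = n")
  case True
  then show ?thesis using coeff_mult_degree_sum[of p q] by simp
next
  case False
  then have "degree p < m \<or> degree q < n" using assms by auto
  moreover have "degree (p * q) < m + n" using False assms degree_mult_le[of p q] by linarith
  ultimately show ?thesis by (auto simp: coeff_eq_0)
qed

text \<open>The derivation on polynomials in \<open>t\<close> induced by \<delta> when
  \<open>\<delta> t = \<alpha> + \<beta> * t\<close>.\<close>

definition poly_deriv :: "('a::field \<Rightarrow> 'a) \<Rightarrow> 'a \<Rightarrow> 'a \<Rightarrow> 'a poly \<Rightarrow> 'a poly" where
  "poly_deriv \<delta> \<alpha> \<beta> p = map_poly \<delta> p + pderiv p * [:\<alpha>, \<beta>:]"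

context
  fixes F :: "'a::field set" and t :: 'a
  assumes F: "subfield F" and t: "t \<notin> acl F"
begin

lemma poly_nonzero: "p \<in> poly_over F \<Longrightarrow> p \<noteq> 0 \<Longrightarrow> poly p t \<noteq> 0"
  using transcendental_nonzero[OF t] by blast

lemma poly_eq_transcendental:
  assumes "p \<in> poly_over F" "q \<in> poly_over F" "poly p t = poly q t" shows "p = q"
  using transcendental_nonzero[OF t poly_over_diff[OF F assms(1,2)]] assms(3) by simp

lemma lim_infinity_add:
  assumes "lim_infinity F t z a" "lim_infinity F t w b"
  shows "lim_infinity F t (z + w) (a + b)"
proof -
  obtain p q where pq: "p \<in> poly_over F" "q \<in> poly_over F" "q \<noteq> 0" "degree p \<le> degree q"
    "z = poly p t / poly q t" "a = coeff p (degree q) / lead_coeff q" using assms(1) unfolding lim_infinity_def by blast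
  obtain p' q' where pq': "p' \<in> poly_over F" "q' \<in> poly_over F" "q' \<noteq> 0" "degree p' \<le> degree q'"
    "w = poly p' t / poly q' t" "b = coeff p' (degree q') / lead_coeff q'" using assms(2) unfolding lim_infinity_def by blast
  have deg: "degree (q * q') = degree q + degree q'" using pq pq' by (simp add: degree_mult_eq)
  have c1: "coeff (p * q') (degree q + degree q') = coeff p (degree q) * lead_coeff q'"
    using pq by (intro coeff_mult_top) auto
  have c2: "coeff (p' * q) (degree q + degree q') = coeff p' (degree q') * lead_coeff q"
    using pq' coeff_mult_top[of p' "degree q'" q "degree q"] by (simp add: add.commute)
  have "degree (p * q') \<le> degree q + degree q'" "degree (p' * q) \<le> degree q + degree q'"
    using pq pq' degree_mult_le[of p q'] degree_mult_le[of p' q] by linarith+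
  then have "degree (p * q' + p' * q) \<le> degree (q * q')" unfolding deg by (rule degree_add_le)
  moreover have "p * q' + p' * q \<in> poly_over F" "q * q' \<in> poly_over F" "q * q' \<noteq> 0"
    using pq pq' F by (auto simp: poly_over_add poly_over_mult)
  moreover have "z + w = poly (p * q' + p' * q) t / poly (q * q') t"
    unfolding pq(5) pq'(5) using poly_nonzero[OF pq(2,3)] poly_nonzero[OF pq'(2,3)] by (simp add: field_simps)
  moreover have "a + b = coeff (p * q' + p' * q) (degree (q * q')) / lead_coeff (q * q')"
    unfolding deg coeff_add c1 c2 lead_coeff_mult pq(6) pq'(6) using pq(3) pq'(3) by (simp add: coeff_mult_degree_sum add_frac_eq)
  ultimately show ?thesis unfolding lim_infinity_def by blast
qed

text \<open>By transcendence of \<open>t\<close>, cross-multiplied representations agree as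
  polynomials; compare their coefficients at \<open>degree q + degree q'\<close>.\<close>

lemma lim_infinity_unique:
  assumes "lim_infinity F t z a" "lim_infinity F t z b"
  shows "a = b"
proof -
  obtain p q where pq: "p \<in> poly_over F" "q \<in> poly_over F" "q \<noteq> 0" "degree p \<le> degree q"
    "z = poly p t / poly q t" "a = coeff p (degree q) / lead_coeff q" using assms(1) unfolding lim_infinity_def by blast
  obtain p' q' where pq': "p' \<in> poly_over F" "q' \<in> poly_over F" "q' \<noteq> 0" "degree p' \<le> degree q'"
    "z = poly p' t / poly q' t" "b = coeff p' (degree q') / lead_coeff q'" using assms(2) unfolding lim_infinity_def by blast
  have "poly p t / poly q t = poly p' t / poly q' t" using pq(5) pq'(5) by simp
  then have "poly (p * q') t = poly (p' * q) t"
    using poly_nonzero[OF pq(2,3)] poly_nonzero[OF pq'(2,3)] by (simp add: frac_eq_eq)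
  then have "p * q' = p' * q" using pq pq' F by (intro poly_eq_transcendental) (auto simp: poly_over_mult)
  then have "coeff (p * q') (degree q + degree q') = coeff (p' * q) (degree q' + degree q)" by (simp add: add.commute)
  then have "coeff p (degree q) * lead_coeff q' = coeff p' (degree q') * lead_coeff q"
    using pq pq' by (simp add: coeff_mult_top)
  then show ?thesis using pq pq' by (simp add: frac_eq_eq)
qed

lemma lim_infinity_const: "a \<in> F \<Longrightarrow> lim_infinity F t a a"
  unfolding lim_infinity_def using F
  by (intro exI[of _ "[:a:]"] exI[of _ 1]) (auto simp: poly_over_pCons_iff poly_over_zero poly_over_one)

lemma lim_infinity_scale:
  assumes "a \<in> F" "lim_infinity F t z r" shows "lim_infinity F t (a * z) (a * r)"
proof -
  obtain p q where pq: "p \<in> poly_over F" "q \<in> poly_over F" "q \<noteq> 0" "degree p \<le> degree q"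
    "z = poly p t / poly q t" "r = coeff p (degree q) / lead_coeff q" using assms(2) unfolding lim_infinity_def by blast
  then show ?thesis unfolding lim_infinity_def using assms(1) F degree_smult_le[of a p]
    by (intro exI[of _ "smult a p"] exI[of _ q]) (auto simp: poly_over_smult)
qed

lemma lim_infinity_sum:
  "finite I \<Longrightarrow> (\<And>i. i \<in> I \<Longrightarrow> lim_infinity F t (f i) (g i)) \<Longrightarrow> lim_infinity F t (\<Sum>i\<in>I. f i) (\<Sum>i\<in>I. g i)"
  by (induction I rule: finite_induct) (auto intro: lim_infinity_const lim_infinity_add subfield_zero F)

text \<open>A nonconstant polynomial has a pole at infinity.\<close>

lemma lim_infinity_poly:
  assumes "p \<in> poly_over F" "lim_infinity F t (poly p t) r"
  shows "p = [:r:]"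
proof -
  obtain s q where sq: "s \<in> poly_over F" "q \<in> poly_over F" "q \<noteq> 0" "degree s \<le> degree q"
    "poly p t = poly s t / poly q t" "r = coeff s (degree q) / lead_coeff q" using assms(2) unfolding lim_infinity_def by blast
  have "poly (p * q) t = poly s t" using sq poly_nonzero[OF sq(2,3)] by simp
  then have eq: "p * q = s" using sq F assms by (intro poly_eq_transcendental) (auto simp: poly_over_mult)
  have "degree p = 0"
  proof (cases "p = 0")
    case False
    then have "degree s = degree p + degree q" using eq sq(3) by (auto simp: degree_mult_eq)
    then show ?thesis using sq(4) by simp
  qed simp
  then obtain a where a: "p = [:a:]" by (metis degree_0_id)
  have "coeff s (degree q) = a * lead_coeff q" using eq a by auto
  then show ?thesis using a sq by simp
qed

context
  fixes \<delta> :: "'a \<Rightarrow> 'a" and \<alpha> \<beta> :: 'a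
  assumes d: "deriv_on (gen_field F {t}) \<delta>" and dF: "\<And>a. a \<in> F \<Longrightarrow> \<delta> a \<in> F"
    and dt: "\<delta> t = \<alpha> + \<beta> * t" and ab: "\<alpha> \<in> F" "\<beta> \<in> F"
begin

lemma deriv_base: "deriv_on F \<delta>"
  using deriv_on_subset[OF d] gen_field_superset[of F "{t}"] by blast

lemma poly_over_poly_deriv: "p \<in> poly_over F \<Longrightarrow> poly_deriv \<delta> \<alpha> \<beta> p \<in> poly_over F"
  unfolding poly_deriv_def using F ab dF deriv_zero[OF F deriv_base]
  by (intro poly_over_add poly_over_mult poly_over_map_poly poly_over_pderiv) (auto simp: poly_over_pCons_iff poly_over_zero)

lemma deriv_poly_deriv: "p \<in> poly_over F \<Longrightarrow> \<delta> (poly p t) = poly (poly_deriv \<delta> \<alpha> \<beta> p) t"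
  using deriv_poly[OF subfield_gen_field d, of p t] poly_over_mono[of F "gen_field F {t}" p] gen_field_superset[of F "{t}"]
  by (simp add: poly_deriv_def dt algebra_simps)

text \<open>The \<alpha>-term contributes only through the coefficient at \<open>n + 1\<close>,
  which vanishes by the degree bound. Hence an affine \<open>\<delta> t\<close> never raises
  degrees.\<close>

lemma coeff_poly_deriv:
  assumes "degree p \<le> n"
  shows "coeff (poly_deriv \<delta> \<alpha> \<beta> p) n = \<delta> (coeff p n) + of_nat n * \<beta> * coeff p n"
  using assms deriv_zero[OF F deriv_base]
  by (cases n) (auto simp: poly_deriv_def coeff_map_poly coeff_pderiv coeff_eq_0 algebra_simps simp del: of_nat_Suc)

lemma degree_poly_deriv: "degree (poly_deriv \<delta> \<alpha> \<beta> p) \<le> degree p"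
  by (rule degree_le) (use coeff_poly_deriv deriv_zero[OF F deriv_base] in \<open>auto simp: coeff_eq_0\<close>)

lemma lim_infinity_log_deriv_poly:
  assumes "p \<in> poly_over F" "p \<noteq> 0"
  shows "lim_infinity F t (\<delta> (poly p t) / poly p t) (\<delta> (lead_coeff p) / lead_coeff p + of_nat (degree p) * \<beta>)"
  unfolding lim_infinity_def
  using assms poly_over_poly_deriv[OF assms(1)] degree_poly_deriv[of p] deriv_poly_deriv[OF assms(1)] coeff_poly_deriv[of p "degree p"]
  by (intro exI[of _ "poly_deriv \<delta> \<alpha> \<beta> p"] exI[of _ p]) (auto simp: field_simps)

lemma lim_infinity_log_deriv_fraction:
  assumes "p \<in> poly_over F" "q \<in> poly_over F" "p \<noteq> 0" "q \<noteq> 0"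
  defines "u \<equiv> poly p t / poly q t" and "l \<equiv> lead_coeff p / lead_coeff q"
  shows "lim_infinity F t (\<delta> u / u) (\<delta> l / l + (of_nat (degree p) - of_nat (degree q)) * \<beta>)"
proof -
  have sup: "F \<subseteq> gen_field F {t}" "t \<in> gen_field F {t}" using gen_field_superset[of F "{t}"] by auto
  have ev: "poly r t \<in> gen_field F {t}" if "r \<in> poly_over F" for r
    using sup that by (intro poly_over_eval subfield_gen_field) (auto intro: poly_over_mono)
  have ne: "poly p t \<noteq> 0" "poly q t \<noteq> 0" using assms poly_nonzero by auto
  have 1: "\<delta> u / u = \<delta> (poly p t) / poly p t + (- 1) * (\<delta> (poly q t) / poly q t)"
    unfolding u_def using deriv_log_divide[OF subfield_gen_field d ev[OF assms(1)] ev[OF assms(2)] ne] by simp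
  have 2: "\<delta> l / l = \<delta> (lead_coeff p) / lead_coeff p - \<delta> (lead_coeff q) / lead_coeff q"
    unfolding l_def using assms by (intro deriv_log_divide[OF F deriv_base]) (auto simp: poly_over_coeff)
  have 3: "lim_infinity F t (\<delta> (poly p t) / poly p t + (- 1) * (\<delta> (poly q t) / poly q t))
     ((\<delta> (lead_coeff p) / lead_coeff p + of_nat (degree p) * \<beta>) + (- 1) * (\<delta> (lead_coeff q) / lead_coeff q + of_nat (degree q) * \<beta>))"
    (is "lim_infinity F t ?z ?r")
    using assms F by (intro lim_infinity_add lim_infinity_scale lim_infinity_log_deriv_poly) (auto intro: subfield_uminus subfield_one)
  have 4: "?r = \<delta> (lead_coeff p) / lead_coeff p - \<delta> (lead_coeff q) / lead_coeff q
      + (of_nat (degree p) - of_nat (degree q)) * \<beta>" by (simp add: algebra_simps)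
  show ?thesis unfolding 1 2 using 3 unfolding 4 .
qed

text \<open>Since \<delta> raises no degree, the quotient rule turns a proper fraction into a proper
  fraction.\<close>

lemma lim_infinity_deriv_proper:
  assumes "p \<in> poly_over F" "q \<in> poly_over F" "q \<noteq> 0" "p = 0 \<or> degree p < degree q"
  shows "lim_infinity F t (\<delta> (poly p t / poly q t)) 0"
proof (cases "p = 0")
  case True
  then show ?thesis using lim_infinity_const[OF subfield_zero[OF F]] deriv_zero[OF F deriv_base] by simp
next
  case False
  then have deg: "degree p < degree q" using assms by blast
  have sup: "F \<subseteq> gen_field F {t}" "t \<in> gen_field F {t}" using gen_field_superset[of F "{t}"] by auto
  have ev: "poly r t \<in> gen_field F {t}" if "r \<in> poly_over F" for r
    using sup that by (intro poly_over_eval subfield_gen_field) (auto intro: poly_over_mono)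
  define r where "r = poly_deriv \<delta> \<alpha> \<beta> p * q - p * poly_deriv \<delta> \<alpha> \<beta> q"
  have "degree (poly_deriv \<delta> \<alpha> \<beta> p * q) \<le> degree p + degree q" "degree (p * poly_deriv \<delta> \<alpha> \<beta> q) \<le> degree p + degree q"
    using degree_mult_le[of "poly_deriv \<delta> \<alpha> \<beta> p" q] degree_mult_le[of p "poly_deriv \<delta> \<alpha> \<beta> q"]
      degree_poly_deriv[of p] degree_poly_deriv[of q] by linarith+
  then have "degree r \<le> degree p + degree q" unfolding r_def by (rule degree_diff_le)
  then have "degree r < degree (q * q)" using deg assms by (simp add: degree_mult_eq)
  moreover have "\<delta> (poly p t / poly q t) = poly r t / poly (q * q) t"
    using deriv_divide[OF subfield_gen_field d ev[OF assms(1)] ev[OF assms(2)] poly_nonzero[OF assms(2,3)]] assms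
    by (simp add: r_def deriv_poly_deriv)
  moreover have "r \<in> poly_over F" "q * q \<in> poly_over F" "q * q \<noteq> 0"
    unfolding r_def using assms F by (auto intro!: poly_over_diff poly_over_mult poly_over_poly_deriv)
  ultimately show ?thesis unfolding lim_infinity_def
    by (intro exI[of _ r] exI[of _ "q * q"]) (auto simp: coeff_eq_0)
qed

end

end

text \<open>The coefficients of a closed logarithmic form over \<open>F(t)\<close> that does not involve \<open>t\<close> can be read
  off at \<open>t = \<infinity>\<close>. The derivation \<open>\<theta>\<close> is \<open>d/dt\<close> if \<open>t\<close> is a logarithm and \<open>t d/dt\<close> if \<open>t\<close> is an
  exponential.\<close>

lemma log_form_descends:
  fixes F :: "'a::field set" and t :: 'a and m :: nat
  assumes ch: "CHAR('a) = 0" and F: "subfield F" and t: "t \<notin> acl F"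
    and u: "\<And>k. k < m \<Longrightarrow> u k \<in> gen_field F {t} \<and> u k \<noteq> 0" and v: "v \<in> gen_field F {t}"
    and c: "\<And>k. k < m \<Longrightarrow> c k \<in> F"
    and par: "deriv_on (gen_field F {t}) \<theta>" "\<And>a. a \<in> F \<Longrightarrow> \<theta> a = 0" "(\<theta> t = 1 \<and> \<not> exponential) \<or> (\<theta> t = t \<and> exponential)"
    and par0: "(\<Sum>k<m. c k * (\<theta> (u k) / u k)) + \<theta> v = 0"
  shows "\<exists>l h. (\<forall>k<m. l k \<in> F \<and> l k \<noteq> 0) \<and> h \<in> F \<and>
    (\<forall>\<delta> \<alpha> \<beta>. deriv_on (gen_field F {t}) \<delta> \<longrightarrow> (\<forall>a\<in>F. \<delta> a \<in> F) \<longrightarrow> \<delta> t = \<alpha> + \<beta> * t \<longrightarrow> \<alpha> \<in> F \<longrightarrow> \<beta> \<in> F \<longrightarrow>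
       (\<beta> = 0 \<or> exponential) \<longrightarrow> (\<Sum>k<m. c k * (\<delta> (u k) / u k)) + \<delta> v \<in> F \<longrightarrow>
       (\<Sum>k<m. c k * (\<delta> (u k) / u k)) + \<delta> v = (\<Sum>k<m. c k * (\<delta> (l k) / l k)) + \<delta> h)"
proof -
  let ?G = "gen_field F {t}"
  have sup: "F \<subseteq> ?G" "t \<in> ?G" using gen_field_superset[of F "{t}"] by auto
  have ev: "poly r t \<in> ?G" if "r \<in> poly_over F" for r
    using sup that by (intro poly_over_eval subfield_gen_field) (auto intro: poly_over_mono)
  have "\<forall>k\<in>{..<m}. \<exists>p q. p \<in> poly_over F \<and> q \<in> poly_over F \<and> p \<noteq> 0 \<and> q \<noteq> 0 \<and> u k = poly p t / poly q t"
  proof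
    fix k assume "k \<in> {..<m}"
    then have "u k \<in> ?G" "u k \<noteq> 0" using u by auto
    then obtain p q where "p \<in> poly_over F" "q \<in> poly_over F" "poly q t \<noteq> 0" "u k = poly p t / poly q t"
      unfolding gen_field_fractions[OF F] by blast
    then show "\<exists>p q. p \<in> poly_over F \<and> q \<in> poly_over F \<and> p \<noteq> 0 \<and> q \<noteq> 0 \<and> u k = poly p t / poly q t"
      using \<open>u k \<noteq> 0\<close> by (intro exI[of _ p] exI[of _ q]) auto
  qed
  then obtain p q where pq: "\<And>k. k < m \<Longrightarrow> p k \<in> poly_over F" "\<And>k. k < m \<Longrightarrow> q k \<in> poly_over F"
    "\<And>k. k < m \<Longrightarrow> p k \<noteq> 0" "\<And>k. k < m \<Longrightarrow> q k \<noteq> 0" "\<And>k. k < m \<Longrightarrow> u k = poly (p k) t / poly (q k) t"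
    by (metis lessThan_iff)
  define l where "l k = lead_coeff (p k) / lead_coeff (q k)" for k
  define e where "e k = (of_nat (degree (p k)) - of_nat (degree (q k)) :: 'a)" for k
  have lF: "l k \<in> F \<and> l k \<noteq> 0" if "k < m" for k
    using pq[OF that] F unfolding l_def by (auto intro!: subfield_divide poly_over_coeff)
  obtain r s where rs: "r \<in> poly_over F" "s \<in> poly_over F" "poly s t \<noteq> 0" "v = poly r t / poly s t"
    using v unfolding gen_field_fractions[OF F] by blast
  have s0: "s \<noteq> 0" using rs(3) by auto
  \<comment> \<open>Splits \<open>v\<close> into a polynomial part \<open>g\<close>, the only
    possible source of a pole at infinity, and a proper fraction, whose derivatives have value 0
    there.\<close>
  obtain g w where gw: "g \<in> poly_over F" "w \<in> poly_over F" "r = s * g + w" "w = 0 \<or> degree w < degree s"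
    using poly_over_division[OF F rs(2) s0 rs(1)] by blast
  have veq: "v = poly g t + poly w t / poly s t" unfolding rs(4) gw(3) using rs(3) by (simp add: field_simps)
  define K where "K \<delta> \<beta> = (\<Sum>k<m. c k * (\<delta> (l k) / l k + e k * \<beta>))" for \<delta> \<beta>
  have lim: "lim_infinity F t ((\<Sum>k<m. c k * (\<delta> (u k) / u k)) + \<delta> (poly w t / poly s t)) (K \<delta> \<beta>)"
    and dv: "\<delta> v = \<delta> (poly g t) + \<delta> (poly w t / poly s t)"
    if d: "deriv_on ?G \<delta>" "\<And>a. a \<in> F \<Longrightarrow> \<delta> a \<in> F" "\<delta> t = \<alpha> + \<beta> * t" "\<alpha> \<in> F" "\<beta> \<in> F" for \<delta> \<alpha> \<beta>
  proof -
    have "lim_infinity F t (c k * (\<delta> (u k) / u k)) (c k * (\<delta> (l k) / l k + e k * \<beta>))" if k: "k < m" for k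
      unfolding pq(5)[OF k] l_def e_def
      by (intro lim_infinity_scale[OF F t c[OF k]] lim_infinity_log_deriv_fraction[OF F t d] pq k)
    then have "lim_infinity F t ((\<Sum>k<m. c k * (\<delta> (u k) / u k)) + \<delta> (poly w t / poly s t)) (K \<delta> \<beta> + 0)"
      unfolding K_def using lim_infinity_deriv_proper[OF F t d gw(2) rs(2) s0 gw(4)]
      by (intro lim_infinity_add[OF F t] lim_infinity_sum[OF F t]) auto
    then show "lim_infinity F t ((\<Sum>k<m. c k * (\<delta> (u k) / u k)) + \<delta> (poly w t / poly s t)) (K \<delta> \<beta>)" by simp
    show "\<delta> v = \<delta> (poly g t) + \<delta> (poly w t / poly s t)" unfolding veq
      using ev gw rs by (intro deriv_add[OF subfield_gen_field d(1)] subfield_divide subfield_gen_field) auto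
  qed
  define \<beta>0 :: 'a where "\<beta>0 = (if exponential then 1 else 0)"
  define \<alpha>0 :: 'a where "\<alpha>0 = (if exponential then 0 else 1)"
  have pt: "\<theta> t = \<alpha>0 + \<beta>0 * t" "\<alpha>0 \<in> F" "\<beta>0 \<in> F" using par(3) F by (auto simp: \<alpha>0_def \<beta>0_def subfield_intros)
  have pF: "\<And>a. a \<in> F \<Longrightarrow> \<theta> a \<in> F" using par(2) subfield_zero[OF F] by simp
  note pd = par(1) pF pt
  have K0: "K \<theta> \<beta>0 = (\<Sum>k<m. c k * e k) * \<beta>0" unfolding K_def sum_distrib_right
    using par(2) lF by (intro sum.cong refl) auto
  define H where "H = poly_deriv \<theta> \<alpha>0 \<beta>0 g"
  have HF: "H \<in> poly_over F" unfolding H_def by (rule poly_over_poly_deriv[OF F t pd gw(1)])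
  have Hp: "\<theta> (poly g t) = poly H t" unfolding H_def by (rule deriv_poly_deriv[OF F t pd gw(1)])
  \<comment> \<open>By \<open>par0\<close> the polynomial \<open>H\<close> is minus an element with
    a finite value at infinity, hence it is constant.\<close>
  have "poly H t = (- 1) * ((\<Sum>k<m. c k * (\<theta> (u k) / u k)) + \<theta> (poly w t / poly s t))"
    using par0 dv[OF pd] Hp by (simp add: algebra_simps eq_neg_iff_add_eq_0)
  then have "lim_infinity F t (poly H t) ((- 1) * K \<theta> \<beta>0)"
    using lim_infinity_scale[OF F t subfield_uminus[OF F subfield_one[OF F]] lim[OF pd]] by (simp only:)
  then have H: "H = [:- K \<theta> \<beta>0:]" using lim_infinity_poly[OF F t HF] by simp
  have H': "H = pderiv g * [:\<alpha>0, \<beta>0:]" unfolding H_def poly_deriv_def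
    using poly_map_poly_zero[of \<theta> g] par(2) poly_over_coeff[OF gw(1)] subfield_zero[OF F] by simp
  \<comment> \<open>For an exponential, \<open>H\<close> is \<open>t\<close> times the derivative of
    \<open>g\<close> and has no constant term; for a logarithm, \<open>\<beta>0 = 0\<close> removes
    the degree contributions. Either way \<open>H = 0\<close>, so \<open>g\<close> is
    constant.\<close>
  have K00: "K \<theta> \<beta>0 = 0"
  proof (cases exponential)
    case True
    then have "coeff H 0 = 0" unfolding H' \<alpha>0_def by (simp add: coeff_mult)
    then show ?thesis using H by simp
  next
    case False
    then show ?thesis unfolding K0 by (simp add: \<beta>0_def)
  qed
  then have "pderiv g * [:\<alpha>0, \<beta>0:] = 0" using H H' by simp
  moreover have "[:\<alpha>0, \<beta>0:] \<noteq> 0" unfolding \<alpha>0_def \<beta>0_def by simp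
  ultimately have pg: "pderiv g = 0" by (metis mult_eq_0_iff)
  have "degree g = 0"
  proof (rule ccontr)
    assume "degree g \<noteq> 0"
    then obtain j where j: "degree g = Suc j" by (cases "degree g") auto
    have "coeff (pderiv g) j = of_nat (Suc j) * lead_coeff g" using j by (simp add: coeff_pderiv)
    moreover have "of_nat (Suc j) \<noteq> (0::'a)" using ch unfolding CHAR_eq0_iff by blast
    ultimately have "lead_coeff g = 0" using pg by simp
    then show False using j by (metis degree_0 leading_coeff_0_iff nat.distinct(1))
  qed
  then obtain h where h: "g = [:h:]" by (metis degree_0_id)
  have hF: "h \<in> F" using gw(1) h by (simp add: poly_over_pCons_iff[OF F])
  have fin: "A = (\<Sum>k<m. c k * (\<delta> (l k) / l k)) + \<delta> h"
    if d: "deriv_on ?G \<delta>" "\<And>a. a \<in> F \<Longrightarrow> \<delta> a \<in> F" "\<delta> t = \<alpha> + \<beta> * t" "\<alpha> \<in> F" "\<beta> \<in> F"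
      and b: "\<beta> = 0 \<or> exponential" and A: "A \<in> F" "A = (\<Sum>k<m. c k * (\<delta> (u k) / u k)) + \<delta> v" for \<delta> \<alpha> \<beta> A
  proof -
    have "lim_infinity F t A A" using lim_infinity_const[OF F t A(1)] .
    moreover have "lim_infinity F t A (K \<delta> \<beta> + \<delta> h)"
    proof -
      have "A = (\<Sum>k<m. c k * (\<delta> (u k) / u k)) + \<delta> (poly w t / poly s t) + \<delta> h"
        using A(2) dv[OF d] h by simp
      then show ?thesis using lim_infinity_add[OF F t lim[OF d] lim_infinity_const[OF F t d(2)[OF hF]]] by simp
    qed
    ultimately have "A = K \<delta> \<beta> + \<delta> h" using lim_infinity_unique[OF F t] by blast
    \<comment> \<open>The weighted degrees sum to 0 for an exponential, and
      \<open>\<beta> = 0\<close> for a logarithm; so the degrees drop out for every admissible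
      \<delta>, not only for \<theta>.\<close>
    moreover have "(\<Sum>k<m. c k * e k) * \<beta>0 = 0" using K00 K0 by simp
    then have "(\<Sum>k<m. c k * e k) * \<beta> = 0" using b by (auto simp: \<beta>0_def)
    then have "K \<delta> \<beta> = (\<Sum>k<m. c k * (\<delta> (l k) / l k))"
      unfolding K_def by (simp add: distrib_left sum.distrib sum_distrib_right mult.assoc)
    ultimately show ?thesis by simp
  qed
  show ?thesis
  proof (intro exI[of _ l] exI[of _ h] conjI allI impI)
    fix \<delta> \<alpha> \<beta>
    assume "deriv_on ?G \<delta>" "\<forall>a\<in>F. \<delta> a \<in> F" "\<delta> t = \<alpha> + \<beta> * t" "\<alpha> \<in> F" "\<beta> \<in> F" "\<beta> = 0 \<or> exponential"
      "(\<Sum>k<m. c k * (\<delta> (u k) / u k)) + \<delta> v \<in> F"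
    then show "(\<Sum>k<m. c k * (\<delta> (u k) / u k)) + \<delta> v = (\<Sum>k<m. c k * (\<delta> (l k) / l k)) + \<delta> h"
      by (intro fin[of \<delta> \<alpha> \<beta>]) auto
  qed (use lF hF in auto)
qed

section \<open>Constants of the rational function field\<close>

lemma field_hom_uminus: assumes "field_hom \<iota>" shows "\<iota> (- a) = - \<iota> a"
proof -
  have "\<iota> (a + - a) = \<iota> a + \<iota> (- a)" "\<iota> 0 = 0" using assms unfolding field_hom_def by blast+
  then show ?thesis by (simp add: eq_neg_iff_add_eq_0 add.commute)
qed

lemma field_hom_inverse: assumes "field_hom \<iota>" shows "\<iota> (inverse a) = inverse (\<iota> a)"
proof (cases "a = 0")
  case False
  have "\<iota> (a * inverse a) = \<iota> a * \<iota> (inverse a)" "\<iota> 1 = 1" using assms unfolding field_hom_def by blast+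
  then have "\<iota> a * \<iota> (inverse a) = 1" using False by simp
  then show ?thesis by (metis inverse_unique)
qed (use assms in \<open>simp add: field_hom_def\<close>)

lemma field_hom_eq_0: assumes "field_hom \<iota>" shows "\<iota> a = 0 \<longleftrightarrow> a = 0"
proof
  assume "\<iota> a = 0"
  show "a = 0"
  proof (rule ccontr)
    assume "a \<noteq> 0"
    then have "\<iota> (a * inverse a) = 1" using assms by (simp add: field_hom_def)
    moreover have "\<iota> (a * inverse a) = \<iota> a * \<iota> (inverse a)" using assms unfolding field_hom_def by blast
    ultimately show False using \<open>\<iota> a = 0\<close> by simp
  qed
qed (use assms in \<open>simp add: field_hom_def\<close>)

lemma field_hom_of_nat: assumes "field_hom \<iota>" shows "\<iota> (of_nat k) = of_nat k"
  using assms by (induction k) (auto simp: field_hom_def)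

lemma field_hom_CHAR: fixes \<iota> :: "complex \<Rightarrow> 'a::field" assumes "field_hom \<iota>" shows "CHAR('a) = 0"
proof -
  have "of_nat k \<noteq> (0::'a)" if "k > 0" for k
    using field_hom_of_nat[OF assms, of k] field_hom_eq_0[OF assms, of "of_nat k"] that by simp
  then show ?thesis unfolding CHAR_eq0_iff by blast
qed

text \<open>Elements expressible as polynomials of total degree at most \<open>d\<close>. The bound
  belongs to the element, not to a chosen expression, so no normal form for polynomials
  enters.\<close>

inductive mpoly_deg :: "(complex \<Rightarrow> 'a::field) \<Rightarrow> (nat \<Rightarrow> 'a) \<Rightarrow> nat \<Rightarrow> nat \<Rightarrow> 'a \<Rightarrow> bool"
  for \<iota> x n where
  const: "mpoly_deg \<iota> x n d (\<iota> a)"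
| var: "mpoly_deg \<iota> x n d y \<Longrightarrow> i < n \<Longrightarrow> mpoly_deg \<iota> x n (Suc d) (x i * y)"
| add: "mpoly_deg \<iota> x n d y \<Longrightarrow> mpoly_deg \<iota> x n d z \<Longrightarrow> mpoly_deg \<iota> x n d (y + z)"

context
  fixes n :: nat and D :: "nat \<Rightarrow> 'a::field \<Rightarrow> 'a" and \<iota> :: "complex \<Rightarrow> 'a" and x :: "nat \<Rightarrow> 'a"
  assumes hom: "field_hom \<iota>"
    and D: "\<And>i. i < n \<Longrightarrow> deriv_on UNIV (D i)"
    and Di: "\<And>i c. i < n \<Longrightarrow> D i (\<iota> c) = 0"
    and Dx: "\<And>i j. i < n \<Longrightarrow> j < n \<Longrightarrow> D i (x j) = (if i = j then 1 else 0)"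
begin

abbreviation "mp \<equiv> mpoly_deg \<iota> x n"

lemma D_add: "i < n \<Longrightarrow> D i (a + b) = D i a + D i b"
  and D_mult: "i < n \<Longrightarrow> D i (a * b) = a * D i b + D i a * b"
  using D by (auto simp: deriv_on_def)

lemma hom_add: "\<iota> (a + b) = \<iota> a + \<iota> b" and hom_mult: "\<iota> (a * b) = \<iota> a * \<iota> b"
  and hom_0: "\<iota> 0 = 0" and hom_1: "\<iota> 1 = 1"
  using hom by (auto simp: field_hom_def)

lemma mpoly_deg_mono: "mp d y \<Longrightarrow> d \<le> e \<Longrightarrow> mp e y"
proof (induction arbitrary: e rule: mpoly_deg.induct)
  case (var d y i)
  then obtain e' where "e = Suc e'" "d \<le> e'" by (cases e) auto
  then show ?case using var by (auto intro: mpoly_deg.var)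
qed (auto intro: mpoly_deg.intros)

lemma mpoly_deg_scale: "mp d y \<Longrightarrow> mp d (\<iota> a * y)"
proof (induction rule: mpoly_deg.induct)
  case (const d b)
  then show ?case using mpoly_deg.const[of \<iota> x n d "a * b"] by (simp add: hom_mult)
next
  case (var d y i)
  then show ?case using mpoly_deg.var[of \<iota> x n d "\<iota> a * y" i] by (simp add: mult_ac)
qed (auto intro: mpoly_deg.intros simp: distrib_left)

lemma mpoly_deg_mult: "mp d y \<Longrightarrow> mp e z \<Longrightarrow> mp (d + e) (y * z)"
proof (induction rule: mpoly_deg.induct)
  case (const d a)
  then show ?case using mpoly_deg_mono[OF mpoly_deg_scale] by simp
next
  case (var d y i)
  then show ?case using mpoly_deg.var[of \<iota> x n "d + e" "y * z" i] by (simp add: mult_ac)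
qed (auto intro: mpoly_deg.intros simp: distrib_right)

lemma mpoly_deg_0: "mp 0 y \<Longrightarrow> y \<in> range \<iota>"
proof (induction "0::nat" y rule: mpoly_deg.induct)
  case (add y z)
  then obtain a b where "y = \<iota> a" "z = \<iota> b" by blast
  then have "y + z = \<iota> (a + b)" by (simp add: hom_add)
  then show ?case by blast
qed auto

text \<open>Truncation of \<open>d - 1\<close> at \<open>d = 0\<close> is harmless: there
  \<open>y\<close> is a complex constant and its derivative is 0.\<close>

lemma mpoly_deg_deriv: "mp d y \<Longrightarrow> i < n \<Longrightarrow> mp (d - 1) (D i y)"
proof (induction rule: mpoly_deg.induct)
  case (const d a)
  then show ?case using Di mpoly_deg.const[of \<iota> x n "d - 1" 0] by (simp add: hom_0)
next
  case (var d y j)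
  have 1: "mp d (D i (x j) * y)"
    using mpoly_deg_scale[OF var.hyps(1), of 1] mpoly_deg_scale[OF var.hyps(1), of 0] Dx var by (auto simp: hom_0 hom_1)
  have 2: "mp d (x j * D i y)"
  proof (cases d)
    case 0
    then have "D i y = 0" using mpoly_deg_0 var Di by auto
    then show ?thesis using mpoly_deg.const[of \<iota> x n d 0] by (simp add: hom_0)
  next
    case (Suc e)
    then show ?thesis using var mpoly_deg.var[of \<iota> x n e "D i y" j] by simp
  qed
  show ?case using mpoly_deg.add[OF 2 1] D_mult var by simp
qed (auto intro: mpoly_deg.intros simp: D_add)

text \<open>The Euler operator \<open>y \<mapsto> \<Sum>i<n. x i * D i y\<close> multiplies homogeneous polynomials of degree \<open>k\<close>
  by \<open>k\<close>, so subtracting \<open>d + 1\<close> times the identity kills the top-degree part.\<close>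

lemma mpoly_deg_Euler:
  "mp e y \<Longrightarrow> e = Suc d \<Longrightarrow> mp d ((\<Sum>i<n. x i * D i y) - of_nat (Suc d) * y)"
proof (induction arbitrary: d rule: mpoly_deg.induct)
  case (const e a)
  have "(\<Sum>i<n. x i * D i (\<iota> a)) - of_nat (Suc d) * \<iota> a = \<iota> (- of_nat (Suc d) * a)"
    using Di unfolding hom_mult field_hom_uminus[OF hom] field_hom_of_nat[OF hom] by (simp del: of_nat_Suc)
  then show ?case using mpoly_deg.const by metis
next
  case (var e y j)
  then have e: "e = d" by simp
  have "(\<Sum>i<n. x i * D i (x j * y)) = (\<Sum>i<n. x j * (x i * D i y) + (if i = j then x i * y else 0))"
    using var Dx D_mult by (intro sum.cong refl) (auto simp: algebra_simps)
  also have "\<dots> = x j * (\<Sum>i<n. x i * D i y) + x j * y"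
    using var by (simp add: sum.distrib sum_distrib_left)
  finally have eq: "(\<Sum>i<n. x i * D i (x j * y)) - of_nat (Suc d) * (x j * y) = x j * ((\<Sum>i<n. x i * D i y) - of_nat d * y)"
    by (simp add: algebra_simps)
  show ?case
  proof (cases d)
    case 0
    then have "\<And>i. i < n \<Longrightarrow> D i y = 0" using mpoly_deg_0 var e Di by auto
    then show ?thesis unfolding eq using 0 mpoly_deg.const[of \<iota> x n d 0] by (simp add: hom_0)
  next
    case (Suc d')
    then show ?thesis unfolding eq using var e by (auto intro!: mpoly_deg.var)
  qed
next
  case (add e y z)
  have "(\<Sum>i<n. x i * D i (y + z)) - of_nat (Suc d) * (y + z) =
    ((\<Sum>i<n. x i * D i y) - of_nat (Suc d) * y) + ((\<Sum>i<n. x i * D i z) - of_nat (Suc d) * z)"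
    by (simp add: D_add algebra_simps sum.distrib)
  then show ?case using add by (auto intro: mpoly_deg.add)
qed

text \<open>If all derivatives vanish, the Euler combination is \<open>- of_nat (Suc d) * y\<close>
  and has smaller degree; division by the nonzero integer lowers the degree bound of
  \<open>y\<close> itself, down to 0.\<close>

lemma mpoly_deg_constant:
  assumes "mp d y" "\<And>i. i < n \<Longrightarrow> D i y = 0"
  shows "y \<in> range \<iota>"
  using assms(1)
proof (induction d)
  case 0
  then show ?case by (rule mpoly_deg_0)
next
  case (Suc d)
  have "mp d (- (of_nat (Suc d) * y))" using mpoly_deg_Euler[OF Suc.prems refl] assms(2) by simp
  from mpoly_deg_scale[OF this, of "- inverse (of_nat (Suc d))"]
  have "mp d (inverse (of_nat (Suc d)) * (of_nat (Suc d) * y))"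
    by (simp only: field_hom_uminus[OF hom] field_hom_inverse[OF hom] field_hom_of_nat[OF hom] mult_minus_left mult_minus_right minus_minus)
  moreover have "of_nat (Suc d) \<noteq> (0::'a)" using field_hom_CHAR[OF hom] unfolding CHAR_eq0_iff by blast
  ultimately have "mp d y" by (simp add: mult.assoc[symmetric] del: of_nat_Suc)
  then show ?case by (rule Suc.IH)
qed

lemma gen_field_mpoly_fractions:
  assumes "y \<in> gen_field (range \<iota>) (x ` {..<n})"
  shows "\<exists>p q d e. mp d p \<and> mp e q \<and> q \<noteq> 0 \<and> y = p / q"
proof -
  define R where "R = {y. \<exists>p q d e. mp d p \<and> mp e q \<and> q \<noteq> 0 \<and> y = p / q}"
  have in': "p / q \<in> R" if "mp d p" "mp e q" "q \<noteq> 0" for p q d e unfolding R_def using that by blast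
  have one: "mp 0 1" and zero: "mp 0 0" using mpoly_deg.const[of \<iota> x n 0 1] mpoly_deg.const[of \<iota> x n 0 0] by (simp_all add: hom_1 hom_0)
  have RR: "a + b \<in> R" "a - b \<in> R" "a * b \<in> R" if ab: "a \<in> R" "b \<in> R" for a b
  proof -
    obtain p q d e p' q' d' e' where h: "mp d p" "mp e q" "q \<noteq> 0" "a = p / q"
      "mp d' p'" "mp e' q'" "q' \<noteq> 0" "b = p' / q'" using ab unfolding R_def by blast
    have q: "mp (e + e') (q * q')" "q * q' \<noteq> 0" using h mpoly_deg_mult by auto
    have 1: "mp (d + e' + (d' + e)) (p * q')" "mp (d + e' + (d' + e)) (p' * q)"
      using mpoly_deg_mono[OF mpoly_deg_mult[OF h(1,6)], of "d + e' + (d' + e)"]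
        mpoly_deg_mono[OF mpoly_deg_mult[OF h(5,2)], of "d + e' + (d' + e)"] by auto
    have 2: "mp (d + e' + (d' + e)) (- (p' * q))"
      using mpoly_deg_scale[OF 1(2), of "-1"] by (simp add: field_hom_uminus[OF hom] hom_1)
    have eqs: "a + b = (p * q' + p' * q) / (q * q')" "a - b = (p * q' + - (p' * q)) / (q * q')"
      "a * b = (p * p') / (q * q')" unfolding h(4,8) using h(3,7) by (simp_all add: field_simps)
    show "a + b \<in> R" unfolding eqs by (rule in'[OF mpoly_deg.add[OF 1] q])
    show "a - b \<in> R" unfolding eqs by (rule in'[OF mpoly_deg.add[OF 1(1) 2] q])
    show "a * b \<in> R" unfolding eqs by (rule in'[OF mpoly_deg_mult[OF h(1,5)] q])
  qed
  have Rinv: "inverse a \<in> R" if a: "a \<in> R" for a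
  proof (cases "a = 0")
    case True
    then show ?thesis using in'[OF zero one] by simp
  next
    case False
    obtain p q d e where h: "mp d p" "mp e q" "q \<noteq> 0" "a = p / q" using a unfolding R_def by blast
    then have "p \<noteq> 0" using False by auto
    then show ?thesis using in'[OF h(2,1)] h by simp
  qed
  have "subfield R" unfolding subfield_def using in'[OF zero one] in'[OF one one] RR Rinv by simp
  moreover have "range \<iota> \<subseteq> R" using in'[OF mpoly_deg.const one] by auto
  moreover have "x i \<in> R" if "i < n" for i using in'[OF mpoly_deg.var[OF one that] one] by simp
  ultimately have "gen_field (range \<iota>) (x ` {..<n}) \<subseteq> R" by (intro gen_field_least) auto
  then show ?thesis using assms unfolding R_def by blast
qed

text \<open>A fraction of minimal denominator degree: if all derivatives of \<open>p / q\<close> vanish, then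
  \<open>p / q = D i p / D i q\<close> whenever \<open>D i q \<noteq> 0\<close>.\<close>

lemma rational_function_constant:
  assumes y: "y \<in> gen_field (range \<iota>) (x ` {..<n})" and Dy: "\<And>i. i < n \<Longrightarrow> D i y = 0"
  shows "y \<in> range \<iota>"
proof -
  define Q where "Q e \<longleftrightarrow> (\<exists>p q d. mp d p \<and> mp e q \<and> q \<noteq> 0 \<and> y = p / q)" for e
  have "\<exists>e. Q e" using gen_field_mpoly_fractions[OF y] unfolding Q_def by blast
  then have "Q (LEAST e. Q e)" by (rule LeastI_ex)
  then obtain p q d e where h: "mp d p" "mp e q" "q \<noteq> 0" "y = p / q" and e: "e = (LEAST e. Q e)"
    unfolding Q_def by blast
  have eq: "D i p = y * D i q" if "i < n" for i
  proof -
    have "p = y * q" using h by simp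
    then have "D i p = y * D i q + D i y * q" using D_mult[OF that] by simp
    then show ?thesis using Dy that by simp
  qed
  have Dq: "D i q = 0" if i: "i < n" for i
  proof (rule ccontr)
    assume ne: "D i q \<noteq> 0"
    \<comment> \<open>With truncated subtraction, \<open>e \<le> e - 1\<close> is a contradiction
      only for positive \<open>e\<close>.\<close>
    have "e \<noteq> 0"
    proof
      assume "e = 0"
      then have "D i q = 0" using h(2) mpoly_deg_0 Di i by auto
      then show False using ne by simp
    qed
    moreover have "Q (e - 1)" unfolding Q_def using mpoly_deg_deriv[OF h(1) i] mpoly_deg_deriv[OF h(2) i] ne eq[OF i]
      by (intro exI[of _ "D i p"] exI[of _ "D i q"] exI[of _ "d - 1"]) simp
    then have "e \<le> e - 1" unfolding e by (rule Least_le)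
    ultimately show False by simp
  qed
  obtain b where b: "q = \<iota> b" using mpoly_deg_constant[OF h(2) Dq] by blast
  have "D i p = 0" if "i < n" for i using eq[OF that] Dq[OF that] by simp
  then obtain a where a: "p = \<iota> a" using mpoly_deg_constant[OF h(1)] by blast
  have "y = \<iota> (a * inverse b)" unfolding h(4) a b by (simp add: hom_mult field_hom_inverse[OF hom] divide_inverse)
  then show ?thesis by blast
qed

end

section \<open>Descent along first integrals\<close>

text \<open>Together with \<open>gen_field_least\<close>, this reduces the vanishing of a derivation
  on a generated field to its generators.\<close>

lemma deriv_kernel_subfield:
  assumes E: "subfield E" and d: "deriv_on E d"
  shows "subfield {a \<in> E. d a = 0}"
proof -
  have "d (inverse a) = 0" if "a \<in> E" "d a = 0" for a
  proof (cases "a = 0")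
    case False
    then show ?thesis using deriv_divide[OF E d subfield_one[OF E] that(1) False] that deriv_one[OF E d]
      by (simp add: divide_inverse)
  qed (use deriv_zero[OF E d] in simp)
  then show ?thesis unfolding subfield_def using E
    by (auto simp: subfield_intros deriv_zero[OF E d] deriv_one[OF E d] deriv_add[OF E d] deriv_diff[OF E d] deriv_mult[OF E d])
qed

lemma deriv_preimage_subfield:
  assumes E: "subfield E" and d: "deriv_on E d"
  shows "subfield {a \<in> E. d a \<in> E}"
proof -
  have "d (inverse a) \<in> E" if "a \<in> E" "d a \<in> E" for a
  proof (cases "a = 0")
    case False
    then show ?thesis using deriv_divide[OF E d subfield_one[OF E] that(1) False] that deriv_one[OF E d] E
      by (simp add: divide_inverse subfield_intros)
  qed (use deriv_zero[OF E d] E in \<open>simp add: subfield_zero\<close>)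
  then show ?thesis unfolding subfield_def using E
    by (auto simp: subfield_intros deriv_zero[OF E d] deriv_one[OF E d] deriv_add[OF E d] deriv_diff[OF E d] deriv_mult[OF E d])
qed

lemma deriv_on_commutator:
  assumes E: "subfield E" and d: "deriv_on E d" "deriv_on E e"
    and cl: "\<And>a. a \<in> E \<Longrightarrow> d a \<in> E" "\<And>a. a \<in> E \<Longrightarrow> e a \<in> E"
  shows "deriv_on E (\<lambda>a. d (e a) - e (d a))"
  unfolding deriv_on_def
  by (simp add: deriv_add[OF E d(1)] deriv_add[OF E d(2)] deriv_mult[OF E d(1)] deriv_mult[OF E d(2)] cl
      subfield_mult[OF E] algebra_simps)

text \<open>The quotient rule makes both sides symmetric in \<open>d\<close> and \<open>e\<close>,
  given that \<open>d\<close> and \<open>e\<close> commute. This expresses closedness of logarithmic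
  differentials.\<close>

lemma deriv_log_commute:
  assumes E: "subfield E" and d: "deriv_on E d" "deriv_on E e"
    and cl: "\<And>a. a \<in> E \<Longrightarrow> d a \<in> E" "\<And>a. a \<in> E \<Longrightarrow> e a \<in> E"
    and comm: "\<And>a. a \<in> E \<Longrightarrow> d (e a) = e (d a)" and u: "u \<in> E" "u \<noteq> 0"
  shows "d (e u / u) = e (d u / u)"
  using deriv_divide[OF E d(1) cl(2)[OF u(1)] u] deriv_divide[OF E d(2) cl(1)[OF u(1)] u] comm[OF u(1)]
  by (simp add: mult.commute)

text \<open>Substituting a constant for the transcendental first integral \<open>f\<close>.\<close>

lemma specialize_first_integral:
  fixes F :: "'a::field set"
  assumes ch: "CHAR('a) = 0" and F: "subfield F" and X: "deriv_on UNIV X" "\<And>a. a \<in> F \<Longrightarrow> X a \<in> F"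
    and f: "f \<notin> acl F" "X f = 0" and b: "b \<in> gen_field F {f}" "X b = e * b + s" and es: "e \<in> F" "s \<in> F"
  shows "\<exists>w\<in>F. X w = e * w + s \<and> (b \<noteq> 0 \<longrightarrow> w \<noteq> 0)"
proof -
  obtain p q where pq: "p \<in> poly_over F" "q \<in> poly_over F" "poly q f \<noteq> 0" "b = poly p f / poly q f"
    using b(1) unfolding gen_field_fractions[OF F] by blast
  have X0: "X 0 = 0" by (rule deriv_zero[OF subfield_UNIV X(1)])
  have ev: "X (poly r y) = poly (map_poly X r) y" if "X y = 0" for r y
    using deriv_poly[OF subfield_UNIV X(1), of r y] that by (simp add: poly_over_def)
  define P Q where "P = map_poly X p" and "Q = map_poly X q"
  have PQ: "P \<in> poly_over F" "Q \<in> poly_over F" unfolding P_def Q_def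
    using pq X(2) X0 by (auto intro!: poly_over_map_poly F)
  \<comment> \<open>The numerator of \<open>X b - (e * b + s)\<close> over the denominator
    \<open>q * q\<close>. It vanishes at the transcendental \<open>f\<close>, so it is the zero
    polynomial, and the equation survives replacing \<open>f\<close> by any other element killed by
    \<open>X\<close>.\<close>
  define W where "W = P * q - p * Q - (smult e (p * q) + smult s (q * q))"
  have "W \<in> poly_over F" unfolding W_def using pq PQ es F
    by (intro poly_over_diff poly_over_add poly_over_mult poly_over_smult)
  moreover have "poly W f = 0"
  proof -
    have "X b = (poly P f * poly q f - poly p f * poly Q f) / (poly q f * poly q f)"
      unfolding pq(4) P_def Q_def using deriv_divide[OF subfield_UNIV X(1), of "poly p f" "poly q f"] pq(3) ev[OF f(2)] by simp
    then have "poly P f * poly q f - poly p f * poly Q f = X b * (poly q f * poly q f)" using pq(3) by simp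
    also have "\<dots> = e * (poly p f * poly q f) + s * (poly q f * poly q f)"
      unfolding b(2) using pq(3) by (simp add: pq(4) field_simps)
    finally show ?thesis unfolding W_def by simp
  qed
  ultimately have W: "W = 0" using transcendental_nonzero[OF f(1)] by blast
  have q0: "q \<noteq> 0" using pq(3) by auto
  \<comment> \<open>The integer must avoid the zeros of \<open>q\<close>, to keep the fraction
    defined, and those of a nonzero \<open>p\<close>, to keep \<open>w\<close> nonzero.\<close>
  have "finite {y. poly (q * (if p = 0 then 1 else p)) y = 0}" using q0 by (intro poly_roots_finite) auto
  moreover have "infinite (range (of_nat :: nat \<Rightarrow> 'a))"
  proof -
    have "inj (of_nat :: nat \<Rightarrow> 'a)"
    proof (rule injI)
      fix a b :: nat assume ab: "of_nat a = (of_nat b :: 'a)"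
      have nz: "of_nat k \<noteq> (0::'a)" if "k > 0" for k using ch that unfolding CHAR_eq0_iff by blast
      show "a = b"
      proof (rule ccontr)
        assume "a \<noteq> b"
        then consider "a < b" | "b < a" by linarith
        then show False
        proof cases
          case 1
          then have "of_nat (b - a) = (0::'a)" using ab by (simp add: of_nat_diff)
          then show False using nz[of "b - a"] 1 by simp
        next
          case 2
          then have "of_nat (a - b) = (0::'a)" using ab by (simp add: of_nat_diff)
          then show False using nz[of "a - b"] 2 by simp
        qed
      qed
    qed
    then show ?thesis using finite_imageD infinite_UNIV_nat by blast
  qed
  ultimately have "\<not> range (of_nat :: nat \<Rightarrow> 'a) \<subseteq> {y. poly (q * (if p = 0 then 1 else p)) y = 0}"
    using finite_subset by blast
  then obtain k :: nat where "poly (q * (if p = 0 then 1 else p)) (of_nat k) \<noteq> 0" by blast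
  then have k: "poly q (of_nat k) \<noteq> 0" "p \<noteq> 0 \<Longrightarrow> poly p (of_nat k) \<noteq> 0" by (auto split: if_splits)
  have Xk: "X (of_nat k) = 0" by (rule deriv_of_nat[OF subfield_UNIV X(1)])
  define w where "w = poly p (of_nat k) / poly q (of_nat k)"
  have "X w = (poly P (of_nat k) * poly q (of_nat k) - poly p (of_nat k) * poly Q (of_nat k)) / (poly q (of_nat k) * poly q (of_nat k))"
    unfolding w_def P_def Q_def using deriv_divide[OF subfield_UNIV X(1), of "poly p (of_nat k)" "poly q (of_nat k)"] k(1) ev[OF Xk] by simp
  moreover have "poly W (of_nat k) = 0" using W by simp
  then have "poly P (of_nat k) * poly q (of_nat k) - poly p (of_nat k) * poly Q (of_nat k) =
     e * (poly p (of_nat k) * poly q (of_nat k)) + s * (poly q (of_nat k) * poly q (of_nat k))"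
    unfolding W_def by (simp add: algebra_simps)
  moreover have "(e * (poly p (of_nat k) * poly q (of_nat k)) + s * (poly q (of_nat k) * poly q (of_nat k))) /
     (poly q (of_nat k) * poly q (of_nat k)) = e * w + s"
    unfolding w_def using k(1) by (simp add: field_simps)
  ultimately have "X w = e * w + s" by simp
  moreover have "w \<in> F" unfolding w_def using pq F by (intro subfield_divide poly_over_eval subfield_of_nat)
  moreover have "b \<noteq> 0 \<longrightarrow> w \<noteq> 0" unfolding w_def pq(4) using k by (cases "p = 0") auto
  ultimately show ?thesis by blast
qed

lemma gen_field_deriv_closed:
  fixes F :: "'a::field set"
  assumes F: "subfield F" and X: "deriv_on UNIV X" "\<And>a. a \<in> F \<Longrightarrow> X a \<in> F" "X f = 0"
    and a: "a \<in> gen_field F {f}"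
  shows "X a \<in> gen_field F {f}"
proof -
  have sup: "F \<subseteq> gen_field F {f}" using gen_field_superset[of F "{f}"] by blast
  show ?thesis
    by (rule deriv_gen_field_closed[OF F subfield_UNIV subset_UNIV X(1) _ _ a])
       (use X(2,3) sup subfield_zero[OF subfield_gen_field] in auto)
qed

text \<open>Applying \<open>X\<close> to the minimal polynomial kills its leading term and leaves a
  polynomial of smaller degree vanishing at \<open>t\<close>, hence 0. Its coefficient at
  \<open>d - 1\<close> shows that the mean of the conjugates of \<open>t\<close> has derivative
  \<open>s\<close>.\<close>

lemma log_minimal_polynomial:
  fixes k :: "'a::field set"
  assumes ch: "CHAR('a) = 0" and k: "subfield k" and X: "deriv_on UNIV X" "\<And>a. a \<in> k \<Longrightarrow> X a \<in> k"
    and t: "t \<in> acl k" "X t = s" "s \<in> k"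
  shows "\<exists>b\<in>k. X b = s"
proof -
  have X0: "X 0 = 0" and X1: "X 1 = 0" using deriv_zero[OF subfield_UNIV X(1)] deriv_one[OF subfield_UNIV X(1)] by auto
  obtain g where g: "g \<in> poly_over k" "lead_coeff g = 1" "poly g t = 0" "degree g > 0"
    "\<And>p. p \<in> poly_over k \<Longrightarrow> poly p t = 0 \<Longrightarrow> degree p < degree g \<Longrightarrow> p = 0"
    using minimal_polynomial[OF k t(1)] by metis
  define d where "d = degree g"
  define q where "q = map_poly X g + smult s (pderiv g)"
  have qk: "q \<in> poly_over k" unfolding q_def using g X X0 t k
    by (intro poly_over_add poly_over_map_poly poly_over_smult poly_over_pderiv) auto
  have "X (poly g t) = poly (map_poly X g) t + poly (pderiv g) t * X t"
    using deriv_poly[OF subfield_UNIV X(1)] by (simp add: poly_over_def)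
  then have "poly q t = 0" unfolding q_def using g(3) X0 t(2) by (simp add: mult.commute)
  moreover have "coeff q i = 0" if "i \<ge> d" for i
  proof (cases "i = d")
    case True
    then show ?thesis unfolding q_def using g(2) X0 X1 by (simp add: coeff_map_poly coeff_pderiv d_def coeff_eq_0)
  next
    case False
    then show ?thesis unfolding q_def using that X0 by (simp add: coeff_map_poly coeff_pderiv d_def coeff_eq_0)
  qed
  then have "degree q < d" using g(4) unfolding d_def by (metis degree_lessI not_gr_zero)
  ultimately have "q = 0" using g(5) qk unfolding d_def by blast
  then have "coeff q (d - 1) = 0" by simp
  then have e: "X (coeff g (d - 1)) + s * of_nat d = 0" unfolding q_def
    using g(2,4) X0 by (simp add: coeff_map_poly coeff_pderiv d_def)
  have d0: "of_nat d \<noteq> (0::'a)" using ch g(4) unfolding d_def CHAR_eq0_iff by blast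
  define b where "b = - coeff g (d - 1) / of_nat d"
  have "X b = (- X (coeff g (d - 1)) * of_nat d) / (of_nat d * of_nat d)"
    unfolding b_def using deriv_divide[OF subfield_UNIV X(1) _ _ d0] deriv_uminus[OF subfield_UNIV X(1)] deriv_of_nat[OF subfield_UNIV X(1)] by simp
  also have "\<dots> = s" using d0 e by (simp add: field_simps add_eq_0_iff)
  finally have "X b = s" .
  moreover have "b \<in> k" unfolding b_def using g k by (intro subfield_divide subfield_uminus subfield_of_nat poly_over_coeff)
  ultimately show ?thesis by blast
qed

text \<open>The multiplicative counterpart: up to sign, the constant term of the minimal polynomial
  is the norm of \<open>t\<close>, which explains the factor \<open>d\<close>.\<close>

lemma exp_minimal_polynomial:
  fixes k :: "'a::field set"
  assumes k: "subfield k" and X: "deriv_on UNIV X" "\<And>a. a \<in> k \<Longrightarrow> X a \<in> k"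
    and t: "t \<in> acl k" "t \<noteq> 0" "X t = s * t" "s \<in> k"
  shows "\<exists>b\<in>k. \<exists>d>0. b \<noteq> 0 \<and> X b = (of_nat d * s) * b"
proof -
  have X0: "X 0 = 0" and X1: "X 1 = 0" using deriv_zero[OF subfield_UNIV X(1)] deriv_one[OF subfield_UNIV X(1)] by auto
  obtain g where g: "g \<in> poly_over k" "lead_coeff g = 1" "poly g t = 0" "degree g > 0"
    "\<And>p. p \<in> poly_over k \<Longrightarrow> poly p t = 0 \<Longrightarrow> degree p < degree g \<Longrightarrow> p = 0"
    using minimal_polynomial[OF k t(1)] by metis
  define d where "d = degree g"
  \<comment> \<open>Differentiating \<open>g\<close> along \<open>X\<close> leaves the leading
    coefficient \<open>of_nat d * s\<close>; subtracting that multiple of \<open>g\<close> brings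
    the degree below \<open>d\<close>, so that minimality applies.\<close>
  define q where "q = map_poly X g + smult s (pCons 0 (pderiv g)) - smult (of_nat d * s) g"
  have qk: "q \<in> poly_over k" unfolding q_def using g X X0 t k
    by (intro poly_over_diff poly_over_add poly_over_map_poly poly_over_smult subfield_mult subfield_of_nat)
       (auto simp: poly_over_pCons_iff poly_over_pderiv subfield_zero)
  have "X (poly g t) = poly (map_poly X g) t + poly (pderiv g) t * X t"
    using deriv_poly[OF subfield_UNIV X(1)] by (simp add: poly_over_def)
  then have "poly q t = 0" unfolding q_def using g(3) X0 t(3) by (simp add: mult_ac)
  moreover have "coeff q i = 0" if ge: "i \<ge> d" for i
  proof -
    obtain j where j: "i = Suc j" using ge g(4) unfolding d_def by (cases i) auto
    show ?thesis
    proof (cases "i = d")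
      case True
      then have "coeff g (Suc j) = 1" using g(2) j by (simp add: d_def)
      then show ?thesis unfolding q_def True[symmetric] j using X1 X0
        by (simp add: coeff_map_poly coeff_pderiv mult.commute del: of_nat_Suc)
    next
      case False
      then have "coeff g (Suc j) = 0" using ge j unfolding d_def by (simp add: coeff_eq_0)
      then show ?thesis unfolding q_def j using X0 by (simp add: coeff_map_poly coeff_pderiv)
    qed
  qed
  then have "degree q < d" using g(4) unfolding d_def by (metis degree_lessI not_gr_zero)
  ultimately have "q = 0" using g(5) qk unfolding d_def by blast
  then have "coeff q 0 = 0" by simp
  then have e: "X (coeff g 0) = of_nat d * s * coeff g 0" unfolding q_def using X0 by (simp add: coeff_map_poly)
  \<comment> \<open>Otherwise \<open>g\<close> could be divided by the indeterminate, contradicting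
    minimality since \<open>t \<noteq> 0\<close>.\<close>
  have "coeff g 0 \<noteq> 0"
  proof
    assume g0: "coeff g 0 = 0"
    obtain a h where h: "g = pCons a h" by (cases g)
    then have "a = 0" using g0 by simp
    then have "poly h t = 0" using g(3) h t(2) by simp
    moreover have "h \<in> poly_over k" using g(1) h by (simp add: poly_over_pCons_iff[OF k])
    moreover have "h \<noteq> 0" using g(4) h \<open>a = 0\<close> by auto
    moreover have "degree h < degree g" using h \<open>h \<noteq> 0\<close> by simp
    ultimately show False using g(5) by blast
  qed
  then show ?thesis using e g(1,4) unfolding d_def by (auto simp: poly_over_coeff intro!: bexI[of _ "coeff g 0"])
qed

section \<open>The extension field, its constants and contraction with \<Omega>\<close>

locale elementary_setting =
  fixes n :: nat and D :: "nat \<Rightarrow> 'a::field \<Rightarrow> 'a" and \<iota> :: "complex \<Rightarrow> 'a" and x :: "nat \<Rightarrow> 'a"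
    and K :: "'a set" and P :: "nat \<Rightarrow> 'a"
  assumes commuting: "commuting_derivations n D"
    and rational: "rational_function_field n D \<iota> x K"
    and constants: "constants n D UNIV = constants n D K"
    and PK: "\<forall>i<n. P i \<in> K"
begin

lemma hom: "field_hom \<iota>" and K_def: "K = gen_field (range \<iota>) (x ` {..<n})"
  and D_\<iota>: "i < n \<Longrightarrow> D i (\<iota> a) = 0" and D_x: "i < n \<Longrightarrow> j < n \<Longrightarrow> D i (x j) = (if i = j then 1 else 0)"
  using rational by (auto simp: rational_function_field_def)

lemma ch: "CHAR('a) = 0"
  using field_hom_CHAR[OF hom] .

lemma D: "i < n \<Longrightarrow> deriv_on UNIV (D i)"
  using commuting by (auto simp: commuting_derivations_def deriv_on_def)

lemma D_on: "i < n \<Longrightarrow> deriv_on E (D i)"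
  using deriv_on_subset[OF D] by blast

lemma subfield_K: "subfield K"
  unfolding K_def by (rule subfield_gen_field)

lemma \<iota>_K: "\<iota> a \<in> K"
  using gen_field_superset[of "range \<iota>" "x ` {..<n}"] unfolding K_def by blast

text \<open>Equality of constants brings a constant of the whole field into \<open>K\<close>, where
  the constants are the complex numbers.\<close>

lemma constant_\<iota>: assumes "\<And>i. i < n \<Longrightarrow> D i y = 0" shows "y \<in> range \<iota>"
proof -
  have "y \<in> constants n D UNIV" using assms by (simp add: constants_def)
  then have "y \<in> K" unfolding constants by (simp add: constants_def)
  then show ?thesis using rational_function_constant[OF hom D D_\<iota> D_x] assms unfolding K_def by blast
qed

lemma D_K: "i < n \<Longrightarrow> y \<in> K \<Longrightarrow> D i y \<in> K"
proof -
  assume i: "i < n"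
  have "subfield {y \<in> K. D i y \<in> K}" by (rule deriv_preimage_subfield[OF subfield_K D_on[OF i]])
  moreover have "\<iota> a \<in> {y \<in> K. D i y \<in> K}" for a using \<iota>_K D_\<iota>[OF i] subfield_zero[OF subfield_K] by auto
  moreover have "x j \<in> {y \<in> K. D i y \<in> K}" if "j < n" for j
    using gen_field_superset[of "range \<iota>" "x ` {..<n}"] that D_x[OF i that] subfield_zero[OF subfield_K] subfield_one[OF subfield_K]
    unfolding K_def by auto
  ultimately have "K \<subseteq> {y \<in> K. D i y \<in> K}" unfolding K_def by (intro gen_field_least) auto
  then show "y \<in> K \<Longrightarrow> D i y \<in> K" by blast
qed

text \<open>Contraction of a one-form with the vector field dual to \<open>\<Omega>\<close>, on exact forms.\<close>

definition X :: "'a \<Rightarrow> 'a" where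
  "X y = wedge_Omega n (\<lambda>i. D i y) P"

lemma X: "deriv_on UNIV X"
  unfolding deriv_on_def
proof (intro ballI conjI)
  fix a b
  show "X (a + b) = X a + X b" unfolding X_def wedge_Omega_def
    by (simp add: deriv_add[OF subfield_UNIV D] distrib_left distrib_right sum.distrib)
  have "X (a * b) = (\<Sum>i<n. a * ((- 1) ^ i * D i b * P i) + ((- 1) ^ i * D i a * P i) * b)"
    unfolding X_def wedge_Omega_def
    by (intro sum.cong refl) (simp add: deriv_mult[OF subfield_UNIV D] algebra_simps)
  then show "X (a * b) = a * X b + X a * b"
    unfolding X_def wedge_Omega_def by (simp only: sum.distrib sum_distrib_left sum_distrib_right)
qed

lemma X_closed:
  assumes "subfield F" "K \<subseteq> F" "\<And>i a. i < n \<Longrightarrow> a \<in> F \<Longrightarrow> D i a \<in> F" "a \<in> F"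
  shows "X a \<in> F"
  unfolding X_def wedge_Omega_def using assms PK
  by (intro subfield_sum subfield_mult subfield_power subfield_uminus subfield_one) auto

text \<open>Contraction is linear over the field, so the wedge condition becomes a single equation
  for the derivation \<open>X\<close>.\<close>

lemma wedge_log_form:
  "wedge_Omega n (log_form D \<iota> m c u v) P = (\<Sum>k<m. \<iota> (c k) * (X (u k) / u k)) + X v"
proof -
  have "wedge_Omega n (log_form D \<iota> m c u v) P =
    (\<Sum>i<n. \<Sum>k<m. \<iota> (c k) * ((- 1) ^ i * D i (u k) * P i / u k)) + (\<Sum>i<n. (- 1) ^ i * D i v * P i)"
    unfolding wedge_Omega_def log_form_def sum.distrib[symmetric]
    by (intro sum.cong refl) (simp add: sum_distrib_left sum_distrib_right algebra_simps)
  also have "(\<Sum>i<n. \<Sum>k<m. \<iota> (c k) * ((- 1) ^ i * D i (u k) * P i / u k)) = (\<Sum>k<m. \<iota> (c k) * (X (u k) / u k))"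
    unfolding X_def wedge_Omega_def by (subst sum.swap) (simp add: sum_distrib_left sum_divide_distrib)
  finally show ?thesis unfolding X_def wedge_Omega_def .
qed

definition integrable_over :: "'a set \<Rightarrow> bool" where
  "integrable_over F \<longleftrightarrow> (\<exists>m c u v. v \<in> F \<and> (\<forall>k<m. u k \<in> F \<and> u k \<noteq> 0) \<and>
      wedge_Omega n (log_form D \<iota> m c u v) P = 0 \<and> (\<exists>j<n. log_form D \<iota> m c u v j \<noteq> 0))"

text \<open>Every form produced from a first integral has this shape; \<open>u = 1\<close> gives an
  exact one.\<close>

lemma integrable_over_single:
  assumes "u \<in> F" "u \<noteq> 0" "v \<in> F" "X u / u + X v = 0" "j < n" "D j u / u + D j v \<noteq> 0"
  shows "integrable_over F"
proof -
  have h1: "\<iota> 1 = 1" using hom by (simp add: field_hom_def)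
  have "wedge_Omega n (log_form D \<iota> 1 (\<lambda>_. 1) (\<lambda>_. u) v) P = 0"
    unfolding wedge_log_form using assms(4) by (simp add: h1)
  moreover have "log_form D \<iota> 1 (\<lambda>_. 1) (\<lambda>_. u) v j \<noteq> 0" unfolding log_form_def using assms(6) by (simp add: h1)
  ultimately show ?thesis unfolding integrable_over_def using assms
    by (intro exI[of _ 1] exI[of _ "\<lambda>_. 1"] exI[of _ "\<lambda>_. u"] exI[of _ v]) auto
qed

end

text \<open>\<open>F\<close> is relatively algebraically closed, so \<open>t \<notin> F\<close> says
  that \<open>t\<close> is transcendental. The equation of an exponential is kept in product
  form.\<close>

locale elementary_step_setting = elementary_setting +
  fixes F :: "'a set" and t R :: 'a and exponential :: bool
  assumes F: "subfield F" "acl F = F" "K \<subseteq> F" and DF: "\<And>i a. i < n \<Longrightarrow> a \<in> F \<Longrightarrow> D i a \<in> F"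
    and t: "t \<notin> F" and R: "R \<in> F"
    and dt: "if exponential then \<forall>i<n. D i t = D i R * t else R \<noteq> 0 \<and> (\<forall>i<n. D i t = D i R / R)"
begin

lemma t0: "t \<noteq> 0"
  using t subfield_zero[OF F(1)] by auto

lemma XF: "a \<in> F \<Longrightarrow> X a \<in> F"
  using X_closed[OF F(1,3)] DF by blast

lemma X_t: "X t = (if exponential then X R * t else X R / R)"
proof (cases exponential)
  case True
  then have "X t = (\<Sum>i<n. (- 1) ^ i * (D i R * t) * P i)"
    unfolding X_def wedge_Omega_def using dt by (intro sum.cong refl) simp
  then show ?thesis using True unfolding X_def wedge_Omega_def by (simp add: sum_distrib_left mult_ac)
next
  case False
  then have "X t = (\<Sum>i<n. (- 1) ^ i * (D i R / R) * P i)"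
    unfolding X_def wedge_Omega_def using dt by (intro sum.cong refl) simp
  then show ?thesis using False unfolding X_def wedge_Omega_def by (simp add: sum_divide_distrib mult_ac)
qed

text \<open>For \<open>f\<close> in \<open>F\<close> the form \<open>df\<close> serves. Otherwise
  the new form is nonzero because a relation among its terms would be a new constant involving
  \<open>t\<close>.\<close>

lemma first_integral_descends:
  assumes f: "f \<in> acl (gen_field F {t})" "X f = 0" and j: "j < n" "D j f \<noteq> 0"
  shows "integrable_over F"
proof (cases "f \<in> F")
  case True
  show ?thesis
    by (rule integrable_over_single[of 1 _ f j])
       (use True f j F deriv_one[OF subfield_UNIV X] deriv_one[OF subfield_UNIV D[OF j(1)]] in \<open>auto simp: subfield_one\<close>)
next
  case False
  define k where "k = gen_field F {f}"
  have k: "subfield k" "F \<subseteq> k" unfolding k_def using subfield_gen_field gen_field_superset[of F "{f}"] by auto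
  have f': "f \<notin> acl F" using False F(2) by simp
  have tk: "t \<in> acl k" unfolding k_def using acl_exchange[OF F(1) f(1) f'] .
  have Xk: "a \<in> k \<Longrightarrow> X a \<in> k" for a unfolding k_def using gen_field_deriv_closed[OF F(1) X XF f(2)] .
  show ?thesis
  proof (cases exponential)
    case True
    have "X R \<in> k" using XF R k by blast
    moreover have "X t = X R * t" using X_t True by simp
    \<comment> \<open>The summand 0 puts the equation into the affine shape expected by
      \<open>specialize_first_integral\<close>.\<close>
    ultimately obtain b d where b: "b \<in> k" "d > 0" "b \<noteq> 0" "X b = (of_nat d * X R) * b + 0"
      using exp_minimal_polynomial[OF k(1) X Xk tk t0, of "X R"] by auto
    obtain w where w: "w \<in> F" "X w = (of_nat d * X R) * w + 0" "w \<noteq> 0"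
      using specialize_first_integral[OF ch F(1) X XF f' f(2) b(1)[unfolded k_def] b(4)] b(3) XF R F
      by (auto simp: subfield_intros)
    have t_pow: "t ^ d \<notin> F"
    proof
      assume td: "t ^ d \<in> F"
      have "monom 1 d - [:t ^ d:] \<in> poly_over F" using td F
        by (auto intro!: poly_over_diff poly_over_monom simp: poly_over_pCons_iff poly_over_zero subfield_one)
      moreover have "coeff (monom 1 d - [:t ^ d:]) d = 1" using b(2) by (simp add: coeff_pCons split: nat.splits)
      then have "monom 1 d - [:t ^ d:] \<noteq> 0" by (metis coeff_0 zero_neq_one)
      moreover have "poly (monom 1 d - [:t ^ d:]) t = 0" by (simp add: poly_monom)
      ultimately have "t \<in> acl F" unfolding acl_def by blast
      then show False using F(2) t by simp
    qed
    define v where "v = - (of_nat d * R)"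
    have Dv: "\<delta> v = - (of_nat d * \<delta> R)" if "deriv_on UNIV \<delta>" for \<delta>
      unfolding v_def using deriv_uminus[OF subfield_UNIV that] deriv_mult[OF subfield_UNIV that] deriv_of_nat[OF subfield_UNIV that] by simp
    have "\<exists>j<n. D j w / w + D j v \<noteq> 0"
    proof (rule ccontr)
      assume "\<not> ?thesis"
      then have *: "\<And>i. i < n \<Longrightarrow> D i w / w = of_nat d * D i R" using Dv[OF D] by simp
      \<comment> \<open>If the form vanished, \<open>w\<close> and \<open>t ^ d\<close> would have
        the same logarithmic derivatives, and their quotient would be a complex constant; then
        \<open>t ^ d\<close> would lie in \<open>F\<close>.\<close>
      have "D i (w / t ^ d) = 0" if i: "i < n" for i
      proof -
        have "D i (w / t ^ d) / (w / t ^ d) = D i w / w - D i (t ^ d) / t ^ d"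
          using w(3) t0 by (intro deriv_log_divide[OF subfield_UNIV D[OF i]]) auto
        also have "D i (t ^ d) / t ^ d = of_nat d * (D i t / t)" using t0 by (intro deriv_log_power[OF subfield_UNIV D[OF i]]) auto
        also have "D i t / t = D i R" using dt True i t0 by simp
        finally show ?thesis using *[OF i] w(3) t0 by simp
      qed
      then obtain a where a: "w / t ^ d = \<iota> a" using constant_\<iota> by blast
      then have "t ^ d = w / \<iota> a" using w(3) t0 by (auto simp: field_simps)
      then have "t ^ d \<in> F" using w(1) \<iota>_K F by (auto intro!: subfield_divide)
      then show False using t_pow by simp
    qed
    then obtain j where "j < n" "D j w / w + D j v \<noteq> 0" by blast
    moreover have "X w / w + X v = 0" using w Dv[OF X] by simp
    moreover have "v \<in> F" unfolding v_def using R F by (auto intro!: subfield_intros)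
    ultimately show ?thesis using w integrable_over_single by blast
  next
    case False
    have R0: "R \<noteq> 0" using dt False by simp
    have XR: "X R / R \<in> F" using XF R F by (auto intro: subfield_divide)
    then obtain b where b: "b \<in> k" "X b = 0 * b + X R / R"
      using log_minimal_polynomial[OF ch k(1) X Xk tk] X_t False k by auto
    obtain w where w: "w \<in> F" "X w = X R / R"
      using specialize_first_integral[OF ch F(1) X XF f' f(2) b(1)[unfolded k_def] b(2)] XR F
      by (auto simp: subfield_zero)
    have "\<exists>j<n. D j R / R + D j (- w) \<noteq> 0"
    proof (rule ccontr)
      assume "\<not> ?thesis"
      \<comment> \<open>Both \<open>t\<close> and \<open>R\<close> have to do with the same form:
        \<open>dt = dR / R\<close>, so a vanishing form makes \<open>t - w\<close> constant.\<close>
      then have "\<And>i. i < n \<Longrightarrow> D i (t - w) = 0" using dt False deriv_diff[OF subfield_UNIV D] deriv_uminus[OF subfield_UNIV D] by simp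
      then obtain a where "t - w = \<iota> a" using constant_\<iota> by blast
      then have "t = \<iota> a + w" by (simp add: algebra_simps)
      then have "t \<in> F" using w(1) \<iota>_K F by (auto intro!: subfield_add)
      then show False using t by simp
    qed
    then obtain j where "j < n" "D j R / R + D j (- w) \<noteq> 0" by blast
    moreover have "X R / R + X (- w) = 0" using w deriv_uminus[OF subfield_UNIV X] by simp
    ultimately show ?thesis using w(1) R R0 F integrable_over_single[of R F "- w" j] by (simp add: subfield_uminus)
  qed
qed

end

section \<open>Descent along the tower\<close>

context elementary_step_setting
begin

lemma t_acl: "t \<notin> acl F"
  using t F(2) by simp

abbreviation "G \<equiv> gen_field F {t}"

lemma G: "subfield G" "F \<subseteq> G" "t \<in> G"
  using subfield_gen_field gen_field_superset[of F "{t}"] by auto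

text \<open>Writes both cases as \<alpha> + \<beta> \<open>t\<close> over \<open>F\<close>, with
  \<beta> = 0 for a logarithm, as the reading at infinity demands.\<close>

lemma D_t_F: "i < n \<Longrightarrow> D i t = (if exponential then 0 else D i R / R) + (if exponential then D i R else 0) * t"
  using dt by auto

lemma D_G: "i < n \<Longrightarrow> a \<in> G \<Longrightarrow> D i a \<in> G"
proof -
  assume i: "i < n" and a: "a \<in> G"
  have "D i t \<in> G" unfolding D_t_F[OF i] using DF[OF i R] R G by (auto intro!: subfield_intros)
  then show "D i a \<in> G"
    by (rule deriv_gen_field_closed[OF F(1) subfield_UNIV subset_UNIV D[OF i] _ _ a, rotated]) (use DF[OF i] G in blast)
qed

text \<open>As \<open>t\<close> is transcendental, any value for \<open>\<theta> t\<close> is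
  admissible. The extension goes only to a finite extension holding the finitely many data
  \<open>S\<close>, which is all that the form involves.\<close>

lemma t_derivation_exists:
  assumes "finite S" "S \<subseteq> acl G"
  obtains E \<theta> where "finite_ext G E" "S \<subseteq> E" "deriv_on E \<theta>" "\<And>a. a \<in> F \<Longrightarrow> \<theta> a = 0"
    "\<theta> t = (if exponential then t else 1)" "\<And>a. a \<in> E \<Longrightarrow> \<theta> a \<in> E"
proof -
  have z: "deriv_on F (\<lambda>_. 0)" by (simp add: deriv_on_def)
  have wd: "poly (map_poly (\<lambda>_. 0) p) t + poly (pderiv p) t * (if exponential then t else 1) = 0"
    if "p \<in> poly_over F" "poly p t = 0" for p
    using transcendental_nonzero[OF t_acl that(1)] that(2) by simp
  have xi: "(if exponential then t else 1) \<in> G" using G by (auto simp: subfield_one)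
  obtain \<theta>0 where th0: "deriv_on G \<theta>0" "\<And>a. a \<in> F \<Longrightarrow> \<theta>0 a = 0" "\<theta>0 t = (if exponential then t else 1)"
    "\<And>a. a \<in> G \<Longrightarrow> \<theta>0 a \<in> G"
    using deriv_extend[OF F(1) z wd xi] subfield_zero[OF F(1)] by metis
  obtain E \<theta> where E: "finite_ext G E" "S \<subseteq> E" "deriv_on E \<theta>" "\<And>a. a \<in> G \<Longrightarrow> \<theta> a = \<theta>0 a" "\<And>a. a \<in> E \<Longrightarrow> \<theta> a \<in> E"
    using deriv_extend_finite[OF ch G(1) th0(1,4) assms] by metis
  show ?thesis by (rule that[OF E(1-3)]) (use E th0 G in auto)
qed

text \<open>If \<open>z\<close> were outside \<open>F\<close>, exchange would make \<open>t\<close>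
  algebraic over \<open>F(z)\<close>, a field killed by \<theta>, contradicting
  \<open>\<theta> t \<noteq> 0\<close>.\<close>

lemma t_derivation_kernel:
  assumes E: "finite_ext G E" and \<theta>: "deriv_on E \<theta>" "\<And>a. a \<in> F \<Longrightarrow> \<theta> a = 0" "\<theta> t \<noteq> 0"
    and z: "z \<in> E" "\<theta> z = 0"
  shows "z \<in> F"
proof (rule ccontr)
  assume "z \<notin> F"
  then have zF: "z \<notin> acl F" using F(2) by simp
  have sE: "subfield E" "G \<subseteq> E" using E by (auto simp: finite_ext_def)
  have zG: "z \<in> acl G" using finite_ext_subset_acl[OF E] z by blast
  have tz: "t \<in> acl (gen_field F {z})" by (rule acl_exchange[OF F(1) zG zF])
  have "gen_field F {z} \<subseteq> {a \<in> E. \<theta> a = 0}"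
    using deriv_kernel_subfield[OF sE(1) \<theta>(1)] z \<theta>(2) sE G by (intro gen_field_least) auto
  then have "\<theta> t = 0" using sE G tz
    by (intro deriv_vanishes_algebraic[OF ch subfield_gen_field sE(1) _ \<theta>(1) _ tz]) auto
  then show False using \<theta>(3) by simp
qed

text \<open>The commutator is a derivation; it vanishes on \<open>F\<close> and at \<open>t\<close>,
  hence on \<open>G\<close> and on everything algebraic over \<open>G\<close>.\<close>

lemma t_derivation_commutes:
  assumes E: "finite_ext G E" and \<theta>: "deriv_on E \<theta>" "\<And>a. a \<in> F \<Longrightarrow> \<theta> a = 0"
    "\<theta> t = (if exponential then t else 1)" "\<And>a. a \<in> E \<Longrightarrow> \<theta> a \<in> E"
    and DE: "\<And>a. a \<in> E \<Longrightarrow> D i a \<in> E" and i: "i < n" and y: "y \<in> E"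
  shows "\<theta> (D i y) = D i (\<theta> y)"
proof -
  have sE: "subfield E" "G \<subseteq> E" using E by (auto simp: finite_ext_def)
  define \<delta> where "\<delta> a = \<theta> (D i a) - D i (\<theta> a)" for a
  have dd: "deriv_on E \<delta>" unfolding \<delta>_def by (rule deriv_on_commutator[OF sE(1) \<theta>(1) D_on[OF i] \<theta>(4) DE])
  have "\<delta> a = 0" if "a \<in> F" for a
    unfolding \<delta>_def using that \<theta>(2) DF[OF i] deriv_zero[OF subfield_UNIV D[OF i]] by simp
  moreover have "\<delta> t = 0"
  proof (cases exponential)
    case True
    have "D i R \<in> F" using DF[OF i R] .
    then have "\<theta> (D i R * t) = D i R * t"
      using deriv_mult[OF sE(1) \<theta>(1), of "D i R" t] \<theta>(2,3) True G sE by auto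
    then show ?thesis unfolding \<delta>_def using True \<theta>(3) dt i by simp
  next
    case False
    have "D i R / R \<in> F" using DF[OF i R] R F(1) by (auto intro: subfield_divide)
    then show ?thesis unfolding \<delta>_def using False \<theta>(2,3) dt i deriv_one[OF subfield_UNIV D[OF i]] by simp
  qed
  ultimately have "G \<subseteq> {a \<in> E. \<delta> a = 0}"
    using deriv_kernel_subfield[OF sE(1) dd] sE G by (intro gen_field_least) auto
  then have "\<delta> a = 0" if "a \<in> G" for a using that by blast
  moreover have "y \<in> acl G" using finite_ext_subset_acl[OF E] y by blast
  ultimately have "\<delta> y = 0" using deriv_vanishes_algebraic[OF ch G(1) sE dd y] by blast
  then show ?thesis by (simp add: \<delta>_def)
qed

lemma integrable_over_descends:
  assumes "integrable_over (acl G)"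
  shows "integrable_over F"
proof -
  obtain m c u v where v: "v \<in> acl G" and u: "\<And>k. k < m \<Longrightarrow> u k \<in> acl G" "\<And>k. k < m \<Longrightarrow> u k \<noteq> 0"
    and w0: "wedge_Omega n (log_form D \<iota> m c u v) P = 0" and nz: "\<exists>j<n. log_form D \<iota> m c u v j \<noteq> 0"
    using assms unfolding integrable_over_def by blast
  obtain E \<theta> where E: "finite_ext G E" "insert v (u ` {..<m}) \<subseteq> E" and \<theta>: "deriv_on E \<theta>" "\<And>a. a \<in> F \<Longrightarrow> \<theta> a = 0"
    "\<theta> t = (if exponential then t else 1)" "\<And>a. a \<in> E \<Longrightarrow> \<theta> a \<in> E"
    using t_derivation_exists[of "insert v (u ` {..<m})"] v u by (auto simp: image_subset_iff)
  have sE: "subfield E" "G \<subseteq> E" using E by (auto simp: finite_ext_def)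
  have FE: "F \<subseteq> E" "t \<in> E" "R \<in> E" using sE G R by auto
  have uE: "k < m \<Longrightarrow> u k \<in> E" for k using E(2) by auto
  have vE: "v \<in> E" using E(2) by auto
  have DE: "D i a \<in> E" if "i < n" "a \<in> E" for i a
    using deriv_algebraic_closed[OF ch G(1) sE D[OF that(1)] subset_UNIV that(2)] finite_ext_subset_acl[OF E(1)] that D_G by blast
  have comm: "\<theta> (D i a) = D i (\<theta> a)" if "i < n" "a \<in> E" for i a
    using t_derivation_commutes[OF E(1) \<theta> DE[OF that(1)] that] .
  have iF: "\<iota> a \<in> F" for a using \<iota>_K F(3) by blast
  have iE: "\<iota> a \<in> E" for a using iF FE by blast
  have lin: "\<theta> (a * y) = a * \<theta> y" if "a \<in> F" "y \<in> E" for a y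
    using deriv_mult[OF sE(1) \<theta>(1), of a y] that FE \<theta>(2) by auto
  have Dlin: "D i (\<iota> a * y) = \<iota> a * D i y" if "i < n" for a y i
    using deriv_mult[OF subfield_UNIV D[OF that], of "\<iota> a" y] D_\<iota>[OF that] by simp
  \<comment> \<open>The logarithmic form contracted with \<theta>. Commutation of \<theta> with
    \<open>D i\<close> gives \<open>swap\<close>: differentiating a coefficient by \<theta> equals
    differentiating \<open>res\<close> by \<open>D i\<close>.\<close>
  define res where "res m c u v = (\<Sum>k<m. \<iota> (c k) * (\<theta> (u k) / u k)) + \<theta> v"
    for m :: nat and c u v
  have swap: "\<theta> (log_form D \<iota> m c u v i) = D i (res m c u v)" and lE: "log_form D \<iota> m c u v i \<in> E"
    if i: "i < n" and uv: "\<And>k. k < m \<Longrightarrow> u k \<in> E \<and> u k \<noteq> 0" "v \<in> E" for m c u v i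
  proof -
    have lf: "log_form D \<iota> m c u v i = (\<Sum>k<m. \<iota> (c k) * (D i (u k) / u k)) + D i v" by (simp add: log_form_def)
    have in1: "D i (u k) / u k \<in> E" "\<theta> (u k) / u k \<in> E" if "k < m" for k
      using uv(1)[OF that] DE[OF i] \<theta>(4) sE(1) by (auto intro: subfield_divide)
    have in2: "\<iota> (c k) * (D i (u k) / u k) \<in> E" if "k < m" for k
      by (rule subfield_mult[OF sE(1) iE in1(1)[OF that]])
    have in3: "(\<Sum>k<m. \<iota> (c k) * (D i (u k) / u k)) \<in> E" using in2 by (intro subfield_sum[OF sE(1)]) blast
    show "log_form D \<iota> m c u v i \<in> E" unfolding lf by (rule subfield_add[OF sE(1) in3 DE[OF i uv(2)]])
    have "\<theta> (log_form D \<iota> m c u v i) = \<theta> (\<Sum>k<m. \<iota> (c k) * (D i (u k) / u k)) + \<theta> (D i v)"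
      unfolding lf by (rule deriv_add[OF sE(1) \<theta>(1) in3 DE[OF i uv(2)]])
    also have "\<theta> (\<Sum>k<m. \<iota> (c k) * (D i (u k) / u k)) = (\<Sum>k<m. \<theta> (\<iota> (c k) * (D i (u k) / u k)))"
      using in2 by (intro deriv_sum[OF sE(1) \<theta>(1)]) blast
    finally have "\<theta> (log_form D \<iota> m c u v i) = (\<Sum>k<m. \<theta> (\<iota> (c k) * (D i (u k) / u k))) + \<theta> (D i v)" .
    also have "\<dots> = (\<Sum>k<m. \<iota> (c k) * D i (\<theta> (u k) / u k)) + D i (\<theta> v)"
    proof (intro arg_cong2[of _ _ _ _ "(+)"] sum.cong refl)
      fix k assume "k \<in> {..<m}"
      then have k: "k < m" by simp
      have "\<theta> (\<iota> (c k) * (D i (u k) / u k)) = \<iota> (c k) * \<theta> (D i (u k) / u k)" using lin[OF iF in1(1)[OF k]] .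
      also have "\<theta> (D i (u k) / u k) = D i (\<theta> (u k) / u k)"
        using deriv_log_commute[OF sE(1) \<theta>(1) D_on[OF i] \<theta>(4) DE[OF i] comm[OF i]] uv(1)[OF k] by blast
      finally show "\<theta> (\<iota> (c k) * (D i (u k) / u k)) = \<iota> (c k) * D i (\<theta> (u k) / u k)" .
    qed (rule comm[OF i uv(2)])
    also have "\<dots> = D i (res m c u v)" unfolding res_def
      by (simp add: deriv_add[OF subfield_UNIV D[OF i]] deriv_sum[OF subfield_UNIV D[OF i]] Dlin[OF i] del: times_divide_eq_right)
    finally show "\<theta> (log_form D \<iota> m c u v i) = D i (res m c u v)" .
  qed
  define a where "a = res m c u v"
  have aE: "a \<in> E" unfolding a_def res_def using uE vE \<theta>(4) iE
    by (intro subfield_add[OF sE(1)] subfield_sum[OF sE(1)] subfield_mult[OF sE(1)] subfield_divide[OF sE(1)]) blast+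
  have Da: "D i a = \<theta> (log_form D \<iota> m c u v i)" if "i < n" for i
    unfolding a_def using swap[OF that, of m u v c] uE u(2) vE by simp
  \<comment> \<open>Apply \<theta> to the vanishing contraction; the coefficients of \<Omega> lie in
    \<open>F\<close>, so \<theta> passes through them.\<close>
  have Xa: "X a = 0"
  proof -
    have sg: "(- 1) ^ i * P i \<in> F" if "i < n" for i using that PK F by (auto intro!: subfield_intros)
    have "X a = (\<Sum>i<n. \<theta> (((- 1) ^ i * P i) * log_form D \<iota> m c u v i))"
      unfolding X_def wedge_Omega_def
    proof (intro sum.cong refl)
      fix i assume "i \<in> {..<n}"
      then have i: "i < n" by simp
      show "(- 1) ^ i * D i a * P i = \<theta> (((- 1) ^ i * P i) * log_form D \<iota> m c u v i)"
        using lin[OF sg[OF i] lE[OF i, of m u v c]] uE u(2) vE Da[OF i] by (simp add: mult_ac)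
    qed
    also have "\<dots> = \<theta> (\<Sum>i<n. ((- 1) ^ i * P i) * log_form D \<iota> m c u v i)"
    proof (rule deriv_sum[OF sE(1) \<theta>(1), symmetric])
      fix i assume "i \<in> {..<n}"
      then have i: "i < n" by simp
      have "log_form D \<iota> m c u v i \<in> E" using lE[OF i, of m u v c] uE u(2) vE by blast
      then show "((- 1) ^ i * P i) * log_form D \<iota> m c u v i \<in> E" using subfield_mult[OF sE(1)] sg[OF i] FE(1) by blast
    qed
    also have "(\<Sum>i<n. ((- 1) ^ i * P i) * log_form D \<iota> m c u v i) = 0"
      using w0 unfolding wedge_Omega_def by (simp add: mult_ac)
    finally show ?thesis using deriv_zero[OF sE(1) \<theta>(1)] by simp
  qed
  show ?thesis
  proof (cases "\<exists>j<n. D j a \<noteq> 0")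
    case True
    then obtain j where "j < n" "D j a \<noteq> 0" by blast
    then show ?thesis using first_integral_descends[OF _ Xa] finite_ext_subset_acl[OF E(1)] aE by blast
  next
    case False
    then obtain \<gamma> where \<gamma>: "a = \<iota> \<gamma>" using constant_\<iota> by blast
    \<comment> \<open>The extra term is \<open>- a * (dt/t - dR)\<close> or
      \<open>a * (dR/R - dt)\<close>. It is zero as a form, leaving all coefficients as they are,
      but it changes \<open>res\<close> by \<open>- a\<close>.\<close>
    define m' where "m' = Suc m"
    define c' where "c' = c(m := if exponential then - \<gamma> else \<gamma>)"
    define u' where "u' = u(m := if exponential then t else R)"
    define v' where "v' = v + (if exponential then a * R else - (a * t))"
    have u': "u' k \<in> E \<and> u' k \<noteq> 0" if "k < m'" for k
      unfolding u'_def using that uE u(2) FE t0 dt by (auto simp: m'_def)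
    have v': "v' \<in> E" unfolding v'_def using vE aE FE sE(1) by (auto intro!: subfield_intros)
    have hm: "\<iota> (- \<gamma>) = - a" using field_hom_uminus[OF hom] \<gamma> by simp
    have sum': "(\<Sum>k<m'. \<iota> (c' k) * (\<delta> (u' k) / u' k)) = (\<Sum>k<m. \<iota> (c k) * (\<delta> (u k) / u k)) +
        (if exponential then - a * (\<delta> t / t) else a * (\<delta> R / R))" for \<delta>
      unfolding m'_def c'_def u'_def by (simp add: hm \<gamma>[symmetric])
    have lf': "log_form D \<iota> m' c' u' v' i = log_form D \<iota> m c u v i" if i: "i < n" for i
    proof -
      have "D i v' = D i v + (if exponential then a * D i R else - (a * D i t))"
        unfolding v'_def \<gamma> using deriv_add[OF subfield_UNIV D[OF i]] Dlin[OF i] deriv_uminus[OF subfield_UNIV D[OF i]] by simp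
      moreover have "if exponential then D i t / t = D i R else D i t = D i R / R" using dt i t0 by simp
      ultimately show ?thesis using sum'[of "D i"] unfolding log_form_def times_divide_eq_right[symmetric]
        by (cases exponential) (simp_all del: times_divide_eq_right)
    qed
    have res': "res m' c' u' v' = 0"
    proof -
      have aF: "a \<in> F" unfolding \<gamma> by (rule iF)
      have "\<theta> v' = \<theta> v + (if exponential then 0 else - a)"
      proof (cases exponential)
        case True
        have "\<theta> (v + a * R) = \<theta> v + \<theta> (a * R)" using vE aE FE sE(1) by (intro deriv_add[OF sE(1) \<theta>(1)]) (auto intro: subfield_mult)
        also have "\<theta> (a * R) = 0" using aF R F(1) by (intro \<theta>(2)) (auto intro: subfield_mult)
        finally show ?thesis using True by (simp add: v'_def)
      next
        case False
        have "\<theta> (v - a * t) = \<theta> v - \<theta> (a * t)" using vE aE FE sE(1) by (intro deriv_diff[OF sE(1) \<theta>(1)]) (auto intro: subfield_mult)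
        also have "\<theta> (a * t) = a" using lin[OF aF FE(2)] \<theta>(3) False by simp
        finally show ?thesis using False by (simp add: v'_def)
      qed
      then show ?thesis unfolding res_def sum'[of \<theta>] using \<theta>(2,3) R t0 a_def unfolding res_def by auto
    qed
    define A where "A i = log_form D \<iota> m c u v i" for i
    have AF: "A i \<in> F" if i: "i < n" for i
    proof -
      have "A i \<in> E" unfolding A_def using lE[OF i, of m u v c] uE u(2) vE by simp
      moreover have "\<theta> (A i) = 0"
        using swap[OF i, of m' u' v' c'] u' v' res' deriv_zero[OF subfield_UNIV D[OF i]] lf'[OF i] by (simp add: A_def)
      ultimately show ?thesis using t_derivation_kernel[OF E(1) \<theta>(1,2)] \<theta>(3) t0 by auto
    qed
    \<comment> \<open>Only now is it safe to take traces: the coefficients \<open>A i\<close> lie in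
      \<open>F\<close>, so their traces are nonzero integer multiples of themselves.\<close>
    from trace_norm_exist[OF E(1)] obtain Tr N and d :: nat where d0: "d > 0" and TrG: "\<forall>y\<in>E. Tr y \<in> G"
      and Tradd: "\<forall>y\<in>E. \<forall>z\<in>E. Tr (y + z) = Tr y + Tr z"
      and Trlin: "\<forall>a\<in>G. \<forall>y\<in>E. Tr (a * y) = a * Tr y"
      and Trs: "\<forall>a\<in>G. Tr a = of_nat d * a"
      and NG: "\<forall>u\<in>E. u \<noteq> 0 \<longrightarrow> N u \<in> G \<and> N u \<noteq> 0"
      and TrN: "\<forall>\<delta>. deriv_on E \<delta> \<longrightarrow> (\<forall>a\<in>G. \<delta> a \<in> G) \<longrightarrow> (\<forall>a\<in>E. \<delta> a \<in> E) \<longrightarrow>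
        (\<forall>y\<in>E. Tr (\<delta> y) = \<delta> (Tr y)) \<and> (\<forall>u\<in>E. u \<noteq> 0 \<longrightarrow> Tr (\<delta> u / u) = \<delta> (N u) / N u)"
      by (elim exE conjE)
    have Tr0: "Tr 0 = 0" using Trs G(1) by (simp add: subfield_zero)
    have Trsum: "Tr (\<Sum>k\<in>I. f k) = (\<Sum>k\<in>I. Tr (f k))" if "finite I" "\<And>k. k \<in> I \<Longrightarrow> f k \<in> E" for I and f :: "nat \<Rightarrow> 'a"
      using that
    proof (induction I rule: finite_induct)
      case (insert k I)
      then show ?case using Tradd sE(1) by (simp add: subfield_sum)
    qed (simp add: Tr0)
    have traced: "Tr ((\<Sum>k<m'. \<iota> (c' k) * (\<delta> (u' k) / u' k)) + \<delta> v') =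
        (\<Sum>k<m'. \<iota> (c' k) * (\<delta> (N (u' k)) / N (u' k))) + \<delta> (Tr v')"
      if \<delta>: "deriv_on E \<delta>" "\<And>a. a \<in> G \<Longrightarrow> \<delta> a \<in> G" "\<And>a. a \<in> E \<Longrightarrow> \<delta> a \<in> E" for \<delta>
    proof -
      have T: "\<And>y. y \<in> E \<Longrightarrow> Tr (\<delta> y) = \<delta> (Tr y)" "\<And>u. u \<in> E \<Longrightarrow> u \<noteq> 0 \<Longrightarrow> Tr (\<delta> u / u) = \<delta> (N u) / N u"
        using TrN[rule_format, OF \<delta>(1)] \<delta>(2,3) by auto
      have in1: "\<delta> (u' k) / u' k \<in> E" if "k < m'" for k using u'[OF that] \<delta>(3) sE(1) by (auto intro: subfield_divide)
      have in2: "\<iota> (c' k) * (\<delta> (u' k) / u' k) \<in> E" if "k < m'" for k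
        by (rule subfield_mult[OF sE(1) iE in1[OF that]])
      have "Tr ((\<Sum>k<m'. \<iota> (c' k) * (\<delta> (u' k) / u' k)) + \<delta> v') = Tr (\<Sum>k<m'. \<iota> (c' k) * (\<delta> (u' k) / u' k)) + Tr (\<delta> v')"
        using in2 v' \<delta>(3) by (intro Tradd[rule_format] subfield_sum[OF sE(1)]) blast+
      also have "Tr (\<Sum>k<m'. \<iota> (c' k) * (\<delta> (u' k) / u' k)) = (\<Sum>k<m'. Tr (\<iota> (c' k) * (\<delta> (u' k) / u' k)))"
        using in2 by (intro Trsum) blast+
      also have "\<dots> = (\<Sum>k<m'. \<iota> (c' k) * (\<delta> (N (u' k)) / N (u' k)))"
      proof (intro sum.cong refl)
        fix k assume "k \<in> {..<m'}"
        then have k: "k < m'" by simp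
        have "Tr (\<iota> (c' k) * (\<delta> (u' k) / u' k)) = \<iota> (c' k) * Tr (\<delta> (u' k) / u' k)"
          using Trlin in1[OF k] iF G by blast
        then show "Tr (\<iota> (c' k) * (\<delta> (u' k) / u' k)) = \<iota> (c' k) * (\<delta> (N (u' k)) / N (u' k))" using T(2) u'[OF k] by simp
      qed
      finally show ?thesis using T(1)[OF v'] by simp
    qed
    define uN where "uN k = N (u' k)" for k
    define vT where "vT = Tr v'"
    have th_G: "\<theta> a \<in> G" if "a \<in> G" for a
    proof (rule deriv_gen_field_closed[OF F(1) sE \<theta>(1) _ _ that])
      show "\<theta> b \<in> G" if "b \<in> F" for b using \<theta>(2)[OF that] subfield_zero[OF G(1)] by simp
      show "\<theta> t \<in> G" unfolding \<theta>(3) using G(3) subfield_one[OF G(1)] by simp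
    qed
    \<comment> \<open>The trace preserves the normalisation: \<theta> maps \<open>G\<close> to
      itself, so the traced form also has zero contraction with \<theta>.\<close>
    have p1: "(\<Sum>k<m'. \<iota> (c' k) * (\<theta> (uN k) / uN k)) + \<theta> vT = 0"
      using traced[OF \<theta>(1) th_G \<theta>(4)] res' Tr0 unfolding res_def uN_def vT_def by simp
    have p2: "\<And>k. k < m' \<Longrightarrow> uN k \<in> G \<and> uN k \<noteq> 0" unfolding uN_def using NG u' by blast
    have p3: "vT \<in> G" unfolding vT_def using TrG v' by blast
    have p4: "(\<theta> t = 1 \<and> \<not> exponential) \<or> (\<theta> t = t \<and> exponential)" using \<theta>(3) by simp
    have "\<exists>l h. (\<forall>k<m'. l k \<in> F \<and> l k \<noteq> 0) \<and> h \<in> F \<and>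
      (\<forall>\<delta> \<alpha> \<beta>. deriv_on G \<delta> \<longrightarrow> (\<forall>a\<in>F. \<delta> a \<in> F) \<longrightarrow> \<delta> t = \<alpha> + \<beta> * t \<longrightarrow> \<alpha> \<in> F \<longrightarrow> \<beta> \<in> F \<longrightarrow>
       (\<beta> = 0 \<or> exponential) \<longrightarrow> (\<Sum>k<m'. \<iota> (c' k) * (\<delta> (uN k) / uN k)) + \<delta> vT \<in> F \<longrightarrow>
       (\<Sum>k<m'. \<iota> (c' k) * (\<delta> (uN k) / uN k)) + \<delta> vT = (\<Sum>k<m'. \<iota> (c' k) * (\<delta> (l k) / l k)) + \<delta> h)"
      by (rule log_form_descends[where c = "\<lambda>k. \<iota> (c' k)", OF ch F(1) t_acl p2 p3 iF deriv_on_subset[OF \<theta>(1) sE(2)] \<theta>(2) p4 p1])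
    then obtain l h where l: "\<forall>k<m'. l k \<in> F \<and> l k \<noteq> 0" and h: "h \<in> F"
      and desc: "\<forall>\<delta> \<alpha> \<beta>. deriv_on G \<delta> \<longrightarrow> (\<forall>a\<in>F. \<delta> a \<in> F) \<longrightarrow> \<delta> t = \<alpha> + \<beta> * t \<longrightarrow> \<alpha> \<in> F \<longrightarrow> \<beta> \<in> F \<longrightarrow>
       (\<beta> = 0 \<or> exponential) \<longrightarrow> (\<Sum>k<m'. \<iota> (c' k) * (\<delta> (uN k) / uN k)) + \<delta> vT \<in> F \<longrightarrow>
       (\<Sum>k<m'. \<iota> (c' k) * (\<delta> (uN k) / uN k)) + \<delta> vT = (\<Sum>k<m'. \<iota> (c' k) * (\<delta> (l k) / l k)) + \<delta> h"
      by (elim exE conjE)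
    \<comment> \<open>Two descents in a row: the trace moves the data from \<open>E\<close> to
      \<open>G\<close>, and the value at infinity moves them from \<open>G\<close> to
      \<open>F\<close>; together they multiply the form by \<open>d\<close>.\<close>
    have form: "log_form D \<iota> m' c' l h i = of_nat d * A i" if i: "i < n" for i
    proof -
      have lfi: "log_form D \<iota> m' c' u' v' i = (\<Sum>k<m'. \<iota> (c' k) * (D i (u' k) / u' k)) + D i v'" by (simp add: log_form_def)
      have TrA: "of_nat d * A i = Tr (A i)" using Trs AF[OF i] G by auto
      also have "Tr (A i) = Tr (log_form D \<iota> m' c' u' v' i)" unfolding A_def lf'[OF i] ..
      also have "\<dots> = Tr ((\<Sum>k<m'. \<iota> (c' k) * (D i (u' k) / u' k)) + D i v')" unfolding lfi ..
      also have "\<dots> = (\<Sum>k<m'. \<iota> (c' k) * (D i (uN k) / uN k)) + D i vT" unfolding uN_def vT_def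
        by (rule traced[OF D_on[OF i] D_G[OF i] DE[OF i]])
      finally have e1: "of_nat d * A i = \<dots>" .
      have in3: "(\<Sum>k<m'. \<iota> (c' k) * (D i (uN k) / uN k)) + D i vT \<in> F"
        unfolding e1[symmetric] using AF[OF i] F(1) by (auto intro!: subfield_mult subfield_of_nat)
      have "(\<Sum>k<m'. \<iota> (c' k) * (D i (uN k) / uN k)) + D i vT = (\<Sum>k<m'. \<iota> (c' k) * (D i (l k) / l k)) + D i h"
      proof (rule desc[rule_format, OF D_on[OF i] _ D_t_F[OF i] _ _ _ in3])
        show "D i a \<in> F" if "a \<in> F" for a using DF[OF i that] .
        show "(if exponential then 0 else D i R / R) \<in> F" "(if exponential then D i R else 0) \<in> F"
          using DF[OF i R] R F(1) by (auto intro: subfield_intros)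
      qed simp
      then show ?thesis using e1 by (simp add: log_form_def)
    qed
    have "wedge_Omega n (log_form D \<iota> m' c' l h) P = of_nat d * wedge_Omega n (log_form D \<iota> m c u v) P"
      unfolding wedge_Omega_def sum_distrib_left by (intro sum.cong refl) (simp add: form A_def)
    moreover have "\<exists>j<n. log_form D \<iota> m' c' l h j \<noteq> 0"
    proof -
      obtain j where "j < n" "A j \<noteq> 0" using nz unfolding A_def by blast
      moreover have "of_nat d \<noteq> (0::'a)" using ch d0 unfolding CHAR_eq0_iff by blast
      ultimately show ?thesis using form by auto
    qed
    ultimately show ?thesis unfolding integrable_over_def using l h w0
      by (intro exI[of _ m'] exI[of _ c'] exI[of _ l] exI[of _ h]) simp
  qed
qed

end

section \<open>Induction down the tower\<close>

context elementary_setting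
begin

lemma integrable_over_mono:
  assumes "integrable_over A" "A \<subseteq> B" shows "integrable_over B"
proof -
  obtain m c u v where h: "v \<in> A" "\<forall>k<m. u k \<in> A \<and> u k \<noteq> 0"
    "wedge_Omega n (log_form D \<iota> m c u v) P = 0" "\<exists>j<n. log_form D \<iota> m c u v j \<noteq> 0"
    using assms(1) unfolding integrable_over_def by blast
  then have "v \<in> B" "\<forall>k<m. u k \<in> B \<and> u k \<noteq> 0" using assms(2) by auto
  then show ?thesis unfolding integrable_over_def using h(3,4) by blast
qed

lemma elementary_step_closed:
  assumes F: "subfield F" and DF: "\<And>i a. i < n \<Longrightarrow> a \<in> F \<Longrightarrow> D i a \<in> F" and st: "elementary_step n D F E"
  shows "subfield E" "F \<subseteq> E" "\<And>i a. i < n \<Longrightarrow> a \<in> E \<Longrightarrow> D i a \<in> E"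
proof -
  consider (tr) t where "E = gen_field F {t}" "\<And>i. i < n \<Longrightarrow> D i t \<in> gen_field F {t}" | (fin) "finite_ext F E"
  proof -
    have sup: "F \<subseteq> gen_field F {t}" "t \<in> gen_field F {t}" for t using gen_field_superset[of F "{t}"] by auto
    have "D i t \<in> gen_field F {t}" if "t \<noteq> 0" "R \<in> F" "\<forall>i<n. D i t / t = D i R" "i < n" for t R i
    proof -
      have "D i t = D i R * t" using that by (metis nonzero_divide_eq_eq)
      then show ?thesis using DF[OF that(4,2)] sup by (auto intro!: subfield_mult subfield_gen_field)
    qed
    moreover have "D i t \<in> gen_field F {t}" if "R \<in> F" "\<forall>i<n. D i t = D i R / R" "i < n" for t R i
      using that DF[OF that(3,1)] sup by (auto intro!: subfield_divide subfield_gen_field)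
    ultimately show ?thesis using st that unfolding elementary_step_def by blast
  qed
  then have "subfield E \<and> F \<subseteq> E \<and> (\<forall>i a. i < n \<longrightarrow> a \<in> E \<longrightarrow> D i a \<in> E)"
  proof cases
    case tr
    have sup: "F \<subseteq> gen_field F {t}" using gen_field_superset[of F "{t}"] by auto
    have "D i a \<in> E" if "i < n" "a \<in> E" for i a
      unfolding tr(1) by (rule deriv_gen_field_closed[OF F subfield_UNIV subset_UNIV D[OF that(1)]])
        (use that tr sup DF in auto)
    then show ?thesis using sup subfield_gen_field unfolding tr(1) by blast
  next
    case fin
    then have sE: "subfield E" "F \<subseteq> E" by (auto simp: finite_ext_def)
    then show ?thesis using deriv_algebraic_closed[OF ch F sE D subset_UNIV] finite_ext_subset_acl[OF fin] DF by blast
  qed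
  then show "subfield E" "F \<subseteq> E" "\<And>i a. i < n \<Longrightarrow> a \<in> E \<Longrightarrow> D i a \<in> E" by blast+
qed

text \<open>Working with closures makes a finite step trivial, and likewise an exponential or
  logarithm that happens to be algebraic. Otherwise the single-step descent is run over
  \<open>acl F\<close>.\<close>

lemma integrable_over_elementary_step:
  assumes F: "subfield F" "K \<subseteq> F" and DF: "\<And>i a. i < n \<Longrightarrow> a \<in> F \<Longrightarrow> D i a \<in> F"
    and st: "elementary_step n D F E" and E: "integrable_over (acl E)"
  shows "integrable_over (acl F)"
proof -
  have aF: "subfield (acl F)" "acl (acl F) = acl F" "F \<subseteq> acl F" "K \<subseteq> acl F"
    using subfield_acl[OF F(1)] acl_idem[OF F(1)] acl_superset[OF F(1)] F(2) by auto
  have DaF: "D i a \<in> acl F" if "i < n" "a \<in> acl F" for i a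
    using deriv_algebraic_closed[OF ch F(1) aF(1,3) D[OF that(1)] subset_UNIV that(2,2)] DF that by blast
  have step: "integrable_over (acl F)"
    if Et: "E = gen_field F {t}" and R: "R \<in> F"
      and dt: "if ex then \<forall>i<n. D i t = D i R * t else R \<noteq> 0 \<and> (\<forall>i<n. D i t = D i R / R)" for t R ex
  proof (cases "t \<in> acl F")
    case True
    then have "E \<subseteq> acl F" unfolding Et using aF by (intro gen_field_least) auto
    then have "acl E \<subseteq> acl F" using acl_mono[of E "acl F"] aF(2) by simp
    then show ?thesis using integrable_over_mono[OF E] by blast
  next
    case False
    interpret elementary_step_setting n D \<iota> x K P "acl F" t R ex
    proof unfold_locales
      show "D i a \<in> acl F" if "i < n" "a \<in> acl F" for i a by (rule DaF[OF that])
      show "R \<in> acl F" using R aF(3) by blast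
    qed (fact aF(1) aF(2) aF(4) False dt)+
    have "E \<subseteq> gen_field (acl F) {t}" unfolding Et
      using aF gen_field_superset[of "acl F" "{t}"] by (intro gen_field_least subfield_gen_field) auto
    then show ?thesis using integrable_over_descends integrable_over_mono[OF E acl_mono] by blast
  qed
  consider t R where "E = gen_field F {t}" "t \<noteq> 0" "R \<in> F" "\<forall>i<n. D i t / t = D i R"
    | t R where "E = gen_field F {t}" "R \<in> F" "R \<noteq> 0" "\<forall>i<n. D i t = D i R / R" | "finite_ext F E"
    using st unfolding elementary_step_def by blast
  then show ?thesis
  proof cases
    case (1 t R)
    have "D i t = D i R * t" if "i < n" for i using 1(2,4) that by (metis nonzero_divide_eq_eq)
    then show ?thesis using step[of t R True] 1 by simp
  next
    case (2 t R)
    then show ?thesis using step[of t R False] by simp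
  next
    case 3
    then show ?thesis using E acl_finite_ext[OF 3] by simp
  qed
qed

text \<open>Going up, each stage is shown to be a differential subfield containing \<open>K\<close>;
  going down, the property passes between the closures of successive stages.\<close>

lemma integrable_over_algebraic:
  assumes T: "T 0 = K" "\<And>i. i < N \<Longrightarrow> elementary_step n D (T i) (T (Suc i))" and "integrable_over (T N)"
  shows "integrable_over (acl K)"
proof -
  have inv: "subfield (T i) \<and> K \<subseteq> T i \<and> (\<forall>j a. j < n \<longrightarrow> a \<in> T i \<longrightarrow> D j a \<in> T i)" if "i \<le> N" for i
    using that
  proof (induction i)
    case 0
    then show ?case using T(1) subfield_K D_K by simp
  next
    case (Suc i)
    then have "elementary_step n D (T i) (T (Suc i))" using T(2) by simp
    from elementary_step_closed[OF _ _ this] Suc show ?case by (meson Suc_leD order_trans)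
  qed
  have "integrable_over (acl (T N))"
    using integrable_over_mono[OF assms(3) acl_superset] inv[of N] by blast
  moreover have "integrable_over (acl (T i))" if "i < N" "integrable_over (acl (T (Suc i)))" for i
    using integrable_over_elementary_step[OF _ _ _ T(2)[OF that(1)] that(2)] inv[of i] that(1) by simp
  ultimately have "integrable_over (acl (T 0))"
    by (rule inc_induct[of 0 N "\<lambda>i. integrable_over (acl (T i))", rotated]) auto
  then show ?thesis using T(1) by simp
qed

end

theorem theorem1:
  fixes n :: nat and D :: "nat \<Rightarrow> 'a::field \<Rightarrow> 'a"
    and \<iota> :: "complex \<Rightarrow> 'a" and x :: "nat \<Rightarrow> 'a" and K :: "'a set"
    and P :: "nat \<Rightarrow> 'a"
    and m :: nat and c :: "nat \<Rightarrow> complex" and u :: "nat \<Rightarrow> 'a" and v :: 'a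
  assumes "commuting_derivations n D"
    and "rational_function_field n D \<iota> x K"
    and "elementary_over n D K"
    and "\<forall>i<n. P i \<in> K"
    and "\<forall>k<m. u k \<noteq> 0"
    and "wedge_Omega n (log_form D \<iota> m c u v) P = 0"
    and "\<exists>j<n. log_form D \<iota> m c u v j \<noteq> 0"
  shows "\<exists>Lt. finite_ext K Lt \<and>
           (\<exists>m' c' u' v'. v' \<in> Lt \<and> (\<forall>k<m'. u' k \<in> Lt \<and> u' k \<noteq> 0) \<and>
              wedge_Omega n (log_form D \<iota> m' c' u' v') P = 0 \<and>
              (\<exists>j<n. log_form D \<iota> m' c' u' v' j \<noteq> 0))"
proof -
  interpret elementary_setting n D \<iota> x K P
    by unfold_locales (use assms in \<open>auto simp: elementary_over_def\<close>)
  obtain N T where T: "T 0 = K" "T N = UNIV" "\<forall>i<N. elementary_step n D (T i) (T (Suc i))"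
    using assms(3) unfolding elementary_over_def by blast
  have "integrable_over (T N)" unfolding T(2) integrable_over_def using assms(5-7) by blast
  then have "integrable_over (acl K)" using integrable_over_algebraic[of T N] T by blast
  then obtain m' c' u' v' where h: "v' \<in> acl K" "\<forall>k<m'. u' k \<in> acl K \<and> u' k \<noteq> 0"
    "wedge_Omega n (log_form D \<iota> m' c' u' v') P = 0" "\<exists>j<n. log_form D \<iota> m' c' u' v' j \<noteq> 0"
    unfolding integrable_over_def by blast
  \<comment> \<open>The descended form involves finitely many algebraic elements, so one finite
    extension of \<open>K\<close> holds them all.\<close>
  obtain Lt where Lt: "finite_ext K Lt" "insert v' (u' ` {..<m'}) \<subseteq> Lt"
    using finite_ext_containing[OF subfield_K, of "insert v' (u' ` {..<m'})"] h by auto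
  then have "v' \<in> Lt" "\<forall>k<m'. u' k \<in> Lt \<and> u' k \<noteq> 0" using h(2) by auto
  then show ?thesis using Lt(1) h(3,4) by blast
qed

end
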